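(* Consider the $k$-center problem with $z$ outliers in the sliding-window model, for streams of points from a metric space with doubling dimension $d$ (a fixed constant). Let $\Delta_{\min}$ and $\Delta_{\max}$ be given (lower and upper) bounds on the minimum and maximum distance between any two distinct points in the stream, and let $\sigma:=\Delta_{\max}/\Delta_{\min}$ be (an upper bound on) the spread of the stream. Suppose we have a $c$-approximation algorithm for the static version of the problem that runs in $T_{k,z}(n)$ time on a set of $n$ points. Then for any $0<\varepsilon<1$ we can maintain a sketch with the following properties: (1) The sketch uses $O((kz/\varepsilon^d)\log\sigma)$ storage. (2) Departures and arrivals of points can be handled in $O(\log\sigma)$ and $O((kz/\varepsilon^d)^3\log\sigma)$ time, respectively. (3) At any time $t$, the algorithm can report a valid solution for $P(t)$ of cost at most $(1+\varepsilon)c\cdot\mathrm{opt}_{k,z}(P(t))$. The time needed to compute the solution is $T_{k,z}(n)$, where $n:=O(kz/\varepsilon^d)$.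
   Context: The doubling dimension of a metric space is the smallest $d$ such that every ball $B$ can be covered by $2^d$ balls of radius $\mathrm{radius}(B)/2$. The distance between any two given points can be computed in $O(1)$ time. Sliding-window model: a possibly infinite stream $P=\langle p_1,p_2,\ldots\rangle$ of points (repetitions allowed, sets are multisets) arrives over time; $p_i$ arrives at time $t_{\mathrm{arr}}(p_i)$ and expires (departs) at time $t_{\mathrm{exp}}(p_i):=t_{\mathrm{arr}}(p_i)+W$, where $W$ is the given window length; all arrival and expiration times are distinct. $P(t):=\{p_i: t_{\mathrm{arr}}(p_i)\le t<t_{\mathrm{exp}}(p_i)\}$. The algorithm has no knowledge of future arrivals, knows $\Delta_{\min}$ and $\Delta_{\max}$, and maintains a data structure (the sketch) under arrivals and departures. A valid solution for a finite multiset $Q$ is a collection of $k$ balls of equal radius that together cover all points of $Q$ except at most $z$ outliers; its cost is the radius of the balls; $\mathrm{opt}_{k,z}(Q)$ is the smallest cost of a valid solution for $Q$. A $c$-approximation algorithm for the static problem reports, for a given finite $Q$, a valid solution of cost at most $c\cdot\mathrm{opt}_{k,z}(Q)$. Storage is the number of objects (points, balls) stored. Constants hidden in $O(\cdot)$ may depend on $d$; when $z=0$, $kz$ in the bounds is to be read as $k(z+1)$. *)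

theory Defs
  imports "HOL-Analysis.Analysis" "HOL-Library.Multiset" "HOL-Library.Extended_Nat"
begin

definition doubling_bound :: "'a set \<Rightarrow> ('a \<Rightarrow> 'a \<Rightarrow> real) \<Rightarrow> real \<Rightarrow> bool" where
  "doubling_bound M \<delta> d \<longleftrightarrow>
     (\<forall>x\<in>M. \<forall>r>0. \<exists>C\<subseteq>M. finite C \<and> real (card C) \<le> 2 powr d \<and>
        Metric_space.mcball M \<delta> x r \<subseteq> (\<Union>y\<in>C. Metric_space.mcball M \<delta> y (r / 2)))"

text \<open>The dimension is a real number, so a space in which balls can be covered by three but not by
  two balls of half the radius has dimension \<open>log 2 3\<close>. The empty space has no dimension.\<close>

definition doubling_dimension :: "'a set \<Rightarrow> ('a \<Rightarrow> 'a \<Rightarrow> real) \<Rightarrow> real \<Rightarrow> bool" where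
  "doubling_dimension M \<delta> d \<longleftrightarrow>
     doubling_bound M \<delta> d \<and> (\<forall>d'. doubling_bound M \<delta> d' \<longrightarrow> d \<le> d')"

text \<open>A solution is a list of centers, which may be any points of the space and may repeat,
  together with the common radius of the closed balls.\<close>

definition valid_solution ::
  "'a set \<Rightarrow> ('a \<Rightarrow> 'a \<Rightarrow> real) \<Rightarrow> nat \<Rightarrow> nat \<Rightarrow> 'a multiset \<Rightarrow> 'a list \<Rightarrow> real \<Rightarrow> bool" where
  "valid_solution M \<delta> k z Q cs r \<longleftrightarrow>
     length cs = k \<and> set cs \<subseteq> M \<and> 0 \<le> r \<and>
     size (filter_mset (\<lambda>q. q \<notin> (\<Union>y\<in>set cs. Metric_space.mcball M \<delta> y r)) Q) \<le> z"

text \<open>An infimum, because in a general metric space the smallest cost need not be attained.\<close>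

definition opt :: "'a set \<Rightarrow> ('a \<Rightarrow> 'a \<Rightarrow> real) \<Rightarrow> nat \<Rightarrow> nat \<Rightarrow> 'a multiset \<Rightarrow> real" where
  "opt M \<delta> k z Q = Inf {r. \<exists>cs. valid_solution M \<delta> k z Q cs r}"

definition static_approx ::
  "'a set \<Rightarrow> ('a \<Rightarrow> 'a \<Rightarrow> real) \<Rightarrow> nat \<Rightarrow> nat \<Rightarrow> real \<Rightarrow> ('a list \<Rightarrow> 'a list \<times> real) \<Rightarrow> bool" where
  "static_approx M \<delta> k z c A \<longleftrightarrow>
     (\<forall>qs cs r. set qs \<subseteq> M \<and> A qs = (cs, r) \<longrightarrow>
        valid_solution M \<delta> k z (mset qs) cs r \<and> r \<le> c * opt M \<delta> k z (mset qs))"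

text \<open>A stream of length \<open>len\<close> (possibly infinite) consists of points \<open>p i\<close> with arrival times
  \<open>ta i\<close>, for \<open>i < len\<close>; values at other indices are irrelevant. The last
  condition says that only finitely many points have arrived at any time.\<close>

definition window_stream ::
  "'a set \<Rightarrow> real \<Rightarrow> enat \<Rightarrow> (nat \<Rightarrow> 'a) \<Rightarrow> (nat \<Rightarrow> real) \<Rightarrow> bool" where
  "window_stream M W len p ta \<longleftrightarrow>
     0 < W \<and>
     (\<forall>i. enat i < len \<longrightarrow> p i \<in> M) \<and>
     (\<forall>i j. i < j \<and> enat j < len \<longrightarrow> ta i < ta j) \<and>
     (\<forall>i j. enat i < len \<and> enat j < len \<longrightarrow> ta i \<noteq> ta j + W) \<and>
     (\<forall>t. finite {i. enat i < len \<and> ta i \<le> t})"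

definition window :: "real \<Rightarrow> enat \<Rightarrow> (nat \<Rightarrow> 'a) \<Rightarrow> (nat \<Rightarrow> real) \<Rightarrow> real \<Rightarrow> 'a multiset" where
  "window W len p ta t =
     image_mset p (mset_set {i. enat i < len \<and> ta i \<le> t \<and> t < ta i + W})"

definition event_times :: "real \<Rightarrow> enat \<Rightarrow> (nat \<Rightarrow> real) \<Rightarrow> real set" where
  "event_times W len ta = {ta i | i. enat i < len} \<union> {ta i + W | i. enat i < len}"

definition next_event :: "real \<Rightarrow> enat \<Rightarrow> (nat \<Rightarrow> real) \<Rightarrow> real \<Rightarrow> real \<Rightarrow> bool" where
  "next_event W len ta t u \<longleftrightarrow>
     t < u \<and> u \<in> event_times W len ta \<and> (\<forall>e\<in>event_times W len ta. \<not> (t < e \<and> e < u))"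

text \<open>Algorithms are programs of a real RAM with an additional type of points. Points are opaque:
  they can only be copied, passed to the distance function, and handed to the static algorithm,
  which is available as a subroutine. There are no real or point constants, no rounding and no
  integer division.

  The memory consists of named arrays; a scalar variable is the cell with index 0 of its array.
  A cell is absent until it is first written, and cells are never released.\<close>

type_synonym loc = "string \<times> nat"

record 'a mem =
  nats :: "loc \<rightharpoonup> nat"
  reals :: "loc \<rightharpoonup> real"
  points :: "loc \<rightharpoonup> 'a"

datatype nexp =
    NConst nat
  | NCell string nexp
  | NAdd nexp nexp
  | NSub nexp nexp
  | NMul nexp nexp

datatype pexp = PCell string nexp

datatype rexp =
    ROf nexp
  | RCell string nexp
  | RAdd rexp rexp
  | RSub rexp rexp
  | RMul rexp rexp
  | RDiv rexp rexp
  | RDist pexp pexp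

datatype bexp =
    NLess nexp nexp
  | RLess rexp rexp
  | BNot bexp
  | BAnd bexp bexp

datatype com =
    Skip
  | NAssign string nexp nexp
  | RAssign string nexp rexp
  | PAssign string nexp pexp
  | Seq com com
  | Cond bexp com com
  | While bexp com
  | Solve string nexp nexp string string

text \<open>Reading an absent cell gives 0 for numbers and an unspecified object for points.\<close>

primrec nval :: "nexp \<Rightarrow> 'a mem \<Rightarrow> nat" where
  "nval (NConst n) s = n"
| "nval (NCell x i) s = (case nats s (x, nval i s) of None \<Rightarrow> 0 | Some n \<Rightarrow> n)"
| "nval (NAdd a b) s = nval a s + nval b s"
| "nval (NSub a b) s = nval a s - nval b s"
| "nval (NMul a b) s = nval a s * nval b s"

primrec pval :: "pexp \<Rightarrow> 'a mem \<Rightarrow> 'a" where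
  "pval (PCell x i) s = the (points s (x, nval i s))"

primrec rval :: "('a \<Rightarrow> 'a \<Rightarrow> real) \<Rightarrow> rexp \<Rightarrow> 'a mem \<Rightarrow> real" where
  "rval \<delta> (ROf a) s = real (nval a s)"
| "rval \<delta> (RCell x i) s = (case reals s (x, nval i s) of None \<Rightarrow> 0 | Some r \<Rightarrow> r)"
| "rval \<delta> (RAdd a b) s = rval \<delta> a s + rval \<delta> b s"
| "rval \<delta> (RSub a b) s = rval \<delta> a s - rval \<delta> b s"
| "rval \<delta> (RMul a b) s = rval \<delta> a s * rval \<delta> b s"
| "rval \<delta> (RDiv a b) s = rval \<delta> a s / rval \<delta> b s"
| "rval \<delta> (RDist a b) s = \<delta> (pval a s) (pval b s)"

primrec bval :: "('a \<Rightarrow> 'a \<Rightarrow> real) \<Rightarrow> bexp \<Rightarrow> 'a mem \<Rightarrow> bool" where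
  "bval \<delta> (NLess a b) s \<longleftrightarrow> nval a s < nval b s"
| "bval \<delta> (RLess a b) s \<longleftrightarrow> rval \<delta> a s < rval \<delta> b s"
| "bval \<delta> (BNot b) s \<longleftrightarrow> \<not> bval \<delta> b s"
| "bval \<delta> (BAnd a b) s \<longleftrightarrow> bval \<delta> a s \<and> bval \<delta> b s"

definition write_nat :: "loc \<Rightarrow> nat \<Rightarrow> 'a mem \<Rightarrow> 'a mem" where
  "write_nat l v s = s\<lparr>nats := (nats s)(l \<mapsto> v)\<rparr>"

definition write_real :: "loc \<Rightarrow> real \<Rightarrow> 'a mem \<Rightarrow> 'a mem" where
  "write_real l v s = s\<lparr>reals := (reals s)(l \<mapsto> v)\<rparr>"

definition write_point :: "loc \<Rightarrow> 'a \<Rightarrow> 'a mem \<Rightarrow> 'a mem" where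
  "write_point l v s = s\<lparr>points := (points s)(l \<mapsto> v)\<rparr>"

definition write_points :: "string \<Rightarrow> 'a list \<Rightarrow> 'a mem \<Rightarrow> 'a mem" where
  "write_points x vs s =
     s\<lparr>points := (\<lambda>(y, j). if y = x \<and> j < length vs then Some (vs ! j) else points s (y, j))\<rparr>"

definition read_points :: "string \<Rightarrow> nat \<Rightarrow> nat \<Rightarrow> 'a mem \<Rightarrow> 'a list" where
  "read_points x i n s = map (\<lambda>j. the (points s (x, i + j))) [0..<n]"

text \<open>\<open>exec \<delta> A T c s m s'\<close>: the program \<open>c\<close>, started with memory \<open>s\<close>, terminates after time \<open>m\<close>
  with memory \<open>s'\<close>. Expressions have constant size, so every assignment and every test takes
  one time unit, including the distance computations in it. \<open>Solve x i n y r\<close> runs the static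
  algorithm \<open>A\<close> on the \<open>n\<close> points in the array \<open>x\<close> from index \<open>i\<close> on; this takes \<open>T n\<close> time, and
  leaves the centers in the array \<open>y\<close> and the radius in the variable \<open>r\<close>.\<close>

inductive exec ::
  "('a \<Rightarrow> 'a \<Rightarrow> real) \<Rightarrow> ('a list \<Rightarrow> 'a list \<times> real) \<Rightarrow> (nat \<Rightarrow> nat) \<Rightarrow>
   com \<Rightarrow> 'a mem \<Rightarrow> nat \<Rightarrow> 'a mem \<Rightarrow> bool"
  for \<delta> A T where
  Skip: "exec \<delta> A T Skip s 1 s"
| NAssign: "exec \<delta> A T (NAssign x i a) s 1 (write_nat (x, nval i s) (nval a s) s)"
| RAssign: "exec \<delta> A T (RAssign x i a) s 1 (write_real (x, nval i s) (rval \<delta> a s) s)"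
| PAssign: "exec \<delta> A T (PAssign x i a) s 1 (write_point (x, nval i s) (pval a s) s)"
| Seq: "exec \<delta> A T c1 s m1 s1 \<Longrightarrow> exec \<delta> A T c2 s1 m2 s2 \<Longrightarrow>
    exec \<delta> A T (Seq c1 c2) s (m1 + m2) s2"
| CondTrue: "bval \<delta> b s \<Longrightarrow> exec \<delta> A T c1 s m s' \<Longrightarrow> exec \<delta> A T (Cond b c1 c2) s (1 + m) s'"
| CondFalse: "\<not> bval \<delta> b s \<Longrightarrow> exec \<delta> A T c2 s m s' \<Longrightarrow> exec \<delta> A T (Cond b c1 c2) s (1 + m) s'"
| WhileFalse: "\<not> bval \<delta> b s \<Longrightarrow> exec \<delta> A T (While b c) s 1 s"
| WhileTrue: "bval \<delta> b s \<Longrightarrow> exec \<delta> A T c s m1 s1 \<Longrightarrow> exec \<delta> A T (While b c) s1 m2 s2 \<Longrightarrow>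
    exec \<delta> A T (While b c) s (1 + m1 + m2) s2"
| Solve: "A (read_points x (nval i s) (nval n s) s) = (cs, v) \<Longrightarrow>
    exec \<delta> A T (Solve x i n y r) s (T (nval n s)) (write_real (r, 0) v (write_points y cs s))"

text \<open>All cells count, not only those that hold points. Reachable memories have finitely many cells,
  and since cells are never released, the storage between two operations also bounds the working
  space of the operations before.\<close>

definition storage :: "'a mem \<Rightarrow> nat" where
  "storage s = card (dom (nats s)) + card (dom (reals s)) + card (dom (points s))"

record sketch_alg =
  on_init :: com
  on_arrival :: com
  on_departure :: com
  on_report :: com

definition input_mem :: "nat \<Rightarrow> nat \<Rightarrow> real \<Rightarrow> real \<Rightarrow> real \<Rightarrow> real \<Rightarrow> 'a mem" where
  "input_mem k z \<epsilon> \<Delta>min \<Delta>max W =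
     \<lparr>nats = [(''k'', 0) \<mapsto> k, (''z'', 0) \<mapsto> z],
      reals = [(''eps'', 0) \<mapsto> \<epsilon>, (''dmin'', 0) \<mapsto> \<Delta>min, (''dmax'', 0) \<mapsto> \<Delta>max, (''W'', 0) \<mapsto> W],
      points = Map.empty\<rparr>"

text \<open>Every operation is told the current time, and an arrival also the new point. A departure is
  not told which point expires, since that point need not be stored in the sketch.\<close>

definition load_time :: "real \<Rightarrow> 'a mem \<Rightarrow> 'a mem" where
  "load_time t s = write_real (''now'', 0) t s"

definition load_arrival :: "real \<Rightarrow> 'a \<Rightarrow> 'a mem \<Rightarrow> 'a mem" where
  "load_arrival t q s = write_point (''new'', 0) q (load_time t s)"

definition reported_centers :: "nat \<Rightarrow> 'a mem \<Rightarrow> 'a list" where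
  "reported_centers k s = read_points ''centers'' 0 k s"

definition reported_radius :: "'a mem \<Rightarrow> real" where
  "reported_radius s = the (reals s (''radius'', 0))"

text \<open>\<open>sketch_at \<dots> t s\<close>: at time \<open>t\<close>, when exactly the events up to and including time \<open>t\<close> have been
  handled, and solutions have been requested at arbitrary moments, the memory can be \<open>s\<close>.\<close>

inductive sketch_at ::
  "('a \<Rightarrow> 'a \<Rightarrow> real) \<Rightarrow> ('a list \<Rightarrow> 'a list \<times> real) \<Rightarrow> (nat \<Rightarrow> nat) \<Rightarrow> sketch_alg \<Rightarrow> 'a mem \<Rightarrow>
   real \<Rightarrow> enat \<Rightarrow> (nat \<Rightarrow> 'a) \<Rightarrow> (nat \<Rightarrow> real) \<Rightarrow> real \<Rightarrow> 'a mem \<Rightarrow> bool"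
  for \<delta> A T alg s0 W len p ta where
  start: "exec \<delta> A T (on_init alg) s0 m s \<Longrightarrow> \<forall>e\<in>event_times W len ta. t < e \<Longrightarrow>
    sketch_at \<delta> A T alg s0 W len p ta t s"
| wait: "sketch_at \<delta> A T alg s0 W len p ta t s \<Longrightarrow> t \<le> u \<Longrightarrow>
    \<forall>e\<in>event_times W len ta. \<not> (t < e \<and> e \<le> u) \<Longrightarrow>
    sketch_at \<delta> A T alg s0 W len p ta u s"
| arrival: "sketch_at \<delta> A T alg s0 W len p ta t s \<Longrightarrow> enat i < len \<Longrightarrow>
    next_event W len ta t (ta i) \<Longrightarrow>
    exec \<delta> A T (on_arrival alg) (load_arrival (ta i) (p i) s) m s' \<Longrightarrow>
    sketch_at \<delta> A T alg s0 W len p ta (ta i) s'"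
| departure: "sketch_at \<delta> A T alg s0 W len p ta t s \<Longrightarrow> enat i < len \<Longrightarrow>
    next_event W len ta t (ta i + W) \<Longrightarrow>
    exec \<delta> A T (on_departure alg) (load_time (ta i + W) s) m s' \<Longrightarrow>
    sketch_at \<delta> A T alg s0 W len p ta (ta i + W) s'"
| report: "sketch_at \<delta> A T alg s0 W len p ta t s \<Longrightarrow>
    exec \<delta> A T (on_report alg) (load_time t s) m s' \<Longrightarrow>
    sketch_at \<delta> A T alg s0 W len p ta t s'"

definition kz :: "nat \<Rightarrow> nat \<Rightarrow> nat" where
  "kz k z = (if z = 0 then k * (z + 1) else k * z)"

text \<open>As usual in asymptotic bounds, \<open>log \<sigma>\<close> stands for 1 where it would be smaller.\<close>

definition log_spread :: "real \<Rightarrow> real" where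
  "log_spread \<sigma> = max 1 (log 2 \<sigma>)"

end

theory Submission
  imports Defs
begin

text \<open>For the guesses \<open>\<rho> = 0\<close> and \<open>\<rho> = 2 ^ i * \<Delta>min / 2\<close> of the optimal cost, the sketch keeps a list of
  alive points, each labelled with a center at distance at most \<open>\<epsilon> * \<rho> / 4\<close>. Distinct centers are further
  apart than that, so if the optimal cost is at most \<open>\<rho>\<close>, then by the doubling property all points but the
  \<open>z\<close> outliers have only \<open>O(k / \<epsilon>^d)\<close> centers. It suffices to keep the \<open>z + 1\<close> latest points of
  every center: a solution for the kept points must cover one of them, hence covers the dropped ones after
  enlarging its balls by \<open>\<epsilon> * \<rho> / 2\<close>. A list is therefore longer than \<open>L = O(k (z + 1) / \<epsilon>^d)\<close> only if
  the optimal cost exceeds \<open>\<rho>\<close>. If it would reach \<open>L + 2\<close> points, the oldest is dropped; this is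
  harmless, because the list only becomes usable again when \<open>L\<close> points are left, and by then all points
  older than those have expired. The report uses the smallest guess whose list has at most \<open>L\<close> points.\<close>

section \<open>Executions\<close>

text \<open>The guess zero rests on a gap: a ball of radius below \<open>\<Delta>min / 2\<close>
  covers at most one location of the stream, so the optimal cost is 0 or at least
  \<open>\<Delta>min / 2\<close>. From there the guesses double. A list that is too long shows that
  its guess is below the optimum up to the first positive guess, so the smallest usable positive
  \<rho> is at most twice the optimum, and enlarging the balls by \<epsilon>\<rho>/2 costs at most
  \<epsilon> times the optimum. A dropped point is reached from a kept one in two steps through
  their common center, which fixes the label distance at \<epsilon>\<rho>/4. The cost model shapes
  the program. Cells are never released, so every list lives in a block of fixed size. Departures
  have constant time per guess, so compaction is left to arrivals. Without rounding or logarithms,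
  the parameters \<open>J\<close> and \<open>I\<close> are found by doubling.\<close>

lemma exec_deterministic:
  assumes "exec \<delta> A T c s m s'" "exec \<delta> A T c s n s''"
  shows "m = n \<and> s' = s''"
  using assms
proof (induction arbitrary: n s'' rule: exec.induct)
  case (Seq c1 s m1 s1 c2 m2 s2)
  from Seq.prems show ?case by (cases rule: exec.cases) (use Seq.IH in blast)+
next
  case (CondTrue b s c1 m s' c2)
  from CondTrue.prems show ?case by (cases rule: exec.cases) (use CondTrue in blast)+
next
  case (CondFalse b s c2 m s' c1)
  from CondFalse.prems show ?case by (cases rule: exec.cases) (use CondFalse in blast)+
next
  case (WhileFalse b s c)
  from WhileFalse.prems show ?case by (cases rule: exec.cases) (use WhileFalse in blast)+
next
  case (WhileTrue b s c m1 s1 m2 s2)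
  from WhileTrue.prems show ?case by (cases rule: exec.cases) (use WhileTrue in blast)+
next
  case (Solve x i s n cs v y r)
  from Solve.prems show ?case by (cases rule: exec.cases) (use Solve in auto)
next
  case (Skip s)
  from Skip.prems show ?case by (cases rule: exec.cases) auto
next
  case (NAssign x i a s)
  from NAssign.prems show ?case by (cases rule: exec.cases) auto
next
  case (RAssign x i a s)
  from RAssign.prems show ?case by (cases rule: exec.cases) auto
next
  case (PAssign x i a s)
  from PAssign.prems show ?case by (cases rule: exec.cases) auto
qed

text \<open>Without loops the final memory is a function of the initial one and the time has a
  syntactic bound, so such code is verified by rewriting with \<open>sem\<close>.
  \<open>Solve\<close> is excluded as well, since its effect and time come from \<open>A\<close> and
  \<open>T\<close>.\<close>

primrec loop_free :: "com \<Rightarrow> bool" where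
  "loop_free Skip \<longleftrightarrow> True"
| "loop_free (NAssign x i a) \<longleftrightarrow> True"
| "loop_free (RAssign x i a) \<longleftrightarrow> True"
| "loop_free (PAssign x i a) \<longleftrightarrow> True"
| "loop_free (Seq c1 c2) \<longleftrightarrow> loop_free c1 \<and> loop_free c2"
| "loop_free (Cond b c1 c2) \<longleftrightarrow> loop_free c1 \<and> loop_free c2"
| "loop_free (While b c) \<longleftrightarrow> False"
| "loop_free (Solve x i n y r) \<longleftrightarrow> False"

text \<open>On the last two constructors, \<open>cost\<close> and \<open>sem\<close> are junk.\<close>

primrec cost :: "com \<Rightarrow> nat" where
  "cost Skip = 1"
| "cost (NAssign x i a) = 1"
| "cost (RAssign x i a) = 1"
| "cost (PAssign x i a) = 1"
| "cost (Seq c1 c2) = cost c1 + cost c2"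
| "cost (Cond b c1 c2) = 1 + max (cost c1) (cost c2)"
| "cost (While b c) = 0"
| "cost (Solve x i n y r) = 0"

primrec sem :: "('a \<Rightarrow> 'a \<Rightarrow> real) \<Rightarrow> com \<Rightarrow> 'a mem \<Rightarrow> 'a mem" where
  "sem \<delta> Skip s = s"
| "sem \<delta> (NAssign x i a) s = write_nat (x, nval i s) (nval a s) s"
| "sem \<delta> (RAssign x i a) s = write_real (x, nval i s) (rval \<delta> a s) s"
| "sem \<delta> (PAssign x i a) s = write_point (x, nval i s) (pval a s) s"
| "sem \<delta> (Seq c1 c2) s = sem \<delta> c2 (sem \<delta> c1 s)"
| "sem \<delta> (Cond b c1 c2) s = (if bval \<delta> b s then sem \<delta> c1 s else sem \<delta> c2 s)"
| "sem \<delta> (While b c) s = s"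
| "sem \<delta> (Solve x i n y r) s = s"

lemma loop_free_exec:
  assumes "loop_free c"
  shows "\<exists>m\<le>cost c. exec \<delta> A T c s m (sem \<delta> c s)"
  using assms
proof (induction c arbitrary: s)
  case (Seq c1 c2)
  then obtain m1 m2 where "m1 \<le> cost c1" "exec \<delta> A T c1 s m1 (sem \<delta> c1 s)"
    "m2 \<le> cost c2" "exec \<delta> A T c2 (sem \<delta> c1 s) m2 (sem \<delta> (Seq c1 c2) s)"
    by fastforce
  then show ?case by (auto intro!: exI[of _ "m1 + m2"] exec.Seq)
next
  case (Cond b c1 c2)
  then obtain m1 m2 where m: "m1 \<le> cost c1" "exec \<delta> A T c1 s m1 (sem \<delta> c1 s)"
    "m2 \<le> cost c2" "exec \<delta> A T c2 s m2 (sem \<delta> c2 s)"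
    by fastforce
  show ?case
  proof (cases "bval \<delta> b s")
    case True
    then show ?thesis using m by (auto intro!: exI[of _ "1 + m1"] exec.CondTrue[simplified])
  next
    case False
    then show ?thesis using m by (auto intro!: exI[of _ "1 + m2"] exec.CondFalse[simplified])
  qed
qed (auto intro!: exI[of _ "Suc 0"] exec.Skip[simplified] exec.NAssign[simplified]
      exec.RAssign[simplified] exec.PAssign[simplified])

section \<open>Total correctness with an upper bound on the time\<close>

definition wp where
  "wp \<delta> A T c b Q s \<longleftrightarrow> (\<exists>m s'. exec \<delta> A T c s m s' \<and> m \<le> b \<and> Q s')"

lemma wp_mono:
  "wp \<delta> A T c b Q s \<Longrightarrow> b \<le> b' \<Longrightarrow> (\<And>s'. Q s' \<Longrightarrow> Q' s') \<Longrightarrow> wp \<delta> A T c b' Q' s"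
  unfolding wp_def by (meson order_trans)

lemma wp_loop_free: "loop_free c \<Longrightarrow> Q (sem \<delta> c s) \<Longrightarrow> wp \<delta> A T c (cost c) Q s"
  unfolding wp_def using loop_free_exec by blast

lemma wp_Seq: "wp \<delta> A T c1 b1 (wp \<delta> A T c2 b2 Q) s \<Longrightarrow> wp \<delta> A T (Seq c1 c2) (b1 + b2) Q s"
  unfolding wp_def by (meson add_mono exec.Seq)

text \<open>Every loop of the sketch has an iteration count \<open>K\<close> fixed beforehand, so
  the invariant is indexed by the number of finished rounds, which also gives termination. A round
  pays one test and \<open>B\<close>; the leading 1 is the last, failing test.\<close>

lemma wp_While:
  assumes "I 0 s"
    and "\<And>n s. n < K \<Longrightarrow> I n s \<Longrightarrow> bval \<delta> b s \<and> wp \<delta> A T c B (I (Suc n)) s"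
    and "\<And>s. I K s \<Longrightarrow> \<not> bval \<delta> b s"
  shows "wp \<delta> A T (While b c) (1 + K * (1 + B)) (I K) s"
proof -
  have "wp \<delta> A T (While b c) (1 + (K - n) * (1 + B)) (I K) s" if "n \<le> K" "I n s" for n s
    using that
  proof (induction "K - n" arbitrary: n s)
    case 0
    then have "n = K" by simp
    then have "\<not> bval \<delta> b s" using 0 assms(3) by blast
    then show ?case unfolding wp_def using exec.WhileFalse 0 \<open>n = K\<close>
      by (metis le_add1)
  next
    case (Suc x)
    then have b: "bval \<delta> b s" and c: "wp \<delta> A T c B (I (Suc n)) s"
      using assms(2)[of n s] by auto
    from c obtain m s1 where m: "exec \<delta> A T c s m s1" "m \<le> B" "I (Suc n) s1"
      unfolding wp_def by auto
    have "wp \<delta> A T (While b c) (1 + (K - Suc n) * (1 + B)) (I K) s1"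
      using Suc m by auto
    then obtain m' s2 where m': "exec \<delta> A T (While b c) s1 m' s2"
      "m' \<le> 1 + (K - Suc n) * (1 + B)" "I K s2"
      unfolding wp_def by auto
    have "K - n = Suc (K - Suc n)" using Suc by linarith
    then have "1 + m + m' \<le> 1 + (K - n) * (1 + B)" using m m' by simp
    then show ?case unfolding wp_def using exec.WhileTrue[OF b m(1) m'(1)] m'(3) by blast
  qed
  from this[of 0 s] show ?thesis using assms(1) by simp
qed

lemma wp_While_loop_free:
  assumes "loop_free c" "I 0 s"
    and "\<And>n s. n < K \<Longrightarrow> I n s \<Longrightarrow> bval \<delta> b s \<and> I (Suc n) (sem \<delta> c s)"
    and "\<And>s. I K s \<Longrightarrow> \<not> bval \<delta> b s"
  shows "wp \<delta> A T (While b c) (1 + K * (1 + cost c)) (I K) s"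
  by (rule wp_While) (use assms in \<open>auto intro: wp_loop_free\<close>)

section \<open>Reading memory, frames and footprints\<close>

definition NV :: "'a mem \<Rightarrow> string \<Rightarrow> nat \<Rightarrow> nat" where
  "NV s x i = (case nats s (x, i) of None \<Rightarrow> 0 | Some n \<Rightarrow> n)"

definition RV :: "'a mem \<Rightarrow> string \<Rightarrow> nat \<Rightarrow> real" where
  "RV s x i = (case reals s (x, i) of None \<Rightarrow> 0 | Some r \<Rightarrow> r)"

definition PV :: "'a mem \<Rightarrow> string \<Rightarrow> nat \<Rightarrow> 'a" where
  "PV s x i = the (points s (x, i))"

lemma val_cell [simp]:
  "nval (NCell x i) s = NV s x (nval i s)"
  "rval \<delta> (RCell x i) s = RV s x (nval i s)"
  "pval (PCell x i) s = PV s x (nval i s)"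
  by (simp_all add: NV_def RV_def PV_def)

declare nval.simps(2) [simp del] rval.simps(2) [simp del] pval.simps [simp del]

lemma val_write [simp]:
  "NV (write_nat (x, i) n s) y j = (if y = x \<and> j = i then n else NV s y j)"
  "RV (write_nat (x, i) n s) y j = RV s y j"
  "PV (write_nat (x, i) n s) y j = PV s y j"
  "NV (write_real (x, i) r s) y j = NV s y j"
  "RV (write_real (x, i) r s) y j = (if y = x \<and> j = i then r else RV s y j)"
  "PV (write_real (x, i) r s) y j = PV s y j"
  "NV (write_point (x, i) q s) y j = NV s y j"
  "RV (write_point (x, i) q s) y j = RV s y j"
  "PV (write_point (x, i) q s) y j = (if y = x \<and> j = i then q else PV s y j)"
  "NV (write_points x qs s) y j = NV s y j"
  "RV (write_points x qs s) y j = RV s y j"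
  "PV (write_points x qs s) y j = (if y = x \<and> j < length qs then qs ! j else PV s y j)"
  by (auto simp: NV_def RV_def PV_def write_nat_def write_real_def write_point_def write_points_def)

text \<open>A frame condition by array name. It compares the values read rather than the cells, so
  an absent number and a stored 0 count as equal.\<close>

definition agree :: "string set \<Rightarrow> 'a mem \<Rightarrow> 'a mem \<Rightarrow> bool" where
  "agree X s s' \<longleftrightarrow> (\<forall>x i. x \<notin> X \<longrightarrow> NV s' x i = NV s x i \<and> RV s' x i = RV s x i \<and> PV s' x i = PV s x i)"

lemma agree_refl [simp]: "agree X s s"
  by (simp add: agree_def)

lemma agree_write [simp]:
  "x \<in> X \<Longrightarrow> agree X s s' \<Longrightarrow> agree X s (write_nat (x, i) n s')"
  "x \<in> X \<Longrightarrow> agree X s s' \<Longrightarrow> agree X s (write_real (x, i) r s')"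
  "x \<in> X \<Longrightarrow> agree X s s' \<Longrightarrow> agree X s (write_point (x, i) q s')"
  "x \<in> X \<Longrightarrow> agree X s s' \<Longrightarrow> agree X s (write_points x qs s')"
  by (auto simp: agree_def)

lemma agree_trans: "agree X s s' \<Longrightarrow> agree Y s' s'' \<Longrightarrow> X \<union> Y \<subseteq> Z \<Longrightarrow> agree Z s s''"
  unfolding agree_def by (metis UnI1 UnI2 subset_iff)

lemma agreeD:
  assumes "agree X s s'" "x \<notin> X"
  shows "NV s' x i = NV s x i" "RV s' x i = RV s x i" "PV s' x i = PV s x i"
  using assms by (auto simp: agree_def)

text \<open>Since cells are never released, storage is bounded through a fixed rectangle of names
  and indices that every write respects. \<open>storage_le\<close> counts it once for each of the
  three cell types.\<close>

definition fits :: "string set \<Rightarrow> nat \<Rightarrow> 'a mem \<Rightarrow> bool" where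
  "fits X B s \<longleftrightarrow> dom (nats s) \<subseteq> X \<times> {..<B} \<and> dom (reals s) \<subseteq> X \<times> {..<B} \<and>
     dom (points s) \<subseteq> X \<times> {..<B}"

lemma fits_write [simp]:
  "x \<in> X \<Longrightarrow> i < B \<Longrightarrow> fits X B s \<Longrightarrow> fits X B (write_nat (x, i) n s)"
  "x \<in> X \<Longrightarrow> i < B \<Longrightarrow> fits X B s \<Longrightarrow> fits X B (write_real (x, i) r s)"
  "x \<in> X \<Longrightarrow> i < B \<Longrightarrow> fits X B s \<Longrightarrow> fits X B (write_point (x, i) q s)"
  by (auto simp: fits_def write_nat_def write_real_def write_point_def)

lemma fits_write_points [simp]:
  assumes "x \<in> X" "length qs \<le> B" "fits X B s"
  shows "fits X B (write_points x qs s)"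
proof -
  have "dom (points (write_points x qs s)) \<subseteq> {x} \<times> {..<length qs} \<union> dom (points s)"
    by (auto simp: write_points_def split: if_splits)
  moreover have "{x} \<times> {..<length qs} \<subseteq> X \<times> {..<B}" using assms(1,2) by auto
  ultimately have "dom (points (write_points x qs s)) \<subseteq> X \<times> {..<B}"
    using assms(3) unfolding fits_def by blast
  then show ?thesis using assms(3) by (simp add: fits_def write_points_def)
qed

lemma storage_le:
  assumes "fits X B s" "finite X"
  shows "storage s \<le> 3 * (card X * B)"
proof -
  have "card Y \<le> card X * B" if "Y \<subseteq> X \<times> {..<B}" for Y
    using card_mono[OF _ that] assms(2) by (simp add: card_cartesian_product)
  then have "card (dom (nats s)) \<le> card X * B" "card (dom (reals s)) \<le> card X * B"
    "card (dom (points s)) \<le> card X * B"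
    using assms(1) unfolding fits_def by blast+
  then show ?thesis unfolding storage_def by linarith
qed

section \<open>The sketch as lists of stream indices\<close>

text \<open>Applied with \<open>f = snd\<close>: few distinct labels, each on at most
  \<open>z + 1\<close> entries, make a short list.\<close>

lemma length_le_card_classes:
  assumes "distinct xs" "\<And>c. length (filter (\<lambda>x. f x = c) xs) \<le> n"
  shows "length xs \<le> card (f ` set xs) * n"
proof -
  have "length xs = card (set xs)" using assms(1) by (simp add: distinct_card)
  also have "\<dots> = (\<Sum>c\<in>f ` set xs. card {x \<in> set xs. f x = c})"
    using sum.image_gen[of "set xs" "\<lambda>_. 1::nat" f] by simp
  also have "\<dots> \<le> (\<Sum>c\<in>f ` set xs. n)"
  proof (rule sum_mono)
    fix c
    have "card {x \<in> set xs. f x = c} = length (filter (\<lambda>x. f x = c) xs)"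
      using assms(1) by (metis distinct_card distinct_filter set_filter)
    then show "card {x \<in> set xs. f x = c} \<le> n" using assms(2) by simp
  qed
  finally show ?thesis by simp
qed

text \<open>The fold returns the last label within \<open>e\<close> of \<open>q\<close>, and
  \<open>q\<close> itself if there is none; this is what a loop without early exit computes.\<close>

definition center_for :: "('a \<Rightarrow> 'a \<Rightarrow> real) \<Rightarrow> real \<Rightarrow> 'a \<Rightarrow> (nat \<times> 'a) list \<Rightarrow> 'a" where
  "center_for \<delta> e q l = foldl (\<lambda>y x. if e < \<delta> (snd x) q then y else snd x) q l"

definition class_of :: "'a \<Rightarrow> (nat \<times> 'a) list \<Rightarrow> (nat \<times> 'a) list" where
  "class_of y l = filter (\<lambda>x. snd x = y) l"

text \<open>The counter is the number of class members still kept. Members are dropped while it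
  exceeds \<open>z\<close>, so in a list sorted by age the oldest go first, and the entry appended
  afterwards brings the class to at most \<open>z + 1\<close>.\<close>

definition prune_step :: "nat \<Rightarrow> 'a \<Rightarrow> nat \<times> (nat \<times> 'a) list \<Rightarrow> nat \<times> 'a \<Rightarrow> nat \<times> (nat \<times> 'a) list" where
  "prune_step z y st x =
     (if z < fst st \<and> snd x = y then (fst st - 1, snd st) else (fst st, snd st @ [x]))"

definition prune :: "nat \<Rightarrow> 'a \<Rightarrow> (nat \<times> 'a) list \<Rightarrow> (nat \<times> 'a) list" where
  "prune z y l = snd (foldl (prune_step z y) (length (class_of y l), []) l)"

lemma center_for_cases:
  "(center_for \<delta> e q l = q \<and> (\<forall>x\<in>set l. e < \<delta> (snd x) q)) \<or>
   (\<exists>x\<in>set l. center_for \<delta> e q l = snd x \<and> \<delta> (snd x) q \<le> e)"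
proof (induction l rule: rev_induct)
  case Nil
  then show ?case by (simp add: center_for_def)
next
  case (snoc x l)
  have "center_for \<delta> e q (l @ [x]) = (if e < \<delta> (snd x) q then center_for \<delta> e q l else snd x)"
    by (simp add: center_for_def)
  then show ?case using snoc by (auto simp: not_less)
qed

lemma foldl_prune_step_id:
  assumes "m \<le> z \<or> (\<forall>x\<in>set l. snd x \<noteq> y)"
  shows "foldl (prune_step z y) (m, out) l = (m, out @ l)"
  using assms by (induction l arbitrary: out) (auto simp: prune_step_def)

lemma prune_id: "length (class_of y l) \<le> z \<Longrightarrow> prune z y l = l"
  by (simp add: prune_def foldl_prune_step_id)

text \<open>One removal brings the counter from \<open>z + 1\<close> to \<open>z\<close>, after
  which \<open>foldl_prune_step_id\<close> passes the rest unchanged. In the sketch a class never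
  exceeds \<open>z + 1\<close>, so an arrival prunes at most one entry.\<close>

lemma prune_full:
  assumes "length (class_of y l) = z + 1"
  obtains xs x ys where "l = xs @ x # ys" "snd x = y" "prune z y l = xs @ ys" "\<forall>x\<in>set xs. snd x \<noteq> y"
proof -
  from assms have "class_of y l \<noteq> []" by auto
  then have "\<exists>x\<in>set l. snd x = y" unfolding class_of_def filter_empty_conv by blast
  then obtain xs x ys where l: "l = xs @ x # ys" "snd x = y" "\<forall>x\<in>set xs. snd x \<noteq> y"
    using split_list_first_prop[of l "\<lambda>x. snd x = y"] by blast
  have "prune z y l = snd (foldl (prune_step z y) (z + 1, []) l)" using assms by (simp add: prune_def)
  also have "\<dots> = snd (foldl (prune_step z y) (prune_step z y (z + 1, xs) x) ys)"
    using l by (simp add: foldl_prune_step_id)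
  also have "\<dots> = xs @ ys" using l(2) by (simp add: prune_step_def foldl_prune_step_id)
  finally show ?thesis using that l by blast
qed

locale sliding_window = Metric_space M \<delta> for M :: "'a set" and \<delta> +
  fixes d :: real and k z :: nat and \<epsilon> \<Delta>min \<Delta>max W :: real and len :: enat
    and p :: "nat \<Rightarrow> 'a" and ta :: "nat \<Rightarrow> real" and c :: real and A :: "'a list \<Rightarrow> 'a list \<times> real"
  assumes doubling: "doubling_bound M \<delta> d" and nonempty: "M \<noteq> {}"
    and k_pos: "1 \<le> k" and eps: "0 < \<epsilon>" "\<epsilon> < 1"
    and stream: "window_stream M W len p ta"
    and spread: "0 < \<Delta>min" "\<Delta>min \<le> \<Delta>max"
    and dist_bounds: "\<And>i j. enat i < len \<Longrightarrow> enat j < len \<Longrightarrow> p i \<noteq> p j \<Longrightarrow>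
      \<Delta>min \<le> \<delta> (p i) (p j) \<and> \<delta> (p i) (p j) \<le> \<Delta>max"
    and approx: "static_approx M \<delta> k z c A"
begin

text \<open>Covers have integer cardinality, so \<open>2 powr d\<close> and its floor are the same
  bound for them. This number is the only trace of \<open>d\<close> in the program, so one program
  serves all spaces of dimension \<open>d\<close>.\<close>

definition D :: nat where "D = nat \<lfloor>2 powr d\<rfloor>"
text \<open>\<open>J\<close> halvings take a ball of radius \<open>4 * \<rho>\<close> to at most
  half the label separation \<open>\<epsilon> * \<rho> / 4\<close>; hence 32 = 4 * 4 * 2.\<close>

definition J :: nat where "J = (LEAST j. 32 \<le> \<epsilon> * 2 ^ j)"
text \<open>\<open>k\<close> balls with \<open>D ^ J\<close> labels each and \<open>z + 1\<close>
  entries per label, plus \<open>z\<close> entries at outliers.\<close>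

definition L :: nat where "L = k * D ^ J * (z + 1) + z"
definition \<rho> :: "nat \<Rightarrow> real" where "\<rho> i = \<Delta>min / 2 * 2 ^ i"
definition I :: nat where "I = (LEAST i. \<Delta>max \<le> \<rho> i)"
text \<open>Guess 0 stands for \<rho> = 0 and guess \<open>g > 0\<close> for
  \<open>\<rho> (g - 1)\<close>, up to the first one that reaches \<open>\<Delta>max\<close>; hence
  the 2 here and the shift in \<open>thr\<close>.\<close>

definition G :: nat where "G = I + 2"
definition thr :: "nat \<Rightarrow> real" where "thr g = (if g = 0 then 0 else \<epsilon> * \<rho> (g - 1) / 4)"

definition alive :: "real \<Rightarrow> nat set" where
  "alive t = {i. enat i < len \<and> ta i \<le> t \<and> t < ta i + W}"

abbreviation Q :: "real \<Rightarrow> 'a multiset" where "Q t \<equiv> window W len p ta t"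

subsection \<open>The metric\<close>

lemma card_le_D: "real n \<le> 2 powr d \<Longrightarrow> n \<le> D"
  unfolding D_def by (simp add: le_nat_floor)

text \<open>A ball contains its own center, so a cover of it has at least one member.\<close>

lemma D_pos: "1 \<le> D" and d_nonneg: "0 \<le> d"
proof -
  obtain x where x: "x \<in> M" using nonempty by auto
  obtain C where C: "C \<subseteq> M" "finite C" "real (card C) \<le> 2 powr d" "mcball x 1 \<subseteq> (\<Union>y\<in>C. mcball y (1/2))"
    using doubling x unfolding doubling_bound_def by (meson zero_less_one)
  have "x \<in> mcball x 1" using x mdist_zero[OF x] by simp
  then have "C \<noteq> {}" using C(4) by blast
  then have "1 \<le> card C" using C by (simp add: Suc_leI card_gt_0_iff)
  then show "1 \<le> D" using card_le_D[OF C(3)] by linarith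
  have "1 \<le> 2 powr d" using \<open>1 \<le> card C\<close> C(3) by linarith
  then have "2 powr 0 \<le> 2 powr d" by simp
  then show "0 \<le> d" by (subst (asm) powr_le_cancel_iff) auto
qed

lemma cover_iterated:
  assumes "x \<in> M" "0 < r"
  shows "\<exists>C\<subseteq>M. finite C \<and> card C \<le> D ^ j \<and> mcball x r \<subseteq> (\<Union>y\<in>C. mcball y (r / 2 ^ j))"
proof (induction j)
  case 0
  then show ?case using assms by (intro exI[of _ "{x}"]) auto
next
  case (Suc j)
  then obtain C where C: "C \<subseteq> M" "finite C" "card C \<le> D ^ j" "mcball x r \<subseteq> (\<Union>y\<in>C. mcball y (r / 2 ^ j))"
    by auto
  have "\<forall>y\<in>C. \<exists>F\<subseteq>M. finite F \<and> card F \<le> D \<and> mcball y (r / 2 ^ j) \<subseteq> (\<Union>y\<in>F. mcball y (r / 2 ^ Suc j))"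
  proof
    fix y assume "y \<in> C"
    then have "y \<in> M" "0 < r / 2 ^ j" using C assms by auto
    then obtain F where "F\<subseteq>M" "finite F" "real (card F) \<le> 2 powr d"
      "mcball y (r / 2 ^ j) \<subseteq> (\<Union>y\<in>F. mcball y (r / 2 ^ j / 2))"
      using doubling unfolding doubling_bound_def by meson
    then show "\<exists>F\<subseteq>M. finite F \<and> card F \<le> D \<and> mcball y (r / 2 ^ j) \<subseteq> (\<Union>y\<in>F. mcball y (r / 2 ^ Suc j))"
      using card_le_D by (intro exI[of _ F]) (auto simp: mult.commute)
  qed
  then obtain F where F: "\<And>y. y \<in> C \<Longrightarrow> F y\<subseteq>M \<and> finite (F y) \<and> card (F y) \<le> D \<and>
    mcball y (r / 2 ^ j) \<subseteq> (\<Union>y\<in>F y. mcball y (r / 2 ^ Suc j))" by metis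
  have "card (\<Union>y\<in>C. F y) \<le> (\<Sum>y\<in>C. card (F y))" by (rule card_UN_le[OF C(2)])
  also have "\<dots> \<le> (\<Sum>y\<in>C. D)" using F by (intro sum_mono) blast
  also have "\<dots> = card C * D" by simp
  also have "\<dots> \<le> D ^ j * D" using C by simp
  finally have "card (\<Union>y\<in>C. F y) \<le> D ^ Suc j" by (simp add: mult.commute)
  moreover have "mcball x r \<subseteq> (\<Union>y\<in>(\<Union>y\<in>C. F y). mcball y (r / 2 ^ Suc j))"
  proof
    fix x' assume "x' \<in> mcball x r"
    then obtain y where "y \<in> C" "x' \<in> mcball y (r / 2 ^ j)" using C(4) by blast
    then show "x' \<in> (\<Union>y\<in>(\<Union>y\<in>C. F y). mcball y (r / 2 ^ Suc j))" using F[of y] by blast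
  qed
  moreover have "(\<Union>y\<in>C. F y) \<subseteq> M" "finite (\<Union>y\<in>C. F y)" using C(2) F by blast+
  ultimately show ?case by (intro exI[of _ "\<Union>y\<in>C. F y"]) simp
qed

text \<open>Packing against covering: a covering ball of radius at most \<open>e / 2\<close> has
  diameter at most \<open>e\<close> and so contains at most one point of \<open>X\<close>. Strict
  separation is what makes this work with closed balls.\<close>

lemma card_separated_le:
  assumes "y \<in> M" "0 < r" "X \<subseteq> mcball y r" "r / 2 ^ j \<le> e / 2"
    and "\<And>x x'. x \<in> X \<Longrightarrow> x' \<in> X \<Longrightarrow> x \<noteq> x' \<Longrightarrow> e < \<delta> x x'"
  shows "card X \<le> D ^ j"
proof -
  obtain C where C: "C \<subseteq> M" "finite C" "card C \<le> D ^ j" "mcball y r \<subseteq> (\<Union>y\<in>C. mcball y (r / 2 ^ j))"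
    using cover_iterated[OF assms(1,2)] by blast
  then have "\<forall>x\<in>X. \<exists>y\<in>C. x \<in> mcball y (r / 2 ^ j)" using assms(3) by blast
  then obtain f where f: "\<And>x. x \<in> X \<Longrightarrow> f x \<in> C \<and> x \<in> mcball (f x) (r / 2 ^ j)" by metis
  have "inj_on f X"
  proof (rule inj_onI, rule ccontr)
    fix x x' assume x: "x \<in> X" "x' \<in> X" "f x = f x'" "x \<noteq> x'"
    have "f x \<in> M" "x \<in> M" "x' \<in> M" "\<delta> (f x) x \<le> e / 2" "\<delta> (f x) x' \<le> e / 2"
      using f[OF x(1)] f[OF x(2)] x(3) assms(4) unfolding in_mcball by (metis order_trans)+
    then have "\<delta> x x' \<le> e" using triangle[of x "f x" x'] commute[of x "f x"] by linarith
    then show False using assms(5)[OF x(1,2,4)] by simp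
  qed
  then have "card X \<le> card C" using card_inj_on_le[of f X C] f C(2) by blast
  then show ?thesis using C(3) by simp
qed

subsection \<open>Optimal costs\<close>

lemma opt_le: "valid_solution M \<delta> k z S cs r \<Longrightarrow> opt M \<delta> k z S \<le> r"
  unfolding opt_def by (intro cInf_lower) (auto intro!: bdd_belowI[of _ 0] simp: valid_solution_def)

text \<open>The static algorithm is the witness that valid solutions exist. Without one the infimum
  in \<open>opt\<close> would be taken over the empty set.\<close>

lemma valid_exists: "set_mset S \<subseteq> M \<Longrightarrow> \<exists>cs r. valid_solution M \<delta> k z S cs r \<and> r \<le> c * opt M \<delta> k z S"
  using approx unfolding static_approx_def by (metis ex_mset set_mset_mset surj_pair)

lemma opt_nonneg: "set_mset S \<subseteq> M \<Longrightarrow> 0 \<le> opt M \<delta> k z S"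
  unfolding opt_def by (rule cInf_greatest) (use valid_exists in blast, simp add: valid_solution_def, blast)

text \<open>As the infimum need not be attained, an actual solution is only available strictly above
  \<open>opt\<close>. The slack in later radii comes from here.\<close>

lemma opt_less_valid:
  assumes "set_mset S \<subseteq> M" "opt M \<delta> k z S < r"
  obtains cs r' where "valid_solution M \<delta> k z S cs r'" "r' < r"
  using cInf_lessD[of "{r. \<exists>cs. valid_solution M \<delta> k z S cs r}" r] assms valid_exists[OF assms(1)]
  unfolding opt_def by blast

lemma valid_mono: "S \<subseteq># S' \<Longrightarrow> valid_solution M \<delta> k z S' cs r \<Longrightarrow> valid_solution M \<delta> k z S cs r"
  unfolding valid_solution_def by (meson multiset_filter_mono order_trans size_mset_mono)

lemma opt_mono:
  assumes "S \<subseteq># S'" "set_mset S' \<subseteq> M"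
  shows "opt M \<delta> k z S \<le> opt M \<delta> k z S'"
  unfolding opt_def
proof (rule cInf_superset_mono)
  show "{r. \<exists>cs. valid_solution M \<delta> k z S' cs r} \<noteq> {}" using valid_exists[OF assms(2)] by blast
  show "bdd_below {r. \<exists>cs. valid_solution M \<delta> k z S cs r}"
    by (intro bdd_belowI[of _ 0]) (auto simp: valid_solution_def)
  show "{r. \<exists>cs. valid_solution M \<delta> k z S' cs r} \<subseteq> {r. \<exists>cs. valid_solution M \<delta> k z S cs r}"
    using valid_mono[OF assms(1)] by blast
qed

text \<open>Nothing is assumed about \<open>c\<close> directly; this yields \<open>1 \<le> c\<close>
  whenever the optimum is positive.\<close>

lemma opt_mult_c: "set_mset S \<subseteq> M \<Longrightarrow> opt M \<delta> k z S \<le> c * opt M \<delta> k z S"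
  using valid_exists opt_le order_trans by metis

subsection \<open>The stream\<close>

lemma ta_less_iff: "enat i < len \<Longrightarrow> enat j < len \<Longrightarrow> ta i < ta j \<longleftrightarrow> i < j"
  using stream unfolding window_stream_def by (metis linorder_neqE_nat order_less_asym order_less_irrefl)

lemma ta_neq: "enat i < len \<Longrightarrow> enat j < len \<Longrightarrow> ta i \<noteq> ta j + W"
  using stream unfolding window_stream_def by blast

lemma p_in_M: "enat i < len \<Longrightarrow> p i \<in> M"
  using stream unfolding window_stream_def by blast

lemma W_pos: "0 < W"
  using stream unfolding window_stream_def by blast

lemma finite_alive: "finite (alive t)"
proof -
  have "finite {i. enat i < len \<and> ta i \<le> t}" using stream unfolding window_stream_def by blast
  then show ?thesis by (rule rev_finite_subset) (auto simp: alive_def)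
qed

lemma alive_len: "i \<in> alive t \<Longrightarrow> enat i < len"
  by (simp add: alive_def)

lemma set_window: "set_mset (Q t) \<subseteq> M"
  using finite_alive[of t] p_in_M by (auto simp: window_def alive_def)

text \<open>Outliers are counted by stream index, which accounts for repeated points and matches the
  lists, whose entries are indices.\<close>

lemma valid_window_iff:
  "valid_solution M \<delta> k z (Q t) cs r \<longleftrightarrow>
     length cs = k \<and> set cs \<subseteq> M \<and> 0 \<le> r \<and> card {i \<in> alive t. p i \<notin> (\<Union>y\<in>set cs. mcball y r)} \<le> z"
proof -
  have "filter_mset P (Q t) = image_mset p (mset_set {i \<in> alive t. P (p i)})" for P
    using finite_alive[of t] unfolding window_def alive_def
    by (subst filter_mset_image_mset) (simp add: filter_mset_mset_set)
  then show ?thesis unfolding valid_solution_def by simp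
qed

text \<open>One ball around any alive point covers the whole window, and for an empty window any
  center does. This makes the top guess always usable.\<close>

lemma opt_le_\<Delta>max: "opt M \<delta> k z (Q t) \<le> \<Delta>max"
proof -
  have "\<exists>y\<in>M. \<forall>i\<in>alive t. \<delta> y (p i) \<le> \<Delta>max"
  proof (cases "alive t = {}")
    case False
    then obtain j where j: "j \<in> alive t" by auto
    have "\<delta> (p j) (p i) \<le> \<Delta>max" if "i \<in> alive t" for i
      using dist_bounds[of j i] alive_len j that spread p_in_M mdist_zero by (cases "p i = p j") auto
    then show ?thesis using p_in_M alive_len j by blast
  qed (use nonempty in auto)
  then obtain y where y: "y \<in> M" "\<forall>i\<in>alive t. \<delta> y (p i) \<le> \<Delta>max" by auto
  have empty: "{i \<in> alive t. p i \<notin> (\<Union>y\<in>set (replicate k y). mcball y \<Delta>max)} = {}"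
    using y k_pos p_in_M alive_len by auto
  have "valid_solution M \<delta> k z (Q t) (replicate k y) \<Delta>max"
    unfolding valid_window_iff empty using y spread by auto
  then show ?thesis by (rule opt_le)
qed

text \<open>No event lies strictly between \<open>t\<close> and \<open>ta i\<close>, and no point
  expires exactly at \<open>ta i\<close> because arrival and expiration times are distinct.\<close>

lemma alive_arrival:
  assumes "enat i < len" "next_event W len ta t (ta i)"
  shows "alive (ta i) = insert i (alive t)" "\<And>j. j \<in> alive t \<Longrightarrow> j < i"
proof -
  have ev: "t < ta i" "\<And>e. e \<in> event_times W len ta \<Longrightarrow> \<not> (t < e \<and> e < ta i)"
    using assms(2) by (auto simp: next_event_def)
  have e1: "ta j \<in> event_times W len ta" "ta j + W \<in> event_times W len ta" if "enat j < len" for j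
    using that by (auto simp: event_times_def)
  show lt: "\<And>j. j \<in> alive t \<Longrightarrow> j < i"
    using ta_less_iff assms(1) ev(1) by (fastforce simp: alive_def)
  show "alive (ta i) = insert i (alive t)"
  proof (rule set_eqI)
    fix j
    show "j \<in> alive (ta i) \<longleftrightarrow> j \<in> insert i (alive t)"
    proof (cases "enat j < len \<and> j \<noteq> i")
      case True
      then have "ta j \<noteq> ta i" using ta_less_iff assms(1) by (metis less_irrefl nat_neq_iff)
      then show ?thesis using True ev(1) ev(2)[OF e1(1)[of j]] ev(2)[OF e1(2)[of j]] ta_neq[of i j] assms(1)
        by (auto simp: alive_def)
    qed (use W_pos assms(1) in \<open>auto simp: alive_def\<close>)
  qed
qed

text \<open>The survivors are described by expiration times because that is the comparison made by
  \<open>expire\<close>. The second claim identifies the departing point as the oldest alive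
  one.\<close>

lemma alive_departure:
  assumes "enat i < len" "next_event W len ta t (ta i + W)"
  shows "alive (ta i + W) = {j \<in> alive t. ta i + W < ta j + W}"
    "\<And>j. j \<in> alive t \<Longrightarrow> ta i \<le> ta j"
proof -
  have ev: "t < ta i + W" "\<And>e. e \<in> event_times W len ta \<Longrightarrow> \<not> (t < e \<and> e < ta i + W)"
    using assms(2) by (auto simp: next_event_def)
  have e1: "ta j \<in> event_times W len ta" "ta j + W \<in> event_times W len ta" if "enat j < len" for j
    using that by (auto simp: event_times_def)
  show "\<And>j. j \<in> alive t \<Longrightarrow> ta i \<le> ta j"
    using ev(2)[OF e1(2)] by (fastforce simp: alive_def)
  show "alive (ta i + W) = {j \<in> alive t. ta i + W < ta j + W}"
  proof (rule set_eqI)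
    fix j
    show "j \<in> alive (ta i + W) \<longleftrightarrow> j \<in> {j \<in> alive t. ta i + W < ta j + W}"
    proof (cases "enat j < len")
      case True
      then show ?thesis using ev(1) ev(2)[OF e1(1)[of j]] ta_neq[of j i] assms(1)
        by (auto simp: alive_def)
    qed (auto simp: alive_def)
  qed
qed

lemma alive_wait:
  assumes "t \<le> u" "\<forall>e\<in>event_times W len ta. \<not> (t < e \<and> e \<le> u)"
  shows "alive u = alive t"
proof -
  have "\<not> (t < ta j \<and> ta j \<le> u)" "\<not> (t < ta j + W \<and> ta j + W \<le> u)" if "enat j < len" for j
    using that assms(2) by (auto simp: event_times_def)
  then show ?thesis using assms(1) unfolding alive_def by force
qed

subsection \<open>The list of a guess\<close>

text \<open>The last conjunct lists the two excuses for an alive point to be missing. Either it was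
  lost by overflow, and then the list is still too long to be used and all its entries are younger;
  or it was pruned, and then a label near it carries the full number of \<open>z + 1\<close>
  entries, all younger. Recording the ages is what lets both excuses survive departures.\<close>

definition good :: "real \<Rightarrow> real \<Rightarrow> (nat \<times> 'a) list \<Rightarrow> bool" where
  "good e t l \<longleftrightarrow> sorted_wrt (\<lambda>x y. fst x < fst y) l \<and>
     (\<forall>x\<in>set l. fst x \<in> alive t \<and> snd x \<in> M \<and> \<delta> (p (fst x)) (snd x) \<le> e) \<and>
     (\<forall>x\<in>set l. \<forall>y\<in>set l. snd x \<noteq> snd y \<longrightarrow> e < \<delta> (snd x) (snd y)) \<and>
     (\<forall>y. length (class_of y l) \<le> z + 1) \<and>
     (\<forall>i\<in>alive t - fst ` set l.
        (L + 1 \<le> length l \<and> (\<forall>x\<in>set l. i < fst x)) \<or>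
        (\<exists>y\<in>M. \<delta> (p i) y \<le> e \<and> length (class_of y l) = z + 1 \<and> (\<forall>x\<in>set l. snd x = y \<longrightarrow> i < fst x)))"

definition insert_entry :: "real \<Rightarrow> nat \<Rightarrow> (nat \<times> 'a) list \<Rightarrow> (nat \<times> 'a) list" where
  "insert_entry e i l =
     (let y = center_for \<delta> e (p i) l; l' = prune z y l @ [(i, y)]
      in if L + 1 < length l' then tl l' else l')"

text \<open>Testing the head is enough: entries are sorted by age and arrival times are distinct, so
  a departure removes at most one entry, and none if the departing point is not in the list.\<close>

definition expire :: "real \<Rightarrow> (nat \<times> 'a) list \<Rightarrow> (nat \<times> 'a) list" where
  "expire t l = (if l \<noteq> [] \<and> \<not> t < ta (fst (hd l)) + W then tl l else l)"

text \<open>At least \<open>L + 1\<close> younger entries remain, so the dropped head is excused by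
  overflow.\<close>

lemma good_tl:
  assumes "good e t l" "L + 1 < length l"
  shows "good e t (tl l)"
proof -
  obtain x l' where l: "l = x # l'" using assms(2) by (cases l) auto
  have lt: "\<forall>y\<in>set l'. fst x < fst y" using assms(1) l by (simp add: good_def)
  have cl: "length (class_of y l') \<le> length (class_of y l)" for y by (simp add: l class_of_def)
  have "(L + 1 \<le> length l' \<and> (\<forall>x\<in>set l'. i < fst x)) \<or>
        (\<exists>y\<in>M. \<delta> (p i) y \<le> e \<and> length (class_of y l') = z + 1 \<and> (\<forall>x\<in>set l'. snd x = y \<longrightarrow> i < fst x))"
    if i: "i \<in> alive t - fst ` set l'" for i
  proof (cases "i = fst x")
    case True
    then show ?thesis using lt assms(2) l by auto
  next
    case False
    then have "i \<in> alive t - fst ` set l" using i l by auto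
    then consider "L + 1 \<le> length l \<and> (\<forall>x\<in>set l. i < fst x)" |
      y where "y\<in>M" "\<delta> (p i) y \<le> e" "length (class_of y l) = z + 1" "\<forall>x\<in>set l. snd x = y \<longrightarrow> i < fst x"
      using assms(1) unfolding good_def by blast
    then show ?thesis
    proof cases
      case 1
      then show ?thesis using assms(2) l by auto
    next
      case 2
      show ?thesis
      proof (cases "snd x = y")
        case True
        \<comment> \<open>Dropping \<open>x\<close> spoils the full count of its class, but a point
          excused by that class is older than \<open>x\<close>, hence older than all remaining
          entries, and switches to the overflow excuse.\<close>
        then have "\<forall>x\<in>set l'. i < fst x" using 2 lt l by fastforce
        then show ?thesis using assms(2) l by auto
      next
        case False
        then have "class_of y l' = class_of y l" by (simp add: l class_of_def)
        then show ?thesis using 2 l by auto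
      qed
    qed
  qed
  moreover have "\<forall>y. length (class_of y l') \<le> z + 1"
    using assms(1) cl order_trans unfolding good_def by blast
  ultimately show ?thesis using assms(1) unfolding good_def l by simp
qed

text \<open>If the class of the new label is not full, no missing point is excused by it, and the
  class can simply grow. If it is full, its oldest entry makes room for the new one, so its size,
  the length of the list and with them all excuses are preserved.\<close>

lemma good_append:
  assumes g: "good e t l" and i: "enat i < len" "next_event W len ta t (ta i)" and e: "0 \<le> e"
  shows "good e (ta i) (prune z (center_for \<delta> e (p i) l) l @ [(i, center_for \<delta> e (p i) l)])"
    "length (prune z (center_for \<delta> e (p i) l) l) \<le> length l"
    "set (prune z (center_for \<delta> e (p i) l) l) \<subseteq> set l"
proof -
  define y where "y = center_for \<delta> e (p i) l"
  define l1 where "l1 = prune z y l"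
  have y: "y \<in> M" "\<delta> (p i) y \<le> e"
    and sep: "\<forall>x\<in>set l. snd x \<noteq> y \<longrightarrow> e < \<delta> (snd x) y"
  proof -
    have pi: "p i \<in> M" "\<delta> (p i) (p i) = 0" using p_in_M[OF i(1)] mdist_zero by auto
    have l: "\<And>x. x \<in> set l \<Longrightarrow> snd x \<in> M"
      "\<And>x x'. x \<in> set l \<Longrightarrow> x' \<in> set l \<Longrightarrow> snd x \<noteq> snd x' \<Longrightarrow> e < \<delta> (snd x) (snd x')"
      using g unfolding good_def by blast+
    consider "y = p i" "\<forall>x\<in>set l. e < \<delta> (snd x) (p i)" |
      x where "x \<in> set l" "y = snd x" "\<delta> (snd x) (p i) \<le> e"
      using center_for_cases[of \<delta> e "p i" l] unfolding y_def by blast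
    then have "y \<in> M \<and> \<delta> (p i) y \<le> e \<and> (\<forall>x\<in>set l. snd x \<noteq> y \<longrightarrow> e < \<delta> (snd x) y)"
    proof cases
      case 1
      then show ?thesis using pi e by simp
    next
      case 2
      then show ?thesis using l by (simp add: commute[of "p i"])
    qed
    then show "y \<in> M" "\<delta> (p i) y \<le> e" "\<forall>x\<in>set l. snd x \<noteq> y \<longrightarrow> e < \<delta> (snd x) y" by auto
  qed
  have le: "length (class_of y' l) \<le> z + 1" for y' using g unfolding good_def by blast
  have alive: "alive (ta i) = insert i (alive t)" "\<And>j. j \<in> alive t \<Longrightarrow> j < i"
    using alive_arrival[OF i] by auto
  have l_lt: "\<forall>x\<in>set l. fst x < i" using g alive(2) unfolding good_def by blast
  have main: "good e (ta i) (l1 @ [(i, y)]) \<and> length l1 \<le> length l \<and> set l1 \<subseteq> set l"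
  proof (cases "length (class_of y l) \<le> z")
    case True
    then have l1: "l1 = l" by (simp add: l1_def prune_id)
    have cl: "class_of y' (l @ [(i, y)]) = (if y' = y then class_of y l @ [(i, y)] else class_of y' l)" for y'
      by (auto simp: class_of_def)
    have len1: "length (class_of y' (l @ [(i, y)])) \<le> z + 1" for y'
      using True le[of y'] by (simp add: cl)
    have "(L + 1 \<le> length (l @ [(i,y)]) \<and> (\<forall>x\<in>set (l @ [(i,y)]). j < fst x)) \<or>
        (\<exists>y'\<in>M. \<delta> (p j) y' \<le> e \<and> length (class_of y' (l @ [(i,y)])) = z + 1 \<and>
           (\<forall>x\<in>set (l @ [(i,y)]). snd x = y' \<longrightarrow> j < fst x))"
      if j: "j \<in> alive (ta i) - fst ` set (l @ [(i,y)])" for j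
    proof -
      have j': "j \<in> alive t - fst ` set l" "j < i" using j alive by auto
      then consider "L + 1 \<le> length l \<and> (\<forall>x\<in>set l. j < fst x)" |
        y' where "y'\<in>M" "\<delta> (p j) y' \<le> e" "length (class_of y' l) = z + 1" "\<forall>x\<in>set l. snd x = y' \<longrightarrow> j < fst x"
        using g unfolding good_def by blast
      then show ?thesis
      proof cases
        case 1
        then show ?thesis using j'(2) by auto
      next
        case 2
        \<comment> \<open>An excusing class has \<open>z + 1\<close> entries, while the class of
          \<open>y\<close> has at most \<open>z\<close>.\<close>
        then have "y' \<noteq> y" using True by auto
        then show ?thesis using 2 j'(2) cl by auto
      qed
    qed
    then have "good e (ta i) (l @ [(i, y)])"
      using g l_lt len1 y sep alive unfolding good_def
      by (auto simp: sorted_wrt_append commute)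
    then show ?thesis by (simp add: l1)
  next
    case False
    then have full: "length (class_of y l) = z + 1" using le[of y] by linarith
    then obtain xs x ys where l: "l = xs @ x # ys" "snd x = y" "l1 = xs @ ys" "\<forall>x\<in>set xs. snd x \<noteq> y"
      unfolding l1_def by (rule prune_full)
    have cl: "class_of y' (l1 @ [(i, y)]) = (if y' = y then class_of y ys @ [(i, y)] else class_of y' l)" for y'
      using l by (auto simp: class_of_def)
    have cly: "length (class_of y (l1 @ [(i, y)])) = z + 1"
      using full l cl by (auto simp: class_of_def)
    have len1: "length (class_of y' (l1 @ [(i, y)])) \<le> z + 1" for y'
      using cly le[of y'] by (cases "y' = y") (auto simp: cl)
    have xlt: "\<forall>x'\<in>set ys. fst x < fst x'" using g l by (simp add: good_def sorted_wrt_append)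
    have sub: "set l1 \<subseteq> set l" using l by auto
    have "(L + 1 \<le> length (l1 @ [(i,y)]) \<and> (\<forall>x\<in>set (l1 @ [(i,y)]). j < fst x)) \<or>
        (\<exists>y'\<in>M. \<delta> (p j) y' \<le> e \<and> length (class_of y' (l1 @ [(i,y)])) = z + 1 \<and>
           (\<forall>x\<in>set (l1 @ [(i,y)]). snd x = y' \<longrightarrow> j < fst x))"
      if j: "j \<in> alive (ta i) - fst ` set (l1 @ [(i,y)])" for j
    proof (cases "j = fst x")
      case True
      \<comment> \<open>The entry just pruned is itself a new missing point; its class, full again
        after the arrival, excuses it.\<close>
      have "\<delta> (p j) y \<le> e" using g l True unfolding good_def by auto
      moreover have "\<forall>x\<in>set (l1 @ [(i,y)]). snd x = y \<longrightarrow> j < fst x"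
        using True xlt l l_lt by auto
      ultimately show ?thesis using y cly by blast
    next
      case False
      have j': "j \<in> alive t - fst ` set l" "j < i" using j alive False l by auto
      then consider "L + 1 \<le> length l \<and> (\<forall>x\<in>set l. j < fst x)" |
        y' where "y'\<in>M" "\<delta> (p j) y' \<le> e" "length (class_of y' l) = z + 1" "\<forall>x\<in>set l. snd x = y' \<longrightarrow> j < fst x"
        using g unfolding good_def by blast
      then show ?thesis
      proof cases
        case 1
        then show ?thesis using j'(2) l by auto
      next
        case 2
        then have "length (class_of y' (l1 @ [(i,y)])) = z + 1" using cly by (cases "y' = y") (auto simp: cl)
        moreover have "\<forall>x\<in>set (l1 @ [(i,y)]). snd x = y' \<longrightarrow> j < fst x"
          using 2(4) sub j'(2) by auto
        ultimately show ?thesis using 2 by blast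
      qed
    qed
    moreover have "sorted_wrt (\<lambda>x y. fst x < fst y) (l1 @ [(i, y)])"
      using g l_lt l unfolding good_def by (auto simp: sorted_wrt_append)
    moreover have "\<forall>x\<in>set (l1 @ [(i,y)]). fst x \<in> alive (ta i) \<and> snd x \<in> M \<and> \<delta> (p (fst x)) (snd x) \<le> e"
      using g sub y alive unfolding good_def by auto
    moreover have "\<forall>x\<in>set (l1 @ [(i,y)]). \<forall>x'\<in>set (l1 @ [(i,y)]). snd x \<noteq> snd x' \<longrightarrow> e < \<delta> (snd x) (snd x')"
    proof -
      have "\<forall>x\<in>set l1. \<forall>x'\<in>set l1. snd x \<noteq> snd x' \<longrightarrow> e < \<delta> (snd x) (snd x')"
        using g sub unfolding good_def by blast
      moreover have "\<forall>x\<in>set l1. snd x \<noteq> y \<longrightarrow> e < \<delta> (snd x) y" using sep sub by blast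
      moreover from this have "\<forall>x\<in>set l1. snd x \<noteq> y \<longrightarrow> e < \<delta> y (snd x)" by (simp add: commute)
      ultimately show ?thesis by simp
    qed
    ultimately have "good e (ta i) (l1 @ [(i, y)])"
      using len1 unfolding good_def by blast
    then show ?thesis using l by auto
  qed
  then show "good e (ta i) (prune z (center_for \<delta> e (p i) l) l @ [(i, center_for \<delta> e (p i) l)])"
    "length (prune z (center_for \<delta> e (p i) l) l) \<le> length l"
    "set (prune z (center_for \<delta> e (p i) l) l) \<subseteq> set l"
    by (simp_all add: l1_def y_def)
qed

lemma good_insert_entry:
  assumes "good e t l" "enat i < len" "next_event W len ta t (ta i)" "0 \<le> e" "length l \<le> L + 1"
  shows "good e (ta i) (insert_entry e i l)" "length (insert_entry e i l) \<le> L + 1"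
  using good_append[OF assms(1-4)] good_tl assms(5) by (auto simp: insert_entry_def Let_def)

text \<open>When the head expires, it is the departing point, so every surviving missing point is
  younger than it. Such a point cannot have the overflow excuse, nor be excused by the class of the
  head. The remaining excuses refer to classes that lose nothing.\<close>

lemma good_expire:
  assumes g: "good e t l" and i: "enat i < len" "next_event W len ta t (ta i + W)"
  shows "good e (ta i + W) (expire (ta i + W) l)"
proof -
  define u where "u = ta i + W"
  have alive: "alive u = {j \<in> alive t. u < ta j + W}" and least: "\<And>j. j \<in> alive t \<Longrightarrow> ta i \<le> ta j"
    using alive_departure[OF i] by (auto simp: u_def)
  have in_alive: "\<forall>x\<in>set l. fst x \<in> alive t" using g by (simp add: good_def)
  have "good e u (expire u l)"
  proof (cases "l \<noteq> [] \<and> \<not> u < ta (fst (hd l)) + W")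
    case True
    then obtain x l' where l: "l = x # l'" by (cases l) auto
    have lt: "\<forall>y\<in>set l'. fst x < fst y" using g l by (simp add: good_def)
    have x: "fst x \<in> alive t" using in_alive l by simp
    \<comment> \<open>The head has expired, so it is at least as old as \<open>i\<close>; being
      alive before the event, it is not older.\<close>
    have "ta (fst x) = ta i" using True l least[OF x] by (auto simp: u_def)
    then have keep: "u < ta j + W \<longleftrightarrow> fst x < j" if "j \<in> alive t" for j
      using that ta_less_iff alive_len x unfolding u_def by (metis add_less_cancel_right)
    have cl: "length (class_of y l') \<le> length (class_of y l)" for y by (simp add: l class_of_def)
    have "\<exists>y\<in>M. \<delta> (p j) y \<le> e \<and> length (class_of y l') = z + 1 \<and> (\<forall>x\<in>set l'. snd x = y \<longrightarrow> j < fst x)"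
      if j: "j \<in> alive u - fst ` set l'" for j
    proof -
      have j': "j \<in> alive t" "fst x < j" using j alive keep by auto
      then have "j \<in> alive t - fst ` set l" using j l by auto
      then consider "\<forall>x\<in>set l. j < fst x" |
        y where "y\<in>M" "\<delta> (p j) y \<le> e" "length (class_of y l) = z + 1" "\<forall>x\<in>set l. snd x = y \<longrightarrow> j < fst x"
        using g unfolding good_def by blast
      then show ?thesis
      proof cases
        case 1
        then show ?thesis using j'(2) l by auto
      next
        case 2
        then have "snd x \<noteq> y" using j'(2) l by auto
        then have "class_of y l' = class_of y l" by (simp add: l class_of_def)
        then show ?thesis using 2 l by auto
      qed
    qed
    moreover have "\<forall>x\<in>set l'. fst x \<in> alive u" using lt keep in_alive l alive by auto
    moreover have "\<forall>y. length (class_of y l') \<le> z + 1"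
      using g cl order_trans unfolding good_def by blast
    ultimately have "good e u l'" using g unfolding good_def l by simp
    then show ?thesis using True l by (simp add: expire_def)
  next
    case False
    have "fst x \<in> alive u" if x: "x \<in> set l" for x
    proof -
      obtain y l' where l: "l = y # l'" using x by (cases l) auto
      have "fst y \<le> fst x" using x l g by (auto simp: good_def)
      then have "ta (fst y) \<le> ta (fst x)"
        using ta_less_iff[of "fst x" "fst y"] in_alive l x alive_len by force
      then show ?thesis using False l x in_alive alive by auto
    qed
    then have "good e u l" using g alive unfolding good_def by blast
    then show ?thesis using False by (auto simp: expire_def)
  qed
  then show ?thesis by (simp add: u_def)
qed

lemma good_wait: "good e t l \<Longrightarrow> alive u = alive t \<Longrightarrow> good e u l"
  by (simp add: good_def)

lemma good_Nil: "alive t = {} \<Longrightarrow> good e t []"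
  by (simp add: good_def class_of_def)

subsection \<open>Parameters\<close>

text \<open>The minimality of \<open>J\<close> serves twice: it bounds \<open>2 ^ J\<close> from
  above, and it is the loop condition under which the program makes exactly \<open>J\<close>
  rounds.\<close>

lemma J_spec: "32 \<le> \<epsilon> * 2 ^ J" "j < J \<Longrightarrow> \<epsilon> * 2 ^ j < 32"
proof -
  obtain n where "32 / \<epsilon> < 2 ^ n" using real_arch_pow[of 2] by auto
  then have "32 \<le> \<epsilon> * 2 ^ n" using eps by (simp add: field_simps)
  then show "32 \<le> \<epsilon> * 2 ^ J" unfolding J_def by (rule LeastI)
  show "j < J \<Longrightarrow> \<epsilon> * 2 ^ j < 32" unfolding J_def using not_less_Least by fastforce
qed

lemma I_spec: "\<Delta>max \<le> \<rho> I" "i < I \<Longrightarrow> \<rho> i < \<Delta>max"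
proof -
  obtain n where "\<Delta>max / (\<Delta>min / 2) < 2 ^ n" using real_arch_pow[of 2] by auto
  then have "\<Delta>max \<le> \<rho> n" using spread by (simp add: field_simps \<rho>_def)
  then show "\<Delta>max \<le> \<rho> I" unfolding I_def by (rule LeastI)
  show "i < I \<Longrightarrow> \<rho> i < \<Delta>max" unfolding I_def using not_less_Least by fastforce
qed

lemma \<rho>_pos: "0 < \<rho> i"
  using spread by (simp add: \<rho>_def)

lemma thr_nonneg: "0 \<le> thr g"
  using \<rho>_pos[of "g - 1"] eps by (simp add: thr_def)

lemma D_le: "real D \<le> 2 powr d"
  unfolding D_def by (simp add: of_nat_floor)

text \<open>Minimality gives \<open>2 ^ J < 64 / \<epsilon>\<close>, twice the threshold 32, and
  \<open>D ^ J\<close> is at most the \<open>d\<close>-th power of \<open>2 ^ J\<close>.\<close>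

lemma D_power_J_le: "real (D ^ J) \<le> 64 powr d / \<epsilon> powr d"
proof -
  have "2 ^ J \<le> 64 / \<epsilon>"
  proof (cases J)
    case 0
    then show ?thesis using eps by (simp add: field_simps)
  next
    case (Suc j)
    then show ?thesis using J_spec(2)[of j] eps by (simp add: field_simps)
  qed
  have "real (D ^ J) \<le> (2 powr d) ^ J" using D_le by (simp add: power_mono)
  also have "\<dots> = (2 ^ J) powr d" by (simp add: powr_power powr_powr mult.commute flip: powr_realpow)
  also have "\<dots> \<le> (64 / \<epsilon>) powr d" using \<open>2 ^ J \<le> 64 / \<epsilon>\<close> d_nonneg by (intro powr_mono2) auto
  also have "\<dots> = 64 powr d / \<epsilon> powr d" using eps by (simp add: powr_divide)
  finally show ?thesis .
qed

definition N :: real where "N = real (kz k z) / \<epsilon> powr d"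

lemma kz_le_N: "real (kz k z) \<le> N"
proof -
  have "\<epsilon> powr d \<le> 1 powr d" using eps d_nonneg by (intro powr_mono2) auto
  then have "\<epsilon> powr d \<le> 1" by simp
  then have "real (kz k z) * \<epsilon> powr d \<le> real (kz k z)" by (simp add: mult_left_le)
  then show ?thesis unfolding N_def using eps by (simp add: field_simps)
qed

lemma k_le_N: "real k \<le> N" and N_ge_1: "1 \<le> N"
proof -
  have "k \<le> kz k z" using k_pos by (simp add: kz_def)
  then show "real k \<le> N" using kz_le_N by linarith
  then show "1 \<le> N" using k_pos by linarith
qed

text \<open>The factor 2 absorbs the step from \<open>k * (z + 1)\<close> to \<open>kz k z\<close>;
  the extra 1 pays for the \<open>z\<close> outliers.\<close>

lemma L_le: "real L \<le> (2 * 64 powr d + 1) * N"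
proof -
  have "k * (z + 1) \<le> 2 * kz k z" using k_pos by (cases z) (auto simp: kz_def)
  then have 1: "real (k * (z + 1)) \<le> 2 * real (kz k z)" by linarith
  have "z \<le> kz k z" using k_pos by (simp add: kz_def)
  then have 2: "real z \<le> N" using kz_le_N by linarith
  have "real (D ^ J) * real (k * (z + 1)) \<le> 64 powr d / \<epsilon> powr d * (2 * real (kz k z))"
    using 1 D_power_J_le by (intro mult_mono) auto
  also have "\<dots> = 2 * 64 powr d * N" by (simp add: N_def)
  finally have "real (D ^ J) * real (k * (z + 1)) + real z \<le> 2 * 64 powr d * N + N" using 2 by linarith
  then show ?thesis unfolding L_def by (simp add: algebra_simps)
qed

lemma G_le: "real G \<le> 5 * log_spread (\<Delta>max / \<Delta>min)"
proof (cases I)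
  case 0
  then show ?thesis by (simp add: G_def log_spread_def)
next
  case (Suc i)
  have "\<rho> i < \<Delta>max" using I_spec(2) Suc by simp
  then have "2 ^ i / 2 < \<Delta>max / \<Delta>min" using spread by (simp add: \<rho>_def field_simps)
  then have "log 2 (2 ^ i / 2) < log 2 (\<Delta>max / \<Delta>min)" using spread by (subst log_less_cancel_iff) auto
  \<comment> \<open>Here \<open>G = i + 3\<close>, which is below this logarithm plus 4; each
    summand is at most a multiple of \<open>log_spread\<close>, hence the 5.\<close>
  then have "real i - 1 < log 2 (\<Delta>max / \<Delta>min)" by (simp add: log_divide)
  then show ?thesis using Suc by (simp add: G_def log_spread_def max_def)
qed

subsection \<open>Correctness of the guesses\<close>

text \<open>Entries are split into those covered by the solution and the rest. The packing bound per
  ball is a hypothesis because it has different reasons for the guess zero and for positive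
  guesses.\<close>

lemma length_le_L:
  assumes g: "good e t l" and v: "valid_solution M \<delta> k z (Q t) cs r"
    and cl: "\<And>y. y \<in> set cs \<Longrightarrow> card (snd ` {x \<in> set l. p (fst x) \<in> mcball y r}) \<le> D ^ J"
  shows "length l \<le> L"
proof -
  define U where "U = (\<Union>y\<in>set cs. mcball y r)"
  define l1 where "l1 = filter (\<lambda>x. p (fst x) \<in> U) l"
  define l2 where "l2 = filter (\<lambda>x. p (fst x) \<notin> U) l"
  have v': "length cs = k" "card {i \<in> alive t. p i \<notin> U} \<le> z"
    using v unfolding valid_window_iff U_def by auto
  have "sorted_wrt (<) (map fst l)" using g by (simp add: good_def sorted_wrt_map)
  then have dist: "distinct (map fst l)" by (simp add: strict_sorted_iff)
  then have dl: "distinct l" by (simp add: distinct_map)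
  \<comment> \<open>Entries have distinct indices, so uncovered entries are distinct outliers even
    when their points coincide.\<close>
  have "length l2 = card (fst ` set l2)"
    using dist unfolding l2_def by (metis distinct_card distinct_map_filter length_map set_map)
  also have "\<dots> \<le> card {i \<in> alive t. p i \<notin> U}"
    using g finite_alive unfolding good_def l2_def by (intro card_mono) auto
  finally have l2: "length l2 \<le> z" using v' by simp
  have "length l1 \<le> card (snd ` set l1) * (z + 1)"
  proof (rule length_le_card_classes)
    show "distinct l1" using dl by (simp add: l1_def)
    fix y
    have "length (filter (\<lambda>x. snd x = y) l1) = length (filter (\<lambda>x. p (fst x) \<in> U) (class_of y l))"
      by (simp add: l1_def class_of_def conj_commute)
    also have "\<dots> \<le> z + 1" using g length_filter_le order_trans unfolding good_def by blast
    finally show "length (filter (\<lambda>x. snd x = y) l1) \<le> z + 1" .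
  qed
  moreover have "card (snd ` set l1) \<le> k * D ^ J"
  proof -
    have "snd ` set l1 = (\<Union>y\<in>set cs. snd ` {x \<in> set l. p (fst x) \<in> mcball y r})"
      by (auto simp: l1_def U_def)
    then have "card (snd ` set l1) \<le> (\<Sum>y\<in>set cs. card (snd ` {x \<in> set l. p (fst x) \<in> mcball y r}))"
      by (simp add: card_UN_le)
    also have "\<dots> \<le> (\<Sum>y\<in>set cs. D ^ J)" using cl by (rule sum_mono)
    also have "\<dots> \<le> k * D ^ J" using card_length[of cs] v'(1) by simp
    finally show ?thesis .
  qed
  ultimately have "length l1 \<le> k * D ^ J * (z + 1)" by (meson mult_le_mono1 order_trans)
  moreover have "length l = length l1 + length l2"
    unfolding l1_def l2_def by (simp add: sum_length_filter_compl)
  ultimately show ?thesis using l2 unfolding L_def by linarith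
qed

text \<open>Two locations in one ball of radius \<open>r < \<Delta>min / 2\<close> would be closer
  than \<open>\<Delta>min\<close>. With \<open>e = 0\<close> labels are the points themselves, so a
  ball sees at most one label. Moving each center to the location its ball covers gives a solution
  of cost 0.\<close>

lemma opt_less_\<Delta>min:
  assumes "good 0 t l" "opt M \<delta> k z (Q t) < \<Delta>min / 2"
  shows "length l \<le> L" "opt M \<delta> k z (Q t) = 0"
proof -
  obtain cs r where v: "valid_solution M \<delta> k z (Q t) cs r" "r < \<Delta>min / 2"
    using opt_less_valid[OF set_window assms(2)] .
  have same: "p i = p j" if "i \<in> alive t" "j \<in> alive t" "p i \<in> mcball y r" "p j \<in> mcball y r" for i j y
  proof (rule ccontr)
    assume "p i \<noteq> p j"
    then have "\<Delta>min \<le> \<delta> (p i) (p j)" using dist_bounds that alive_len by blast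
    moreover have "\<delta> (p i) (p j) \<le> \<delta> y (p i) + \<delta> y (p j)"
      using triangle[of "p i" y "p j"] commute[of "p i" y] that(3,4) by auto
    ultimately show False using that v(2) by auto
  qed
  show "length l \<le> L"
  proof (rule length_le_L[OF assms(1) v(1)])
    fix y
    have l: "\<And>x. x \<in> set l \<Longrightarrow> fst x \<in> alive t \<and> snd x = p (fst x)"
    proof -
      fix x assume x: "x \<in> set l"
      then have "fst x \<in> alive t" "snd x \<in> M" "\<delta> (p (fst x)) (snd x) \<le> 0"
        using assms(1) unfolding good_def by blast+
      then show "fst x \<in> alive t \<and> snd x = p (fst x)"
        using p_in_M alive_len zero nonneg by (metis antisym)
    qed
    have "\<exists>q. snd ` {x \<in> set l. p (fst x) \<in> mcball y r} \<subseteq> {q}"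
    proof (cases "{x \<in> set l. p (fst x) \<in> mcball y r} = {}")
      case True
      then show ?thesis by blast
    next
      case False
      then obtain x where x: "x \<in> set l" "p (fst x) \<in> mcball y r" by blast
      have "snd x' = snd x" if "x' \<in> set l" "p (fst x') \<in> mcball y r" for x'
        using same[of "fst x'" "fst x"] l x that by metis
      then show ?thesis by blast
    qed
    then have "card (snd ` {x \<in> set l. p (fst x) \<in> mcball y r}) \<le> 1"
      by (metis card.empty card_insert_disjoint card_mono empty_iff finite.emptyI finite.insertI One_nat_def)
    also have "\<dots> \<le> D ^ J" using D_pos by simp
    finally show "card (snd ` {x \<in> set l. p (fst x) \<in> mcball y r}) \<le> D ^ J" .
  qed
  \<comment> \<open>\<open>q\<close> is the only location covered by the ball around
    \<open>y\<close>; if nothing is covered, any point of \<open>M\<close> serves.\<close>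
  have "\<exists>q. (y \<in> M \<longrightarrow> q \<in> M) \<and> (\<forall>i\<in>alive t. p i \<in> mcball y r \<longrightarrow> q = p i)" for y
  proof (cases "\<exists>i\<in>alive t. p i \<in> mcball y r")
    case True
    then show ?thesis using same p_in_M alive_len by metis
  qed auto
  then obtain f where f: "\<And>y. y \<in> M \<Longrightarrow> f y \<in> M" "\<And>y i. i \<in> alive t \<Longrightarrow> p i \<in> mcball y r \<Longrightarrow> f y = p i"
    by metis
  have "p i \<in> mcball (f y) 0" if "i \<in> alive t" "p i \<in> mcball y r" for i y
    using f(2)[OF that] that(2) mdist_zero by simp
  then have "{i \<in> alive t. p i \<notin> (\<Union>y\<in>set (map f cs). mcball y 0)} \<subseteq>
      {i \<in> alive t. p i \<notin> (\<Union>y\<in>set cs. mcball y r)}"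
    unfolding set_map by blast
  then have "card {i \<in> alive t. p i \<notin> (\<Union>y\<in>set (map f cs). mcball y 0)} \<le>
      card {i \<in> alive t. p i \<notin> (\<Union>y\<in>set cs. mcball y r)}"
    using finite_alive[of t] by (intro card_mono) auto
  then have "valid_solution M \<delta> k z (Q t) (map f cs) 0"
    using v(1) f(1) unfolding valid_window_iff by (auto simp del: in_mcball)
  then show "opt M \<delta> k z (Q t) = 0" using opt_le opt_nonneg[OF set_window] by (simp add: antisym)
qed

text \<open>Labels of the points in one ball lie within \<open>r + e < 3 * \<rho> h\<close> of its
  center and are separated by \<open>e\<close>. Rounding the radius up to
  \<open>4 * \<rho> h\<close> fits the choice of \<open>J\<close>.\<close>

lemma opt_le_\<rho>:
  assumes g: "good (thr (Suc h)) t l" and o: "opt M \<delta> k z (Q t) \<le> \<rho> h"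
  shows "length l \<le> L"
proof -
  define e where "e = thr (Suc h)"
  have e: "e = \<epsilon> * \<rho> h / 4" by (simp add: e_def thr_def)
  \<comment> \<open>The factor 2 creates the strict gap required by
    \<open>opt_less_valid\<close>.\<close>
  have "opt M \<delta> k z (Q t) < 2 * \<rho> h" using o \<rho>_pos[of h] by linarith
  then obtain cs r where v: "valid_solution M \<delta> k z (Q t) cs r" "r < 2 * \<rho> h"
    using opt_less_valid[OF set_window] by metis
  show ?thesis
  proof (rule length_le_L[OF g v(1)])
    fix y assume "y \<in> set cs"
    then have y: "y \<in> M" using v(1) unfolding valid_solution_def by blast
    show "card (snd ` {x \<in> set l. p (fst x) \<in> mcball y r}) \<le> D ^ J"
    proof (rule card_separated_le[OF y, of "4 * \<rho> h" _ _ e])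
      show "0 < 4 * \<rho> h" using \<rho>_pos by simp
      have "e \<le> \<rho> h" unfolding e using eps \<rho>_pos[of h] mult_right_mono[of \<epsilon> 1 "\<rho> h"] by linarith
      show "snd ` {x \<in> set l. p (fst x) \<in> mcball y r} \<subseteq> mcball y (4 * \<rho> h)"
      proof
        fix q assume "q \<in> snd ` {x \<in> set l. p (fst x) \<in> mcball y r}"
        then obtain x where x: "x \<in> set l" "p (fst x) \<in> mcball y r" "q = snd x" by blast
        then have "q \<in> M" "\<delta> (p (fst x)) q \<le> e" using g unfolding good_def e_def by blast+
        then show "q \<in> mcball y (4 * \<rho> h)"
          using x(2) triangle[of y "p (fst x)" q] v(2) \<open>e \<le> \<rho> h\<close> \<rho>_pos[of h] by auto
      qed
      have "\<rho> h * 32 \<le> \<rho> h * (\<epsilon> * 2 ^ J)" using J_spec(1) \<rho>_pos[of h] by (intro mult_left_mono) auto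
      then show "4 * \<rho> h / 2 ^ J \<le> e / 2" unfolding e by (simp add: field_simps)
    next
      fix q q' assume "q \<in> snd ` {x \<in> set l. p (fst x) \<in> mcball y r}"
        "q' \<in> snd ` {x \<in> set l. p (fst x) \<in> mcball y r}" "q \<noteq> q'"
      then show "e < \<delta> q q'" using g unfolding good_def e_def by blast
    qed
  qed
qed

text \<open>Guess \<open>G - 1\<close> has the value \<open>\<rho> I\<close>, which no optimum
  exceeds. This ends the search for a usable guess.\<close>

lemma length_top_le_L: "good (thr (G - 1)) t l \<Longrightarrow> length l \<le> L"
  using opt_le_\<rho>[of I] opt_le_\<Delta>max[of t] I_spec(1) by (simp add: G_def)

text \<open>A long list refutes its guess: the optimum exceeds it, or for the guess zero is at least
  \<open>\<Delta>min / 2\<close>. As the guesses double, \<open>\<rho> h\<close> is at most twice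
  the optimum, and \<open>2 * thr (Suc h)\<close> is \<epsilon>/2 times
  \<open>\<rho> h\<close>.\<close>

lemma opt_greater:
  assumes "good (thr h) t l" "L < length l"
  shows "0 < opt M \<delta> k z (Q t)" "thr (Suc h) * 2 \<le> \<epsilon> * opt M \<delta> k z (Q t)"
proof -
  show pos: "0 < opt M \<delta> k z (Q t)"
  proof (cases h)
    case 0
    then show ?thesis using opt_less_\<Delta>min(1)[of t l] assms spread by (fastforce simp: thr_def)
  next
    case (Suc h')
    then show ?thesis using opt_le_\<rho>[of h' t l] assms \<rho>_pos[of h'] by fastforce
  qed
  have "\<rho> h \<le> 2 * opt M \<delta> k z (Q t)"
  proof (cases h)
    case 0
    then have "good 0 t l" using assms(1) by (simp add: thr_def)
    then have "\<Delta>min / 2 \<le> opt M \<delta> k z (Q t)" using opt_less_\<Delta>min(1) assms(2) by (meson not_less)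
    then show ?thesis using 0 spread by (simp add: \<rho>_def)
  next
    case (Suc h')
    then have "\<rho> h' < opt M \<delta> k z (Q t)" using opt_le_\<rho>[of h' t l] assms by fastforce
    moreover have "\<rho> h = 2 * \<rho> h'" by (simp add: Suc \<rho>_def)
    ultimately show ?thesis by simp
  qed
  then have "\<epsilon> * \<rho> h \<le> \<epsilon> * (2 * opt M \<delta> k z (Q t))" using eps by (intro mult_left_mono) auto
  then show "thr (Suc h) * 2 \<le> \<epsilon> * opt M \<delta> k z (Q t)" by (simp add: thr_def)
qed

text \<open>Every outlier of the enlarged solution in the window is already an outlier among the
  kept points, so their number stays at most \<open>z\<close>. For the cost, the kept points form a
  sub-multiset of the window and have no larger optimum, while the failure of the preceding guess
  bounds the enlargement.\<close>

lemma report_correct: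
  assumes g: "good (thr g) t l" "length l \<le> L"
    and small: "\<And>h. h < g \<Longrightarrow> \<exists>l'. good (thr h) t l' \<and> L < length l'"
    and A: "A (map (\<lambda>x. p (fst x)) l) = (cs, r)"
  shows "valid_solution M \<delta> k z (Q t) cs (r + thr g + thr g)"
    "r + thr g + thr g \<le> (1 + \<epsilon>) * c * opt M \<delta> k z (Q t)"
    "length cs = k"
proof -
  define S where "S = mset (map (\<lambda>x. p (fst x)) l)"
  have l: "\<And>x. x \<in> set l \<Longrightarrow> fst x \<in> alive t \<and> snd x \<in> M \<and> \<delta> (p (fst x)) (snd x) \<le> thr g"
    using g(1) unfolding good_def by blast
  have "sorted_wrt (<) (map fst l)" using g by (simp add: good_def sorted_wrt_map)
  then have dist: "distinct (map fst l)" by (simp add: strict_sorted_iff)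
  have "S = image_mset p (mset (map fst l))" by (simp add: S_def multiset.map_comp comp_def)
  then have S: "S = image_mset p (mset_set (fst ` set l))"
    using mset_set_set[OF dist] by simp
  have "mset_set (fst ` set l) \<subseteq># mset_set (alive t)"
    using l finite_alive by (intro subset_imp_msubset_mset_set) auto
  then have sub: "S \<subseteq># Q t" unfolding S window_def alive_def by (rule image_mset_subseteq_mono)
  have SM: "set (map (\<lambda>x. p (fst x)) l) \<subseteq> M" using l p_in_M alive_len by fastforce
  then have v: "valid_solution M \<delta> k z S cs r" and r: "r \<le> c * opt M \<delta> k z S"
    using approx A unfolding static_approx_def S_def by blast+
  show "length cs = k" using v by (simp add: valid_solution_def)
  have cs: "set cs \<subseteq> M" "0 \<le> r" using v by (auto simp: valid_solution_def)
  define U where "U = (\<Union>y\<in>set cs. mcball y r)"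
  define U' where "U' = (\<Union>y\<in>set cs. mcball y (r + thr g + thr g))"
  have "size (filter_mset (\<lambda>q. q \<notin> U) S) = card {i \<in> fst ` set l. p i \<notin> U}"
    unfolding S by (simp add: filter_mset_image_mset filter_mset_mset_set)
  then have out: "card {i \<in> fst ` set l. p i \<notin> U} \<le> z"
    using v unfolding valid_solution_def U_def by simp
  have "U \<subseteq> U'" unfolding U_def U'_def using thr_nonneg[of g] by auto
  have "{i \<in> alive t. p i \<notin> U'} \<subseteq> {i \<in> fst ` set l. p i \<notin> U}"
  proof (rule subsetI, rule ccontr)
    fix i assume i: "i \<in> {i \<in> alive t. p i \<notin> U'}" and n: "i \<notin> {i \<in> fst ` set l. p i \<notin> U}"
    then have i': "i \<in> alive t" "i \<in> alive t - fst ` set l" "p i \<in> M"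
      using \<open>U \<subseteq> U'\<close> p_in_M alive_len by auto
    \<comment> \<open>At length at most \<open>L\<close> the overflow excuse is impossible, so a
      full class near \<open>p i\<close> remains.\<close>
    obtain y where y: "y \<in> M" "\<delta> (p i) y \<le> thr g" "length (class_of y l) = z + 1"
      using g i'(2) unfolding good_def by (metis Suc_eq_plus1 not_less_eq_eq)
    have "\<exists>x\<in>set (class_of y l). p (fst x) \<in> U"
    proof (rule ccontr)
      assume "\<not> ?thesis"
      then have sub: "fst ` set (class_of y l) \<subseteq> {i \<in> fst ` set l. p i \<notin> U}"
        by (auto simp: class_of_def)
      have "card (fst ` set (class_of y l)) = z + 1"
        using dist y(3) unfolding class_of_def by (metis distinct_card distinct_map_filter length_map set_map)
      then show False using card_mono[OF _ sub] out by simp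
    qed
    then obtain x where x: "x \<in> set l" "snd x = y" "p (fst x) \<in> U" by (auto simp: class_of_def)
    then obtain w where w: "w \<in> set cs" "p (fst x) \<in> mcball w r" unfolding U_def by blast
    have "\<delta> (p (fst x)) y \<le> thr g" "p (fst x) \<in> M" using l[OF x(1)] x p_in_M alive_len by auto
    then have "\<delta> w (p i) \<le> r + thr g + thr g"
      using w y i'(3) triangle[of w "p (fst x)" "p i"] triangle[of "p (fst x)" y "p i"] commute[of y "p i"]
      by auto
    then have "p i \<in> U'" using w i'(3) unfolding U'_def by auto
    then show False using i by simp
  qed
  then have "card {i \<in> alive t. p i \<notin> U'} \<le> card {i \<in> fst ` set l. p i \<notin> U}"
    by (intro card_mono) auto
  then have "card {i \<in> alive t. p i \<notin> U'} \<le> z" using out by simp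
  then show "valid_solution M \<delta> k z (Q t) cs (r + thr g + thr g)"
    unfolding valid_window_iff using v thr_nonneg[of g] cs unfolding U'_def valid_solution_def by auto
  let ?o = "opt M \<delta> k z (Q t)"
  have S0: "0 \<le> opt M \<delta> k z S" "opt M \<delta> k z S \<le> ?o"
    using opt_nonneg SM opt_mono[OF sub set_window] by (auto simp: S_def)
  have o: "0 \<le> ?o" "?o \<le> c * ?o" using opt_nonneg[OF set_window] opt_mult_c[OF set_window] by auto
  show "r + thr g + thr g \<le> (1 + \<epsilon>) * c * ?o"
  proof (cases "?o = 0")
    case True
    \<comment> \<open>With optimum 0 the sign of \<open>c\<close> is unknown and no enlargement is
      affordable; guess 0 has none, and the optimum of the kept points is 0 too.\<close>
    have "g = 0"
    proof (rule ccontr)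
      assume "g \<noteq> 0"
      then show False using small[of 0] opt_greater True by (metis less_irrefl neq0_conv)
    qed
    then show ?thesis using S0 r True by (simp add: thr_def)
  next
    case False
    then have c: "1 \<le> c" using o by (simp add: mult_le_cancel_right1)
    have "r \<le> c * ?o" using r S0(2) c by (meson mult_left_mono order_trans zero_le_one)
    moreover have "thr g + thr g \<le> \<epsilon> * (c * ?o)"
    proof (cases g)
      case 0
      then show ?thesis using o eps by (simp add: thr_def)
    next
      case (Suc h)
      then have "thr g + thr g \<le> \<epsilon> * ?o" using small[of h] opt_greater(2) by fastforce
      also have "\<dots> \<le> \<epsilon> * (c * ?o)" using o eps by (intro mult_left_mono) auto
      finally show ?thesis .
    qed
    ultimately show ?thesis by (simp add: algebra_simps)
  qed
qed

end

section \<open>The program\<close>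

abbreviation Seq_infix :: "com \<Rightarrow> com \<Rightarrow> com" (infixr ";;" 60) where
  "c1 ;; c2 \<equiv> Seq c1 c2"

abbreviation nvar :: "string \<Rightarrow> nexp" where "nvar x \<equiv> NCell x (NConst 0)"
abbreviation rvar :: "string \<Rightarrow> rexp" where "rvar x \<equiv> RCell x (NConst 0)"
abbreviation pvar :: "string \<Rightarrow> pexp" where "pvar x \<equiv> PCell x (NConst 0)"
abbreviation rnum :: "nat \<Rightarrow> rexp" where "rnum n \<equiv> ROf (NConst n)"

abbreviation incr :: "string \<Rightarrow> com" where
  "incr x \<equiv> NAssign x (NConst 0) (NAdd (nvar x) (NConst 1))"

text \<open>The entries of guess \<open>g\<close> occupy the cells of the arrays \<open>p\<close> (points), \<open>q\<close> (centers) and \<open>t\<close>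
  (arrival times) from index \<open>g * S + H[g]\<close> on, and \<open>N[g]\<close> is their number. Departures only
  advance \<open>H[g]\<close>; the next arrival moves the entries back to index \<open>g * S\<close>.\<close>

definition init_prog :: "nat \<Rightarrow> com" where
  "init_prog D =
     RAssign ''e'' (NConst 0) (rvar ''eps'') ;;
     NAssign ''K'' (NConst 0) (nvar ''k'') ;;
     While (RLess (rvar ''e'') (rnum 32))
       (RAssign ''e'' (NConst 0) (RAdd (rvar ''e'') (rvar ''e'')) ;;
        NAssign ''K'' (NConst 0) (NMul (nvar ''K'') (NConst D))) ;;
     NAssign ''L'' (NConst 0) (NAdd (NMul (nvar ''K'') (NAdd (nvar ''z'') (NConst 1))) (nvar ''z'')) ;;
     NAssign ''S'' (NConst 0) (NAdd (nvar ''L'') (NConst 2)) ;;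
     NAssign ''G'' (NConst 0) (NConst 2) ;;
     RAssign ''r'' (NConst 0) (RDiv (rvar ''dmin'') (rnum 2)) ;;
     RAssign ''D'' (NConst 1) (RDiv (RMul (rvar ''eps'') (rvar ''r'')) (rnum 4)) ;;
     While (RLess (rvar ''r'') (rvar ''dmax''))
       (RAssign ''r'' (NConst 0) (RAdd (rvar ''r'') (rvar ''r'')) ;;
        RAssign ''D'' (nvar ''G'') (RDiv (RMul (rvar ''eps'') (rvar ''r'')) (rnum 4)) ;;
        incr ''G'')"

abbreviation src :: nexp where "src \<equiv> NAdd (nvar ''b'') (nvar ''j'')"

abbreviation for_entries :: "com \<Rightarrow> com" where
  "for_entries c \<equiv>
     NAssign ''j'' (NConst 0) (NConst 0) ;;
     While (NLess (nvar ''j'') (NCell ''N'' (nvar ''g''))) (c ;; incr ''j'')"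

text \<open>Points are opaque and cannot be compared, so equality of labels is tested as a distance
  that is not positive. This is sound for points of \<open>M\<close>.\<close>

abbreviation in_class :: bexp where
  "in_class \<equiv> BNot (RLess (rnum 0) (RDist (PCell ''q'' src) (pvar ''c'')))"

definition find_center :: com where
  "find_center =
     PAssign ''c'' (NConst 0) (pvar ''new'') ;;
     for_entries (Cond (RLess (RCell ''D'' (nvar ''g'')) (RDist (PCell ''q'' src) (pvar ''new'')))
       Skip (PAssign ''c'' (NConst 0) (PCell ''q'' src)))"

definition count_class :: com where
  "count_class =
     NAssign ''m'' (NConst 0) (NConst 0) ;;
     for_entries (Cond in_class (incr ''m'') Skip)"

text \<open>Pruning and compaction happen in one pass and in place, from \<open>b + j\<close> to
  \<open>i\<close>; the write position never overtakes the read position.\<close>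

definition prune_class :: com where
  "prune_class =
     NAssign ''i'' (NConst 0) (NMul (nvar ''g'') (nvar ''S'')) ;;
     for_entries (Cond (BAnd (NLess (nvar ''z'') (nvar ''m'')) in_class)
       (NAssign ''m'' (NConst 0) (NSub (nvar ''m'') (NConst 1)))
       (PAssign ''p'' (nvar ''i'') (PCell ''p'' src) ;;
        PAssign ''q'' (nvar ''i'') (PCell ''q'' src) ;;
        RAssign ''t'' (nvar ''i'') (RCell ''t'' src) ;;
        incr ''i''))"

definition push :: com where
  "push =
     PAssign ''p'' (nvar ''i'') (pvar ''new'') ;;
     PAssign ''q'' (nvar ''i'') (pvar ''c'') ;;
     RAssign ''t'' (nvar ''i'') (rvar ''now'') ;;
     NAssign ''H'' (nvar ''g'') (NConst 0) ;;
     NAssign ''N'' (nvar ''g'') (NSub (NAdd (nvar ''i'') (NConst 1)) (NMul (nvar ''g'') (nvar ''S'')))"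

definition pop :: com where
  "pop =
     NAssign ''H'' (nvar ''g'') (NAdd (NCell ''H'' (nvar ''g'')) (NConst 1)) ;;
     NAssign ''N'' (nvar ''g'') (NSub (NCell ''N'' (nvar ''g'')) (NConst 1))"

definition arrive_guess :: com where
  "arrive_guess =
     NAssign ''b'' (NConst 0) (NAdd (NMul (nvar ''g'') (nvar ''S'')) (NCell ''H'' (nvar ''g''))) ;;
     find_center ;; count_class ;; prune_class ;;
     push ;;
     Cond (NLess (NAdd (nvar ''L'') (NConst 1)) (NCell ''N'' (nvar ''g''))) pop Skip ;;
     incr ''g''"

definition depart_guess :: com where
  "depart_guess =
     Cond (BAnd (NLess (NConst 0) (NCell ''N'' (nvar ''g'')))
         (BNot (RLess (rvar ''now'')
           (RAdd (RCell ''t'' (NAdd (NMul (nvar ''g'') (nvar ''S'')) (NCell ''H'' (nvar ''g'')))) (rvar ''W'')))))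
       pop Skip ;;
     incr ''g''"

abbreviation for_guesses :: "com \<Rightarrow> com" where
  "for_guesses c \<equiv>
     NAssign ''g'' (NConst 0) (NConst 0) ;;
     While (NLess (nvar ''g'') (nvar ''G'')) c"

text \<open>A report may add only constant time to the static algorithm, so the search for the
  usable guess is charged to the events instead.\<close>

definition set_best :: com where
  "set_best =
     NAssign ''B'' (NConst 0) (NConst 0) ;;
     While (NLess (nvar ''L'') (NCell ''N'' (nvar ''B''))) (incr ''B'')"

definition report_prog :: com where
  "report_prog =
     Solve ''p'' (NAdd (NMul (nvar ''B'') (nvar ''S'')) (NCell ''H'' (nvar ''B''))) (NCell ''N'' (nvar ''B''))
       ''centers'' ''radius'' ;;
     RAssign ''radius'' (NConst 0)
       (RAdd (RAdd (rvar ''radius'') (RCell ''D'' (nvar ''B''))) (RCell ''D'' (nvar ''B'')))"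

definition sketch_prog :: "nat \<Rightarrow> sketch_alg" where
  "sketch_prog D =
     \<lparr>on_init = init_prog D, on_arrival = for_guesses arrive_guess ;; set_best,
      on_departure = for_guesses depart_guess ;; set_best, on_report = report_prog\<rparr>"

definition names :: "string set" where
  "names = {''k'', ''z'', ''eps'', ''dmin'', ''dmax'', ''W'', ''now'', ''new'', ''centers'', ''radius'',
     ''e'', ''K'', ''L'', ''S'', ''G'', ''r'', ''D'', ''b'', ''j'', ''c'', ''m'', ''i'', ''p'', ''q'', ''t'',
     ''H'', ''N'', ''g'', ''B''}"

lemma names_mem [simp]:
  "''k'' \<in> names" "''z'' \<in> names" "''eps'' \<in> names" "''dmin'' \<in> names" "''dmax'' \<in> names" "''W'' \<in> names"
  "''now'' \<in> names" "''new'' \<in> names" "''centers'' \<in> names" "''radius'' \<in> names" "''e'' \<in> names"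
  "''K'' \<in> names" "''L'' \<in> names" "''S'' \<in> names" "''G'' \<in> names" "''r'' \<in> names" "''D'' \<in> names"
  "''b'' \<in> names" "''j'' \<in> names" "''c'' \<in> names" "''m'' \<in> names" "''i'' \<in> names" "''p'' \<in> names"
  "''q'' \<in> names" "''t'' \<in> names" "''H'' \<in> names" "''N'' \<in> names" "''g'' \<in> names" "''B'' \<in> names"
  by (simp_all add: names_def)

lemma card_names: "card names = 29" and finite_names: "finite names"
  by (simp_all add: names_def)

section \<open>Layout of the lists in memory, and initialization\<close>

context sliding_window
begin

text \<open>A block holds \<open>L + 2\<close> cells because an arrival appends before it checks for
  overflow.\<close>

definition S :: nat where "S = L + 2"
text \<open>An index bound common to all arrays: \<open>G * S\<close> for the blocks, which also
  exceeds \<open>G\<close> for the tables by guess, and \<open>k\<close> for the reported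
  centers.\<close>

definition B :: nat where "B = G * S + k"

definition env :: "'a mem \<Rightarrow> bool" where
  "env s \<longleftrightarrow> NV s ''z'' 0 = z \<and> NV s ''L'' 0 = L \<and> NV s ''S'' 0 = S \<and> NV s ''G'' 0 = G \<and>
     RV s ''W'' 0 = W \<and> (\<forall>g<G. RV s ''D'' g = thr g) \<and> fits names B s"

text \<open>The index of an entry is a ghost value: only its point, label and arrival time are
  stored.\<close>

definition block :: "'a mem \<Rightarrow> nat \<Rightarrow> (nat \<times> 'a) list \<Rightarrow> bool" where
  "block s a l \<longleftrightarrow> (\<forall>j<length l. PV s ''p'' (a + j) = p (fst (l ! j)) \<and>
     PV s ''q'' (a + j) = snd (l ! j) \<and> RV s ''t'' (a + j) = ta (fst (l ! j)))"

definition seg :: "'a mem \<Rightarrow> nat \<Rightarrow> (nat \<times> 'a) list \<Rightarrow> bool" where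
  "seg s g l \<longleftrightarrow> NV s ''N'' g = length l \<and> NV s ''H'' g + length l \<le> S \<and>
     block s (g * S + NV s ''H'' g) l"

lemma env_agree:
  "env s \<Longrightarrow> agree X s s' \<Longrightarrow> fits names B s' \<Longrightarrow> X \<inter> {''z'', ''L'', ''S'', ''G'', ''W'', ''D''} = {} \<Longrightarrow> env s'"
  unfolding env_def agree_def by (auto simp: disjoint_iff)

lemma seg_agree:
  "seg s g l \<Longrightarrow> agree X s s' \<Longrightarrow> X \<inter> {''N'', ''H'', ''p'', ''q'', ''t''} = {} \<Longrightarrow> seg s' g l"
  unfolding seg_def block_def agree_def disjoint_iff by (metis insertCI)

lemma G_ge: "2 \<le> G" and B_ge: "k \<le> B" "g < G \<Longrightarrow> g * S + S \<le> B" "G \<le> B" "2 \<le> B"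
proof -
  have S: "2 \<le> S" by (simp add: S_def)
  show G: "2 \<le> G" by (simp add: G_def)
  have "G * 1 \<le> G * S" using S by (intro mult_le_mono2) auto
  then show "G \<le> B" unfolding B_def by linarith
  then show "2 \<le> B" using G by linarith
  show "k \<le> B" by (simp add: B_def)
  assume "g < G"
  then have "Suc g * S \<le> G * S" by (intro mult_le_mono1) auto
  then show "g * S + S \<le> B" by (simp add: B_def)
qed

text \<open>The first loop doubles \<epsilon> up to 32, multiplying \<open>k\<close> by
  \<open>D\<close> each time, which yields \<open>k * D ^ J\<close>. The second doubles \<rho> up to
  \<open>\<Delta>max\<close> and tabulates the thresholds.\<close>

lemma env_init:
  "wp \<delta> A T (init_prog D) (J * 3 + I * 4 + 20)
     (\<lambda>s. env s \<and> (\<forall>x. NV s ''N'' x = 0 \<and> NV s ''H'' x = 0) \<and> NV s ''B'' 0 = 0)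
     (input_mem k z \<epsilon> \<Delta>min \<Delta>max W)"
proof -
  let ?s = "input_mem k z \<epsilon> \<Delta>min \<Delta>max W :: 'a mem"
  have in_vals: "NV ?s ''k'' 0 = k" "NV ?s ''z'' 0 = z" "RV ?s ''eps'' 0 = \<epsilon>" "RV ?s ''dmin'' 0 = \<Delta>min"
    "RV ?s ''dmax'' 0 = \<Delta>max" "RV ?s ''W'' 0 = W" "RV ?s ''D'' x = 0"
    "NV ?s ''N'' x = 0" "NV ?s ''H'' x = 0" "NV ?s ''B'' x = 0" for x
    by (auto simp: input_mem_def NV_def RV_def)
  have in_fits: "fits names B ?s"
    using B_ge(4) by (auto simp: input_mem_def fits_def)
  define loop1 where "loop1 n s \<longleftrightarrow> agree {''e'', ''K''} ?s s \<and> fits names B s \<and>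
    RV s ''e'' 0 = \<epsilon> * 2 ^ n \<and> NV s ''K'' 0 = k * D ^ n" for n and s :: "'a mem"
  \<comment> \<open>Cell 0 of the threshold table is never written: an absent cell reads as 0, which
    is \<open>thr 0\<close>. Empty lists and the initial best guess rely on the same
    default.\<close>
  define loop2 where "loop2 n s \<longleftrightarrow> agree {''e'', ''K'', ''L'', ''S'', ''G'', ''r'', ''D''} ?s s \<and> fits names B s \<and>
    NV s ''L'' 0 = L \<and> NV s ''S'' 0 = S \<and> NV s ''G'' 0 = n + 2 \<and> RV s ''r'' 0 = \<rho> n \<and>
    (\<forall>g<n+2. RV s ''D'' g = thr g)" for n and s :: "'a mem"
  have pos: "0 < B" "Suc 0 < B" using B_ge(4) by auto
  let ?b1 = "RAssign ''e'' (NConst 0) (RAdd (rvar ''e'') (rvar ''e'')) ;;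
        NAssign ''K'' (NConst 0) (NMul (nvar ''K'') (NConst D))"
  let ?b2 = "RAssign ''r'' (NConst 0) (RAdd (rvar ''r'') (rvar ''r'')) ;;
        RAssign ''D'' (nvar ''G'') (RDiv (RMul (rvar ''eps'') (rvar ''r'')) (rnum 4)) ;;
        incr ''G''"
  have w1: "wp \<delta> A T (While (RLess (rvar ''e'') (rnum 32)) ?b1) (1 + J * (1 + cost ?b1)) (loop1 J) s"
    if "loop1 0 s" for s
  proof (rule wp_While_loop_free[where I = loop1 and K = J])
    show "loop1 0 s" by (rule that)
  next
    fix n s assume "n < J" "loop1 n s"
    then show "bval \<delta> (RLess (rvar ''e'') (rnum 32)) s \<and> loop1 (Suc n) (sem \<delta> ?b1 s)"
      using J_spec(2)[of n] pos by (simp add: loop1_def)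
  next
    fix s assume "loop1 J s"
    then show "\<not> bval \<delta> (RLess (rvar ''e'') (rnum 32)) s" using J_spec(1) by (simp add: loop1_def)
  qed simp
  have w2: "wp \<delta> A T (While (RLess (rvar ''r'') (rvar ''dmax'')) ?b2) (1 + I * (1 + cost ?b2)) (loop2 I) s"
    if "loop2 0 s" for s
  proof (rule wp_While_loop_free[where I = loop2 and K = I])
    show "loop2 0 s" by (rule that)
  next
    fix n s assume n: "n < I" "loop2 n s"
    then have "RV s ''dmax'' 0 = \<Delta>max" "RV s ''eps'' 0 = \<epsilon>"
      using in_vals by (simp_all add: loop2_def agree_def)
    moreover have "n + 2 < B" using n(1) B_ge(3) by (simp add: G_def)
    moreover have "thr (n + 2) = \<epsilon> * \<rho> (Suc n) / 4" by (simp add: thr_def)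
    moreover have "\<rho> (Suc n) = \<rho> n + \<rho> n" by (simp add: \<rho>_def)
    ultimately show "bval \<delta> (RLess (rvar ''r'') (rvar ''dmax'')) s \<and> loop2 (Suc n) (sem \<delta> ?b2 s)"
      using n(2) I_spec(2)[OF n(1)] pos by (auto simp: loop2_def less_Suc_eq)
  next
    fix s assume "loop2 I s"
    moreover from this have "RV s ''dmax'' 0 = \<Delta>max" using in_vals by (simp add: loop2_def agree_def)
    ultimately show "\<not> bval \<delta> (RLess (rvar ''r'') (rvar ''dmax'')) s" using I_spec(1) by (simp add: loop2_def)
  qed simp
  have start: "loop1 0 (sem \<delta> (NAssign ''K'' (NConst 0) (nvar ''k'')) (sem \<delta> (RAssign ''e'' (NConst 0) (rvar ''eps'')) ?s))"
    using in_vals in_fits pos(1) by (simp add: loop1_def)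
  let ?mid = "\<lambda>c. NAssign ''L'' (NConst 0) (NAdd (NMul (nvar ''K'') (NAdd (nvar ''z'') (NConst 1))) (nvar ''z'')) ;;
     NAssign ''S'' (NConst 0) (NAdd (nvar ''L'') (NConst 2)) ;;
     NAssign ''G'' (NConst 0) (NConst 2) ;;
     RAssign ''r'' (NConst 0) (RDiv (rvar ''dmin'') (rnum 2)) ;;
     RAssign ''D'' (NConst 1) (RDiv (RMul (rvar ''eps'') (rvar ''r'')) (rnum 4)) ;; c"
  have mid: "loop2 0 (sem \<delta> (?mid Skip) s)" if s: "loop1 J s" for s
  proof -
    have v: "NV s ''z'' 0 = z" "RV s ''eps'' 0 = \<epsilon>" "RV s ''dmin'' 0 = \<Delta>min" "RV s ''D'' 0 = 0"
      using s in_vals by (simp_all add: loop1_def agree_def)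
    have a: "agree {''e'', ''K'', ''L'', ''S'', ''G'', ''r'', ''D''} ?s s"
      using s by (auto simp: loop1_def agree_def)
    show ?thesis using s v a pos
      by (auto simp: loop1_def loop2_def L_def S_def \<rho>_def thr_def less_Suc_eq numeral_2_eq_2)
  qed
  have step: "wp \<delta> A T (c1 ;; c2) (1 + b) R s" if "loop_free c1" "cost c1 = 1" "wp \<delta> A T c2 b R (sem \<delta> c1 s)"
    for c1 c2 b R s
    using wp_Seq[OF wp_loop_free[OF that(1), of "wp \<delta> A T c2 b R"]] that by simp
  have w3: "wp \<delta> A T (?mid (While (RLess (rvar ''r'') (rvar ''dmax'')) ?b2))
      (1 + (1 + (1 + (1 + (1 + (1 + I * (1 + cost ?b2))))))) (loop2 I) s" if "loop1 J s" for s
    by (intro step) (use w2 mid[OF that] in simp_all)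
  have "wp \<delta> A T (init_prog D) (1 + (1 + ((1 + J * (1 + cost ?b1)) +
      (1 + (1 + (1 + (1 + (1 + (1 + I * (1 + cost ?b2))))))))))
     (loop2 I) ?s"
    unfolding init_prog_def
    by (intro step wp_Seq wp_mono[OF w1[OF start] order_refl] w3) simp_all
  then show ?thesis
  proof (rule wp_mono)
    fix s assume s: "loop2 I s"
    have v: "NV s ''z'' 0 = z" "RV s ''W'' 0 = W" "NV s ''N'' x = 0" "NV s ''H'' x = 0" "NV s ''B'' 0 = 0" for x
      using s in_vals by (simp_all add: loop2_def agree_def)
    show "env s \<and> (\<forall>x. NV s ''N'' x = 0 \<and> NV s ''H'' x = 0) \<and> NV s ''B'' 0 = 0"
      using s v by (auto simp: env_def loop2_def G_def)
  qed simp
qed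

lemma wp_set_best:
  assumes env: "env s" and b: "b < G" "NV s ''N'' b \<le> L" "\<And>h. h < b \<Longrightarrow> L < NV s ''N'' h"
  shows "wp \<delta> A T set_best (2 * G + 2) (\<lambda>s'. agree {''B''} s s' \<and> fits names B s' \<and> NV s' ''B'' 0 = b) s"
proof -
  define P where "P n s' \<longleftrightarrow> agree {''B''} s s' \<and> fits names B s' \<and> NV s' ''B'' 0 = n" for n s'
  have P: "NV s' ''L'' 0 = L \<and> NV s' ''N'' x = NV s ''N'' x" if "P n s'" for n s' x
    using that env by (simp add: P_def agree_def env_def)
  have pos: "0 < B" using B_ge(4) by simp
  have "wp \<delta> A T (While (NLess (nvar ''L'') (NCell ''N'' (nvar ''B''))) (incr ''B''))
      (1 + b * (1 + cost (incr ''B''))) (P b) (sem \<delta> (NAssign ''B'' (NConst 0) (NConst 0)) s)"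
  proof (rule wp_While_loop_free)
    show "P 0 (sem \<delta> (NAssign ''B'' (NConst 0) (NConst 0)) s)" using env pos by (simp add: P_def env_def)
  next
    fix n s' assume n: "n < b" "P n s'"
    then show "bval \<delta> (NLess (nvar ''L'') (NCell ''N'' (nvar ''B''))) s' \<and> P (Suc n) (sem \<delta> (incr ''B'') s')"
      using b(3)[OF n(1)] P[OF n(2)] pos by (simp add: P_def)
  next
    fix s' assume "P b s'"
    then show "\<not> bval \<delta> (NLess (nvar ''L'') (NCell ''N'' (nvar ''B''))) s'"
      using b(2) P by (simp add: P_def not_less)
  qed simp
  then have "wp \<delta> A T set_best (cost (NAssign ''B'' (NConst 0) (NConst 0)) + (1 + b * (1 + cost (incr ''B'')))) (P b) s"
    unfolding set_best_def by (intro wp_Seq wp_loop_free) simp_all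
  then show ?thesis
    by (rule wp_mono) (use b(1) in \<open>auto simp: P_def\<close>)
qed

end

section \<open>Correctness of the program\<close>

lemma wp_for_entries:
  assumes lf: "loop_free c"
    and start: "P 0 (write_nat (''j'', 0) 0 s)"
    and step: "\<And>n s'. n < K \<Longrightarrow> P n s' \<Longrightarrow> P (Suc n) (sem \<delta> (c ;; incr ''j'') s')"
    and guard: "\<And>n s'. n \<le> K \<Longrightarrow> P n s' \<Longrightarrow> NV s' ''j'' 0 = n \<and> NV s' ''N'' (NV s' ''g'' 0) = K"
  shows "wp \<delta> A T (for_entries c) (2 + K * (2 + cost c)) (P K) s"
proof -
  have "wp \<delta> A T (While (NLess (nvar ''j'') (NCell ''N'' (nvar ''g''))) (c ;; incr ''j''))
      (1 + K * (1 + cost (c ;; incr ''j''))) (P K) (write_nat (''j'', 0) 0 s)"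
  proof (rule wp_While_loop_free[where I = P])
    show "loop_free (c ;; incr ''j'')" using lf by simp
    show "P 0 (write_nat (''j'', 0) 0 s)" by (rule start)
  next
    fix n s' assume "n < K" "P n s'"
    then show "bval \<delta> (NLess (nvar ''j'') (NCell ''N'' (nvar ''g''))) s' \<and> P (Suc n) (sem \<delta> (c ;; incr ''j'') s')"
      using step guard[of n s'] by simp
  next
    fix s' assume "P K s'"
    then show "\<not> bval \<delta> (NLess (nvar ''j'') (NCell ''N'' (nvar ''g''))) s'" using guard[of K s'] by simp
  qed
  then have "wp \<delta> A T (for_entries c)
      (cost (NAssign ''j'' (NConst 0) (NConst 0)) + (1 + K * (1 + cost (c ;; incr ''j'')))) (P K) s"
    by (intro wp_Seq wp_loop_free) simp_all
  then show ?thesis by (rule wp_mono) simp_all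
qed

lemma wp_Seq_loop_free:
  assumes "loop_free c1" "wp \<delta> A T c2 b Q (sem \<delta> c1 s)"
  shows "wp \<delta> A T (c1 ;; c2) (cost c1 + b) Q s"
  by (intro wp_Seq wp_loop_free assms)

context sliding_window
begin

lemma block_append:
  "block s a (l @ l') \<longleftrightarrow> block s a l \<and> block s (a + length l) l'"
proof -
  have "(\<forall>j<m + n. P j) \<longleftrightarrow> (\<forall>j<m. P j) \<and> (\<forall>j<n. P (m + j))" for P and m n :: nat
  proof (intro iffI conjI allI impI)
    fix j assume *: "(\<forall>j<m. P j) \<and> (\<forall>j<n. P (m + j))" "j < m + n"
    show "P j"
    proof (cases "j < m")
      case False
      then have "j - m < n" "m + (j - m) = j" using *(2) by auto
      then show ?thesis using *(1) by metis
    qed (use * in auto)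
  qed auto
  then show ?thesis by (simp add: block_def nth_append add.assoc)
qed

lemma block_single:
  "block s a [x] \<longleftrightarrow> PV s ''p'' a = p (fst x) \<and> PV s ''q'' a = snd x \<and> RV s ''t'' a = ta (fst x)"
  by (simp add: block_def)

lemma block_Nil [simp]: "block s a []"
  by (simp add: block_def)

lemma block_cong:
  assumes "block s a l"
    and "\<And>x. a \<le> x \<Longrightarrow> x < a + length l \<Longrightarrow>
      PV s' ''p'' x = PV s ''p'' x \<and> PV s' ''q'' x = PV s ''q'' x \<and> RV s' ''t'' x = RV s ''t'' x"
  shows "block s' a l"
  using assms by (auto simp: block_def)

lemma block_nth:
  assumes "block s a l" "j < length l"
  shows "PV s ''p'' (a + j) = p (fst (l ! j))" "PV s ''q'' (a + j) = snd (l ! j)" "RV s ''t'' (a + j) = ta (fst (l ! j))"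
  using assms by (auto simp: block_def)

text \<open>The precondition shared by the three passes of an arrival. The bound
  \<open>g * S \<le> a\<close> lets compaction write behind the read position.\<close>

definition scan :: "'a mem \<Rightarrow> nat \<Rightarrow> nat \<Rightarrow> (nat \<times> 'a) list \<Rightarrow> bool" where
  "scan s g a l \<longleftrightarrow> env s \<and> g < G \<and> NV s ''g'' 0 = g \<and> NV s ''b'' 0 = a \<and> NV s ''N'' g = length l \<and>
     block s a l \<and> g * S \<le> a \<and> a + length l \<le> g * S + S \<and> (\<forall>x\<in>set l. snd x \<in> M)"

lemma scan_agree:
  assumes "scan s g a l" "agree X s s'" "fits names B s'"
    "X \<inter> {''z'', ''L'', ''S'', ''G'', ''W'', ''D'', ''g'', ''b'', ''N'', ''p'', ''q'', ''t''} = {}"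
  shows "scan s' g a l"
proof -
  have "env s'" using env_agree assms unfolding scan_def by blast
  moreover have "''g'' \<notin> X" "''b'' \<notin> X" "''N'' \<notin> X" "''p'' \<notin> X" "''q'' \<notin> X" "''t'' \<notin> X"
    using assms(4) by auto
  ultimately show ?thesis using assms(1,2) unfolding scan_def block_def agree_def by simp
qed

lemma fits_env: "env s \<Longrightarrow> fits names B s"
  by (simp add: env_def)

lemma B_pos: "0 < B"
  using B_ge(4) by simp

section \<open>The three passes over one list\<close>

lemma wp_find_center:
  assumes s: "scan s g a l" and x: "PV s ''new'' 0 = x"
  shows "wp \<delta> A T find_center (4 * length l + 3)
    (\<lambda>s'. agree {''c'', ''j''} s s' \<and> fits names B s' \<and> PV s' ''c'' 0 = center_for \<delta> (thr g) x l) s"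
proof -
  define P where "P n s' \<longleftrightarrow> agree {''c'', ''j''} s s' \<and> fits names B s' \<and> NV s' ''j'' 0 = n \<and>
    PV s' ''c'' 0 = center_for \<delta> (thr g) x (take n l)" for n s'
  have P: "NV s' ''g'' 0 = g \<and> NV s' ''b'' 0 = a \<and> NV s' ''N'' g = length l \<and> RV s' ''D'' g = thr g \<and>
      PV s' ''new'' 0 = x \<and> block s' a l" if "P n s'" for n s'
    using that s x unfolding P_def scan_def env_def block_def agree_def by simp
  have "wp \<delta> A T (for_entries (Cond (RLess (RCell ''D'' (nvar ''g'')) (RDist (PCell ''q'' src) (pvar ''new'')))
       Skip (PAssign ''c'' (NConst 0) (PCell ''q'' src))))
     (2 + length l * (2 + cost (Cond (RLess (RCell ''D'' (nvar ''g'')) (RDist (PCell ''q'' src) (pvar ''new'')))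
       Skip (PAssign ''c'' (NConst 0) (PCell ''q'' src))))) (P (length l))
     (sem \<delta> (PAssign ''c'' (NConst 0) (pvar ''new'')) s)"
  proof (rule wp_for_entries)
    show "P 0 (write_nat (''j'', 0) 0 (sem \<delta> (PAssign ''c'' (NConst 0) (pvar ''new'')) s))"
      using s x B_pos fits_env unfolding P_def scan_def by (simp add: center_for_def)
  next
    fix n s' assume n: "n < length l" "P n s'"
    note v = P[OF n(2)]
    have "take (Suc n) l = take n l @ [l ! n]" using n(1) by (simp add: take_Suc_conv_app_nth)
    then have c: "center_for \<delta> (thr g) x (take (Suc n) l) =
        (if thr g < \<delta> (snd (l ! n)) x then center_for \<delta> (thr g) x (take n l) else snd (l ! n))"
      by (simp add: center_for_def)
    have "PV s' ''q'' (a + n) = snd (l ! n)" using v block_nth n(1) by blast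
    then show "P (Suc n) (sem \<delta> (Cond (RLess (RCell ''D'' (nvar ''g'')) (RDist (PCell ''q'' src) (pvar ''new'')))
       Skip (PAssign ''c'' (NConst 0) (PCell ''q'' src)) ;; incr ''j'') s')"
      using n(2) v B_pos unfolding P_def by (simp add: c)
  qed (use P in \<open>auto simp: P_def\<close>)
  then show ?thesis unfolding find_center_def
    by (rule wp_mono[OF wp_Seq_loop_free[rotated]]) (auto simp: P_def)
qed

lemma in_class_eq:
  assumes "scan s g a l" "PV s ''c'' 0 = y" "y \<in> M" "n < length l" "NV s ''j'' 0 = n"
  shows "bval \<delta> in_class s \<longleftrightarrow> snd (l ! n) = y"
proof -
  have "PV s ''q'' (a + n) = snd (l ! n)" "NV s ''b'' 0 = a" "snd (l ! n) \<in> M"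
    using assms block_nth unfolding scan_def by auto
  then show ?thesis using assms nonneg[of "snd (l ! n)" y] zero[of "snd (l ! n)" y] by auto
qed

lemma wp_count_class:
  assumes s: "scan s g a l" and y: "PV s ''c'' 0 = y" "y \<in> M"
  shows "wp \<delta> A T count_class (4 * length l + 3)
    (\<lambda>s'. agree {''m'', ''j''} s s' \<and> fits names B s' \<and> NV s' ''m'' 0 = length (class_of y l)) s"
proof -
  define P where "P n s' \<longleftrightarrow> agree {''m'', ''j''} s s' \<and> fits names B s' \<and> NV s' ''j'' 0 = n \<and>
    NV s' ''m'' 0 = length (class_of y (take n l))" for n s'
  have P: "scan s' g a l" "PV s' ''c'' 0 = y" if "P n s'" for n s'
  proof -
    have "agree {''m'', ''j''} s s'" "fits names B s'" using that by (auto simp: P_def)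
    then show "scan s' g a l" "PV s' ''c'' 0 = y"
      using scan_agree[OF s, of "{''m'', ''j''}"] y by (simp_all add: agree_def)
  qed
  have "wp \<delta> A T (for_entries (Cond in_class (incr ''m'') Skip))
     (2 + length l * (2 + cost (Cond in_class (incr ''m'') Skip))) (P (length l))
     (sem \<delta> (NAssign ''m'' (NConst 0) (NConst 0)) s)"
  proof (rule wp_for_entries)
    show "P 0 (write_nat (''j'', 0) 0 (sem \<delta> (NAssign ''m'' (NConst 0) (NConst 0)) s))"
      using s B_pos fits_env unfolding P_def scan_def by (simp add: class_of_def)
  next
    fix n s' assume n: "n < length l" "P n s'"
    have "take (Suc n) l = take n l @ [l ! n]" using n(1) by (simp add: take_Suc_conv_app_nth)
    then have c: "length (class_of y (take (Suc n) l)) =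
        length (class_of y (take n l)) + (if snd (l ! n) = y then 1 else 0)"
      by (simp add: class_of_def)
    have "bval \<delta> in_class s' \<longleftrightarrow> snd (l ! n) = y"
      using in_class_eq[OF P(1,2)[OF n(2)] y(2) n(1)] n(2) unfolding P_def by blast
    then show "P (Suc n) (sem \<delta> (Cond in_class (incr ''m'') Skip ;; incr ''j'') s')"
      using n(2) B_pos unfolding P_def by (simp add: c del: bval.simps)
  qed (use P in \<open>auto simp: P_def scan_def\<close>)
  then show ?thesis unfolding count_class_def
    by (rule wp_mono[OF wp_Seq_loop_free[rotated]]) (auto simp: P_def)
qed

text \<open>All guesses share the arrays of entries, so a frame by names is too coarse for them;
  this one works by blocks.\<close>

definition same_outside :: "nat \<Rightarrow> 'a mem \<Rightarrow> 'a mem \<Rightarrow> bool" where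
  "same_outside g s s' \<longleftrightarrow> (\<forall>x. x < g * S \<or> g * S + S \<le> x \<longrightarrow>
     PV s' ''p'' x = PV s ''p'' x \<and> PV s' ''q'' x = PV s ''q'' x \<and> RV s' ''t'' x = RV s ''t'' x)"

lemma foldl_prune_step_length: "length (snd (foldl (prune_step z y) st l)) \<le> length (snd st) + length l"
  by (induction l rule: rev_induct) (auto simp: prune_step_def)

text \<open>The loop invariant has two halves: the front of the block holds the output for the first
  \<open>n\<close> entries, and the unread input from \<open>a + n\<close> on is still
  intact.\<close>

lemma wp_prune_class:
  assumes s: "scan s g a l" and y: "PV s ''c'' 0 = y" "y \<in> M" and m: "NV s ''m'' 0 = length (class_of y l)"
  shows "wp \<delta> A T prune_class (8 * length l + 3)
    (\<lambda>s'. agree {''i'', ''j'', ''m'', ''p'', ''q'', ''t''} s s' \<and> fits names B s' \<and> same_outside g s s' \<and>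
       NV s' ''i'' 0 = g * S + length (prune z y l) \<and> block s' (g * S) (prune z y l)) s"
proof -
  define st where "st n = foldl (prune_step z y) (length (class_of y l), []) (take n l)" for n
  define P where "P n s' \<longleftrightarrow> agree {''i'', ''j'', ''m'', ''p'', ''q'', ''t''} s s' \<and> fits names B s' \<and>
    same_outside g s s' \<and> NV s' ''j'' 0 = n \<and> NV s' ''m'' 0 = fst (st n) \<and>
    NV s' ''i'' 0 = g * S + length (snd (st n)) \<and> block s' (g * S) (snd (st n)) \<and>
    block s' (a + n) (drop n l)" for n s'
  have P: "NV s' ''g'' 0 = g" "NV s' ''b'' 0 = a" "NV s' ''N'' g = length l" "NV s' ''z'' 0 = z" "PV s' ''c'' 0 = y"
    if "P n s'" for n s'
    using that s y unfolding P_def scan_def env_def agree_def by simp_all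
  have a: "g * S \<le> a" "a + length l \<le> g * S + S" "g * S + S \<le> B" "\<forall>x\<in>set l. snd x \<in> M"
    using s B_ge(2) unfolding scan_def by auto
  let ?body = "Cond (BAnd (NLess (nvar ''z'') (nvar ''m'')) in_class)
       (NAssign ''m'' (NConst 0) (NSub (nvar ''m'') (NConst 1)))
       (PAssign ''p'' (nvar ''i'') (PCell ''p'' src) ;;
        PAssign ''q'' (nvar ''i'') (PCell ''q'' src) ;;
        RAssign ''t'' (nvar ''i'') (RCell ''t'' src) ;;
        incr ''i'')"
  have "wp \<delta> A T (for_entries ?body) (2 + length l * (2 + cost ?body)) (P (length l))
     (sem \<delta> (NAssign ''i'' (NConst 0) (NMul (nvar ''g'') (nvar ''S''))) s)"
  proof (rule wp_for_entries)
    show "P 0 (write_nat (''j'', 0) 0 (sem \<delta> (NAssign ''i'' (NConst 0) (NMul (nvar ''g'') (nvar ''S''))) s))"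
      using s m B_pos unfolding P_def scan_def env_def
      by (auto simp: st_def same_outside_def elim!: block_cong)
  next
    fix n s' assume n: "n < length l" "P n s'"
    note v = P[OF n(2)]
    have st: "st (Suc n) = prune_step z y (st n) (l ! n)"
      using n(1) by (simp add: st_def take_Suc_conv_app_nth)
    \<comment> \<open>Output never exceeds the input read. Since also \<open>g * S \<le> a\<close>,
      a write hits at most the entry just being copied, never an unread one.\<close>
    have le: "length (snd (st n)) \<le> n"
      using foldl_prune_step_length[of y "(length (class_of y l), [])" "take n l"] by (simp add: st_def)
    have drop: "drop n l = l ! n # drop (Suc n) l" using n(1) by (simp add: Cons_nth_drop_Suc)
    have blk: "block s' (a + n) [l ! n]" "block s' (a + Suc n) (drop (Suc n) l)"
      using n(2) block_append[of s' "a + n" "[l ! n]" "drop (Suc n) l"] unfolding P_def drop by auto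
    then have cell: "PV s' ''p'' (a + n) = p (fst (l ! n))" "PV s' ''q'' (a + n) = snd (l ! n)"
      "RV s' ''t'' (a + n) = ta (fst (l ! n))" by (auto simp: block_single)
    have j: "NV s' ''j'' 0 = n" using n(2) by (simp add: P_def)
    have ic: "0 < \<delta> (snd (l ! n)) y \<longleftrightarrow> snd (l ! n) \<noteq> y"
      using a(4) n(1) y(2) nonneg[of "snd (l ! n)" y] zero[of "snd (l ! n)" y] by (auto simp: order_le_less)
    have idx: "g * S + length (snd (st n)) < B" "g * S + length (snd (st n)) < g * S + S"
      using le n(1) a by linarith+
    show "P (Suc n) (sem \<delta> (?body ;; incr ''j'') s')"
    proof (cases "z < fst (st n) \<and> snd (l ! n) = y")
      case True
      then have "st (Suc n) = (fst (st n) - 1, snd (st n))" by (simp add: st prune_step_def)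
      then show ?thesis using n(2) True v cell ic B_pos blk(2) unfolding P_def
        by (auto simp: same_outside_def elim!: block_cong)
    next
      case False
      then have st': "st (Suc n) = (fst (st n), snd (st n) @ [l ! n])" by (simp add: st prune_step_def)
      define s2 where "s2 = sem \<delta> (?body ;; incr ''j'') s'"
      have "bval \<delta> (BAnd (NLess (nvar ''z'') (nvar ''m'')) in_class) s' \<longleftrightarrow>
          z < fst (st n) \<and> \<not> 0 < \<delta> (snd (l ! n)) y"
        using n(2) v cell by (simp add: P_def)
      then have "\<not> bval \<delta> (BAnd (NLess (nvar ''z'') (nvar ''m'')) in_class) s'"
        using False ic by blast
      then have s2: "s2 = write_nat (''j'', 0) (Suc n) (write_nat (''i'', 0) (g * S + length (snd (st n)) + 1)
        (write_real (''t'', g * S + length (snd (st n))) (ta (fst (l ! n)))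
        (write_point (''q'', g * S + length (snd (st n))) (snd (l ! n))
        (write_point (''p'', g * S + length (snd (st n))) (p (fst (l ! n))) s'))))"
        using n(2) v cell unfolding s2_def P_def by auto
      have 1: "block s2 (a + Suc n) (drop (Suc n) l)"
        by (rule block_cong[OF blk(2)]) (use le a in \<open>simp add: s2\<close>)
      have 2: "block s2 (g * S) (snd (st n))"
        by (rule block_cong[of s']) (use n(2) in \<open>auto simp add: s2 P_def\<close>)
      have 3: "block s2 (g * S + length (snd (st n))) [l ! n]" by (simp add: block_single s2)
      have 4: "same_outside g s s2" using n(2) idx unfolding P_def same_outside_def by (auto simp: s2)
      have "P (Suc n) s2"
        using n(2) 1 2 3 4 idx(1) B_pos unfolding P_def st' by (simp add: s2 block_append)
      then show ?thesis by (simp only: s2_def)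
    qed
  qed (use P in \<open>auto simp: P_def\<close>)
  then show ?thesis unfolding prune_class_def
    by (rule wp_mono[OF wp_Seq_loop_free[rotated]]) (auto simp: P_def st_def prune_def)
qed

section \<open>One event at one guess\<close>

lemma seg_other:
  assumes "seg s h l" "h \<noteq> g" "same_outside g s s'"
    "NV s' ''N'' h = NV s ''N'' h" "NV s' ''H'' h = NV s ''H'' h"
  shows "seg s' h l"
proof -
  have *: "Suc h * S \<le> g * S \<or> Suc g * S \<le> h * S"
    using assms(2) by (metis mult_le_mono1 not_less_eq_eq linorder_neqE_nat Suc_leI)
  have "block s' (h * S + NV s ''H'' h) l"
    by (rule block_cong[of s]) (use * assms(1,3) in \<open>auto simp: seg_def same_outside_def\<close>)
  then show ?thesis using assms by (simp add: seg_def)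
qed

lemma seg_pop:
  assumes "seg s g l" "l \<noteq> []" "NV s ''g'' 0 = g" "g < G" "fits names B s"
  shows "seg (sem \<delta> pop s) g (tl l)" "fits names B (sem \<delta> pop s)"
    "agree {''H'', ''N''} s (sem \<delta> pop s)" "same_outside g s (sem \<delta> pop s)"
    "h \<noteq> g \<Longrightarrow> NV (sem \<delta> pop s) ''N'' h = NV s ''N'' h \<and> NV (sem \<delta> pop s) ''H'' h = NV s ''H'' h"
proof -
  obtain x l' where l: "l = [x] @ l'" using assms(2) by (cases l) auto
  have "block s (g * S + NV s ''H'' g + 1) l'"
    using assms(1) block_append[of s "g * S + NV s ''H'' g" "[x]" l'] unfolding seg_def l by simp
  then have "block (sem \<delta> pop s) (g * S + NV s ''H'' g + 1) l'" by (simp add: pop_def block_def)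
  then show "seg (sem \<delta> pop s) g (tl l)"
    using assms unfolding seg_def l by (simp add: pop_def)
  have "g < B" using assms(4) B_ge(3) by linarith
  then show "fits names B (sem \<delta> pop s)" using assms by (simp add: pop_def)
  show "agree {''H'', ''N''} s (sem \<delta> pop s)" by (simp add: pop_def)
  show "same_outside g s (sem \<delta> pop s)" by (simp add: pop_def same_outside_def)
  show "h \<noteq> g \<Longrightarrow> NV (sem \<delta> pop s) ''N'' h = NV s ''N'' h \<and> NV (sem \<delta> pop s) ''H'' h = NV s ''H'' h"
    using assms(3) by (simp add: pop_def)
qed

text \<open>The lists of the other guesses are quantified universally, so that the loop over all
  guesses can carry over both those already treated and those still untouched.\<close>

definition updated :: "nat \<Rightarrow> (nat \<times> 'a) list \<Rightarrow> 'a mem \<Rightarrow> 'a mem \<Rightarrow> bool" where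
  "updated g l s s' \<longleftrightarrow> env s' \<and> NV s' ''g'' 0 = Suc g \<and> PV s' ''new'' 0 = PV s ''new'' 0 \<and>
     RV s' ''now'' 0 = RV s ''now'' 0 \<and> seg s' g l \<and> (\<forall>h l'. h \<noteq> g \<longrightarrow> seg s h l' \<longrightarrow> seg s' h l')"

lemma sem_push:
  fixes s :: "'a mem" and s' :: "'a mem"
  assumes s: "env s" "g < G" "NV s ''g'' 0 = g" "NV s ''i'' 0 = g * S + length l" "length l \<le> L + 1"
    and l: "block s (g * S) l"
    and new: "PV s ''new'' 0 = p i" "RV s ''now'' 0 = ta i" "PV s ''c'' 0 = y"
  defines "s' \<equiv> sem \<delta> (push ;; Cond (NLess (NAdd (nvar ''L'') (NConst 1)) (NCell ''N'' (nvar ''g''))) pop Skip ;; incr ''g'') s"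
  shows "env s'" "NV s' ''g'' 0 = Suc g" "PV s' ''new'' 0 = p i" "RV s' ''now'' 0 = ta i"
    "seg s' g (let l' = l @ [(i, y)] in if L + 1 < length l' then tl l' else l')"
    "same_outside g s s'" "h \<noteq> g \<Longrightarrow> NV s' ''N'' h = NV s ''N'' h \<and> NV s' ''H'' h = NV s ''H'' h"
proof -
  define s1 where "s1 = sem \<delta> push s"
  have B: "g < B" "g * S + length l < B" "g * S + length l < g * S + S"
    using s(2,5) B_ge(2)[OF s(2)] B_ge(3) by (auto simp: S_def)
  have NVS: "NV s ''S'' 0 = S" "NV s ''L'' 0 = L" "fits names B s" using s(1) by (auto simp: env_def)
  have b1: "block s1 (g * S) l" unfolding s1_def
    by (rule block_cong[OF l]) (use s in \<open>auto simp: push_def\<close>)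
  have b2: "block s1 (g * S + length l) [(i, y)]" using s new by (simp add: s1_def push_def block_single)
  have N: "NV s1 ''N'' g = length (l @ [(i, y)])" "NV s1 ''H'' g = 0"
    using s new NVS by (simp_all add: s1_def push_def)
  have seg1: "seg s1 g (l @ [(i, y)])"
    using b1 b2 N s(5) by (simp add: seg_def block_append S_def)
  have fits1: "fits names B s1" using NVS(3) s(3,4) B by (simp add: s1_def push_def)
  have agree1: "agree {''p'', ''q'', ''t'', ''H'', ''N''} s s1" by (simp add: s1_def push_def)
  have out1: "same_outside g s s1" using s(4) B by (auto simp: same_outside_def s1_def push_def)
  have oth1: "NV s1 ''N'' h = NV s ''N'' h \<and> NV s1 ''H'' h = NV s ''H'' h" if "h \<noteq> g" for h
    using that s(3) by (simp add: s1_def push_def)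
  have g1: "NV s1 ''g'' 0 = g" "NV s1 ''L'' 0 = L" using agreeD[OF agree1] s(3) NVS by simp_all
  define s2 where "s2 = (if L + 1 < length l + 1 then sem \<delta> pop s1 else s1)"
  have "s2 = sem \<delta> (Cond (NLess (NAdd (nvar ''L'') (NConst 1)) (NCell ''N'' (nvar ''g''))) pop Skip) s1"
    using g1 N by (simp add: s2_def)
  then have s': "s' = sem \<delta> (incr ''g'') s2" by (simp add: s'_def s1_def)
  note pop = seg_pop[OF seg1 _ g1(1) s(2) fits1]
  have 2: "seg s2 g (let l' = l @ [(i, y)] in if L + 1 < length l' then tl l' else l')" "fits names B s2"
    "agree {''H'', ''N''} s1 s2" "same_outside g s1 s2"
    "h \<noteq> g \<Longrightarrow> NV s2 ''N'' h = NV s1 ''N'' h \<and> NV s2 ''H'' h = NV s1 ''H'' h" for h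
    using pop seg1 fits1 unfolding s2_def by (auto simp: same_outside_def)
  have a2: "agree {''p'', ''q'', ''t'', ''H'', ''N''} s s2" using agree_trans[OF agree1 2(3)] by auto
  have a': "agree {''p'', ''q'', ''t'', ''H'', ''N'', ''g''} s s'"
    using agree_trans[OF a2, of "{''g''}" s'] by (auto simp: s')
  have fits': "fits names B s'" using 2(2) B_pos by (simp add: s')
  show "env s'" by (rule env_agree[OF s(1) a' fits']) auto
  show "NV s' ''g'' 0 = Suc g" using agreeD[OF a2] s(3) by (simp add: s')
  show "PV s' ''new'' 0 = p i" "RV s' ''now'' 0 = ta i" using agreeD[OF a'] new by simp_all
  show "seg s' g (let l' = l @ [(i, y)] in if L + 1 < length l' then tl l' else l')"
    by (rule seg_agree[OF 2(1), of "{''g''}"]) (auto simp: s')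
  show "same_outside g s s'" using out1 2(4) by (simp add: same_outside_def s')
  show "h \<noteq> g \<Longrightarrow> NV s' ''N'' h = NV s ''N'' h \<and> NV s' ''H'' h = NV s ''H'' h"
    using 2(5)[of h] oth1[of h] by (simp add: s')
qed

text \<open>Per entry the passes cost 4, 4 and 8 steps, which makes 16; the list has at most
  \<open>L + 1\<close> entries and the constant 60 absorbs the rest.\<close>

lemma wp_arrive_guess:
  assumes s: "env s" "g < G" "NV s ''g'' 0 = g" "seg s g l" "length l \<le> L + 1" "\<forall>x\<in>set l. snd x \<in> M"
    and i: "p i \<in> M" and new: "PV s ''new'' 0 = p i" "RV s ''now'' 0 = ta i"
  shows "wp \<delta> A T arrive_guess (16 * L + 60) (updated g (insert_entry (thr g) i l) s) s"
proof -
  define a where "a = g * S + NV s ''H'' g"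
  define y where "y = center_for \<delta> (thr g) (p i) l"
  have y: "y \<in> M" using center_for_cases[of \<delta> "thr g" "p i" l] i s(6) unfolding y_def by auto
  have short: "length (prune z y l) \<le> L + 1"
    using foldl_prune_step_length[of y "(length (class_of y l), [])" l] s(5) by (simp add: prune_def)
  let ?c0 = "NAssign ''b'' (NConst 0) (NAdd (NMul (nvar ''g'') (nvar ''S'')) (NCell ''H'' (nvar ''g'')))"
  let ?c4 = "push ;; Cond (NLess (NAdd (nvar ''L'') (NConst 1)) (NCell ''N'' (nvar ''g''))) pop Skip ;; incr ''g''"
  define s1 where "s1 = sem \<delta> ?c0 s"
  have "NV s ''S'' 0 = S" using s(1) by (simp add: env_def)
  then have b: "NV s1 ''b'' 0 = a" using s(3) by (simp add: s1_def a_def)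
  have a1: "agree {''b''} s s1" "fits names B s1" using B_pos fits_env[OF s(1)] by (simp_all add: s1_def)
  have "env s1" using env_agree[OF s(1) a1] by auto
  moreover have "seg s1 g l" using seg_agree[OF s(4) a1(1)] by auto
  ultimately have scan1: "scan s1 g a l"
    using b s(2,3,6) agreeD[OF a1(1)] unfolding scan_def seg_def by (auto simp: a_def)
  have new1: "PV s1 ''new'' 0 = p i" using agreeD[OF a1(1)] new by simp
  have final: "updated g (insert_entry (thr g) i l) s (sem \<delta> ?c4 s4)"
    if 4: "agree {''b'', ''c'', ''j'', ''m'', ''i'', ''p'', ''q'', ''t''} s s4" "fits names B s4"
      "same_outside g s s4" "NV s4 ''i'' 0 = g * S + length (prune z y l)" "block s4 (g * S) (prune z y l)"
      "PV s4 ''c'' 0 = y" for s4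
  proof -
    have "env s4" using env_agree[OF s(1) 4(1,2)] by auto
    have g4: "NV s4 ''g'' 0 = g" "PV s4 ''new'' 0 = p i" "RV s4 ''now'' 0 = ta i"
      using agreeD[OF 4(1)] s(3) new by simp_all
    note push = sem_push[OF \<open>env s4\<close> s(2) g4(1) 4(4) short 4(5) g4(2,3) 4(6)]
    have "same_outside g s (sem \<delta> ?c4 s4)" using 4(3) push(6) by (simp add: same_outside_def)
    moreover have "NV (sem \<delta> ?c4 s4) ''N'' h = NV s ''N'' h \<and> NV (sem \<delta> ?c4 s4) ''H'' h = NV s ''H'' h"
      if "h \<noteq> g" for h
      using push(7)[OF that] agreeD[OF 4(1), of "''N''"] agreeD[OF 4(1), of "''H''"] by simp
    ultimately have "seg (sem \<delta> ?c4 s4) h l'" if "h \<noteq> g" "seg s h l'" for h l'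
      using seg_other[OF that(2,1)] that(1) by blast
    then show ?thesis
      using push(1-5) new unfolding updated_def insert_entry_def y_def Let_def by auto
  qed
  have w4: "wp \<delta> A T ?c4 (cost ?c4) (updated g (insert_entry (thr g) i l) s) s4"
    if "agree {''b'', ''c'', ''j'', ''m'', ''i'', ''p'', ''q'', ''t''} s s4" "fits names B s4"
      "same_outside g s s4" "NV s4 ''i'' 0 = g * S + length (prune z y l)" "block s4 (g * S) (prune z y l)"
      "PV s4 ''c'' 0 = y" for s4
    by (rule wp_loop_free) (simp add: push_def pop_def, rule final[OF that])
  have w3: "wp \<delta> A T (prune_class ;; ?c4) (8 * length l + 3 + cost ?c4) (updated g (insert_entry (thr g) i l) s) s3"
    if 3: "agree {''b'', ''c'', ''j'', ''m''} s s3" "scan s3 g a l"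
      "NV s3 ''m'' 0 = length (class_of y l)" "PV s3 ''c'' 0 = y" for s3
  proof (rule wp_Seq, rule wp_mono[OF wp_prune_class[OF 3(2,4) y 3(3)] order_refl], elim conjE)
    fix s4 assume 4: "agree {''i'', ''j'', ''m'', ''p'', ''q'', ''t''} s3 s4" "fits names B s4"
      "same_outside g s3 s4" "NV s4 ''i'' 0 = g * S + length (prune z y l)" "block s4 (g * S) (prune z y l)"
    show "wp \<delta> A T ?c4 (cost ?c4) (updated g (insert_entry (thr g) i l) s) s4"
    proof (rule w4)
      show "agree {''b'', ''c'', ''j'', ''m'', ''i'', ''p'', ''q'', ''t''} s s4"
        by (rule agree_trans[OF 3(1) 4(1)]) auto
      show "same_outside g s s4" using 4(3) agreeD[OF 3(1)] by (simp add: same_outside_def)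
      show "PV s4 ''c'' 0 = y" using agreeD[OF 4(1)] 3(4) by simp
    qed (use 4 in auto)
  qed
  have w2: "wp \<delta> A T (count_class ;; prune_class ;; ?c4) (4 * length l + 3 + (8 * length l + 3 + cost ?c4))
      (updated g (insert_entry (thr g) i l) s) s2"
    if 2: "agree {''b'', ''c'', ''j''} s s2" "scan s2 g a l" "PV s2 ''c'' 0 = y" for s2
  proof (rule wp_Seq, rule wp_mono[OF wp_count_class[OF 2(2,3) y] order_refl], elim conjE)
    fix s3 assume 3: "agree {''m'', ''j''} s2 s3" "fits names B s3" "NV s3 ''m'' 0 = length (class_of y l)"
    show "wp \<delta> A T (prune_class ;; ?c4) (8 * length l + 3 + cost ?c4) (updated g (insert_entry (thr g) i l) s) s3"
    proof (rule w3)
      show "agree {''b'', ''c'', ''j'', ''m''} s s3" by (rule agree_trans[OF 2(1) 3(1)]) auto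
      show "scan s3 g a l" using scan_agree[OF 2(2) 3(1,2)] by auto
      show "PV s3 ''c'' 0 = y" using agreeD[OF 3(1)] 2(3) by simp
    qed (rule 3)
  qed
  have w1: "wp \<delta> A T (find_center ;; count_class ;; prune_class ;; ?c4)
      (4 * length l + 3 + (4 * length l + 3 + (8 * length l + 3 + cost ?c4)))
      (updated g (insert_entry (thr g) i l) s) s1"
  proof (rule wp_Seq, rule wp_mono[OF wp_find_center[OF scan1 new1] order_refl], elim conjE)
    fix s2 assume 2: "agree {''c'', ''j''} s1 s2" "fits names B s2" "PV s2 ''c'' 0 = center_for \<delta> (thr g) (p i) l"
    show "wp \<delta> A T (count_class ;; prune_class ;; ?c4) (4 * length l + 3 + (8 * length l + 3 + cost ?c4))
      (updated g (insert_entry (thr g) i l) s) s2"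
    proof (rule w2)
      show "agree {''b'', ''c'', ''j''} s s2" by (rule agree_trans[OF a1(1) 2(1)]) auto
      show "scan s2 g a l" using scan_agree[OF scan1 2(1,2)] by auto
      show "PV s2 ''c'' 0 = y" using 2(3) by (simp add: y_def)
    qed
  qed
  have "wp \<delta> A T arrive_guess (cost ?c0 + (4 * length l + 3 + (4 * length l + 3 + (8 * length l + 3 + cost ?c4))))
      (updated g (insert_entry (thr g) i l) s) s"
    unfolding arrive_guess_def using w1 by (intro wp_Seq_loop_free) (simp_all add: s1_def)
  then show ?thesis
    by (rule wp_mono) (use s(5) in \<open>simp_all add: push_def pop_def\<close>)
qed

lemma wp_depart_guess:
  assumes s: "env s" "g < G" "NV s ''g'' 0 = g" "seg s g l" and now: "RV s ''now'' 0 = u"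
  shows "wp \<delta> A T depart_guess 10 (updated g (expire u l) s) s"
proof -
  let ?b = "BAnd (NLess (NConst 0) (NCell ''N'' (nvar ''g'')))
         (BNot (RLess (rvar ''now'')
           (RAdd (RCell ''t'' (NAdd (NMul (nvar ''g'') (nvar ''S'')) (NCell ''H'' (nvar ''g'')))) (rvar ''W''))))"
  define s1 where "s1 = sem \<delta> (Cond ?b pop Skip) s"
  have v: "NV s ''S'' 0 = S" "RV s ''W'' 0 = W" "fits names B s" using s(1) by (auto simp: env_def)
  have b: "bval \<delta> ?b s \<longleftrightarrow> l \<noteq> [] \<and> \<not> u < ta (fst (hd l)) + W"
  proof (cases l)
    case Nil
    then show ?thesis using s(3,4) by (simp add: seg_def)
  next
    case (Cons x l')
    then have "RV s ''t'' (g * S + NV s ''H'' g) = ta (fst x)"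
      using s(4) block_nth(3)[of s "g * S + NV s ''H'' g" l 0] by (simp add: seg_def)
    then show ?thesis using s(3,4) v now Cons by (simp add: seg_def)
  qed
  note pop = seg_pop[OF s(4) _ s(3,2) v(3)]
  have 1: "seg s1 g (expire u l)" "fits names B s1" "agree {''H'', ''N''} s s1" "same_outside g s s1"
    "h \<noteq> g \<Longrightarrow> NV s1 ''N'' h = NV s ''N'' h \<and> NV s1 ''H'' h = NV s ''H'' h" for h
    using pop s(4) b v(3) by (auto simp: s1_def expire_def same_outside_def simp del: bval.simps)
  define s2 where "s2 = sem \<delta> (incr ''g'') s1"
  have a2: "agree {''H'', ''N'', ''g''} s s2"
    using agree_trans[OF 1(3), of "{''g''}" s2] by (auto simp: s2_def)
  have fits2: "fits names B s2" using 1(2) B_pos by (simp add: s2_def)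
  have "env s2" using env_agree[OF s(1) a2 fits2] by auto
  moreover have "NV s2 ''g'' 0 = Suc g" using agreeD[OF 1(3)] s(3) by (simp add: s2_def)
  moreover have "seg s2 g (expire u l)" by (rule seg_agree[OF 1(1), of "{''g''}"]) (auto simp: s2_def)
  moreover have "seg s2 h l'" if "h \<noteq> g" "seg s h l'" for h l'
    using seg_agree[OF seg_other[OF that(2,1) 1(4)], of "{''g''}" s2] 1(5)[OF that(1)] by (auto simp: s2_def)
  ultimately have "updated g (expire u l) s s2"
    using agreeD[OF a2] unfolding updated_def by simp
  then have "wp \<delta> A T depart_guess (cost depart_guess) (updated g (expire u l) s) s"
    by (intro wp_loop_free) (simp_all add: depart_guess_def pop_def s1_def s2_def)
  then show ?thesis by (rule wp_mono) (simp_all add: depart_guess_def pop_def)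
qed

text \<open>The lists are ghost state, tied to the memory by \<open>seg\<close> and to the stream by
  \<open>good\<close>. Cell \<open>B\<close> holds the first usable guess, the one whose
  predecessors certify a large optimum.\<close>

definition sketch_inv :: "real \<Rightarrow> 'a mem \<Rightarrow> bool" where
  "sketch_inv t s \<longleftrightarrow> env s \<and>
     (\<exists>ls. (\<forall>g<G. seg s g (ls g) \<and> good (thr g) t (ls g) \<and> length (ls g) \<le> L + 1) \<and>
        NV s ''B'' 0 < G \<and> length (ls (NV s ''B'' 0)) \<le> L \<and> (\<forall>h<NV s ''B'' 0. L < length (ls h)))"

lemma sketch_inv_agree:
  assumes "sketch_inv t s" "agree X s s'" "fits names B s'"
    "X \<inter> {''z'', ''L'', ''S'', ''G'', ''W'', ''D'', ''N'', ''H'', ''p'', ''q'', ''t'', ''B''} = {}"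
  shows "sketch_inv t s'"
proof -
  have "env s" using assms(1) by (simp add: sketch_inv_def)
  then have "env s'" using env_agree[OF _ assms(2,3)] assms(4) by simp
  moreover have "seg s' g l" if "seg s g l" for g l using seg_agree[OF that assms(2)] assms(4) by simp
  moreover have "''B'' \<notin> X" using assms(4) by simp
  then have "NV s' ''B'' 0 = NV s ''B'' 0" by (rule agreeD(1)[OF assms(2)])
  ultimately show ?thesis using assms(1) unfolding sketch_inv_def by metis
qed

lemma sketch_inv_alive: "sketch_inv t s \<Longrightarrow> alive u = alive t \<Longrightarrow> sketch_inv u s"
  unfolding sketch_inv_def using good_wait by blast

text \<open>Arrivals and departures share this loop; after \<open>n\<close> rounds the guesses below
  \<open>n\<close> hold their new lists \<open>f\<close> and the others their old lists
  \<open>ls\<close>.\<close>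

lemma wp_for_guesses:
  assumes s: "env s" "\<And>g. g < G \<Longrightarrow> seg s g (ls g)"
    and body: "\<And>g s'. g < G \<Longrightarrow> env s' \<Longrightarrow> NV s' ''g'' 0 = g \<Longrightarrow> seg s' g (ls g) \<Longrightarrow>
      PV s' ''new'' 0 = PV s ''new'' 0 \<Longrightarrow> RV s' ''now'' 0 = RV s ''now'' 0 \<Longrightarrow>
      wp \<delta> A T prog b (updated g (f g) s') s'"
    and f: "\<And>g. g < G \<Longrightarrow> good (thr g) u (f g) \<and> length (f g) \<le> L + 1"
  shows "wp \<delta> A T (for_guesses prog ;; set_best) (G * (b + 3) + 4) (sketch_inv u) s"
proof -
  define P where "P n s' \<longleftrightarrow> env s' \<and> NV s' ''g'' 0 = n \<and> PV s' ''new'' 0 = PV s ''new'' 0 \<and>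
    RV s' ''now'' 0 = RV s ''now'' 0 \<and> (\<forall>g<G. seg s' g (if g < n then f g else ls g))" for n s'
  have "wp \<delta> A T (While (NLess (nvar ''g'') (nvar ''G'')) prog) (1 + G * (1 + b)) (P G)
      (sem \<delta> (NAssign ''g'' (NConst 0) (NConst 0)) s)"
  proof (rule wp_While)
    let ?s = "sem \<delta> (NAssign ''g'' (NConst 0) (NConst 0)) s"
    have a: "agree {''g''} s ?s" by simp
    have "fits names B ?s" using fits_env[OF s(1)] B_pos by simp
    then have "env ?s" using env_agree[OF s(1) a] by auto
    moreover have "seg ?s g (ls g)" if "g < G" for g using seg_agree[OF s(2)[OF that] a] by auto
    ultimately show "P 0 ?s" by (simp add: P_def)
  next
    fix n s' assume n: "n < G" "P n s'"
    then have "wp \<delta> A T prog b (updated n (f n) s') s'" unfolding P_def by (intro body) auto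
    moreover have "P (Suc n) s''" if "updated n (f n) s' s''" for s''
    proof -
      have "seg s'' g (if g < Suc n then f g else ls g)" if "g < G" for g
        using n \<open>updated n (f n) s' s''\<close> that unfolding updated_def P_def
        by (cases "g = n") (auto simp: less_Suc_eq)
      then show ?thesis using n that unfolding updated_def P_def by simp
    qed
    ultimately have "wp \<delta> A T prog b (P (Suc n)) s'" by (rule wp_mono[OF _ order_refl])
    then show "bval \<delta> (NLess (nvar ''g'') (nvar ''G'')) s' \<and> wp \<delta> A T prog b (P (Suc n)) s'"
      using n by (simp add: P_def env_def)
  next
    fix s' assume "P G s'"
    then show "\<not> bval \<delta> (NLess (nvar ''g'') (nvar ''G'')) s'" by (simp add: P_def env_def)
  qed
  then have "wp \<delta> A T (for_guesses prog) (cost (NAssign ''g'' (NConst 0) (NConst 0)) + (1 + G * (1 + b))) (P G) s"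
    by (intro wp_Seq_loop_free) simp_all
  then have "wp \<delta> A T (for_guesses prog)  (cost (NAssign ''g'' (NConst 0) (NConst 0)) + (1 + G * (1 + b)))
    (wp \<delta> A T set_best (2 * G + 2) (sketch_inv u)) s"
  proof (rule wp_mono[OF _ order_refl])
    fix s' assume s': "P G s'"
    define h where "h = (LEAST h. length (f h) \<le> L)"
    have "G - 1 < G" using G_ge by linarith
    \<comment> \<open>The top guess is usable, so the least \<open>h\<close> exists and the search
      stays within the table.\<close>
    then have top: "G - 1 < G" "length (f (G - 1)) \<le> L" using length_top_le_L f by blast+
    then have "length (f h) \<le> L" "h \<le> G - 1" unfolding h_def
      by (auto intro: LeastI Least_le)
    moreover have less: "L < length (f h')" if "h' < h" for h'
      using that unfolding h_def by (meson not_le not_less_Least)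
    moreover have seg': "seg s' g (f g)" if "g < G" for g using s' that unfolding P_def by simp
    moreover have "env s'" using s' by (simp add: P_def)
    ultimately have h: "h < G" "NV s' ''N'' h \<le> L" "\<And>h'. h' < h \<Longrightarrow> L < NV s' ''N'' h'" "length (f h) \<le> L" "env s'"
      using top by (auto simp: seg_def)
    show "wp \<delta> A T set_best (2 * G + 2) (sketch_inv u) s'"
    proof (rule wp_mono[OF wp_set_best[OF h(5,1,2,3)] order_refl], assumption, elim conjE)
      fix s'' assume s'': "agree {''B''} s' s''" "fits names B s''" "NV s'' ''B'' 0 = h"
      have "env s''" using env_agree[OF h(5) s''(1,2)] by auto
      moreover have "seg s'' g (f g)" if "g < G" for g using seg_agree[OF seg'[OF that] s''(1)] by auto
      ultimately show "sketch_inv u s''" using h f less s''(3) unfolding sketch_inv_def by blast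
    qed
  qed
  then have "wp \<delta> A T (for_guesses prog ;; set_best)
      (cost (NAssign ''g'' (NConst 0) (NConst 0)) + (1 + G * (1 + b)) + (2 * G + 2)) (sketch_inv u) s"
    by (rule wp_Seq)
  then show ?thesis by (rule wp_mono) (simp_all add: algebra_simps)
qed

lemma wp_arrival:
  assumes s: "sketch_inv t s" and i: "enat i < len" "next_event W len ta t (ta i)"
  shows "wp \<delta> A T (on_arrival (sketch_prog D)) (G * (16 * L + 63) + 4) (sketch_inv (ta i)) (load_arrival (ta i) (p i) s)"
proof -
  define s0 where "s0 = load_arrival (ta i) (p i) s"
  have "sketch_inv t s0"
    by (rule sketch_inv_agree[OF s, of "{''now'', ''new''}"])
      (use s fits_env B_pos in \<open>auto simp: s0_def load_arrival_def load_time_def sketch_inv_def\<close>)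
  then obtain ls where ls: "env s0" "\<And>g. g < G \<Longrightarrow> seg s0 g (ls g)" "\<And>g. g < G \<Longrightarrow> good (thr g) t (ls g)"
    "\<And>g. g < G \<Longrightarrow> length (ls g) \<le> L + 1"
    unfolding sketch_inv_def by blast
  have new: "PV s0 ''new'' 0 = p i" "RV s0 ''now'' 0 = ta i"
    by (simp_all add: s0_def load_arrival_def load_time_def)
  have "wp \<delta> A T (for_guesses arrive_guess ;; set_best) (G * (16 * L + 60 + 3) + 4) (sketch_inv (ta i)) s0"
  proof (rule wp_for_guesses[OF ls(1,2)])
    fix g s' assume g: "g < G" "env s'" "NV s' ''g'' 0 = g" "seg s' g (ls g)"
      "PV s' ''new'' 0 = PV s0 ''new'' 0" "RV s' ''now'' 0 = RV s0 ''now'' 0"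
    have "\<forall>x\<in>set (ls g). snd x \<in> M" using ls(3)[OF g(1)] unfolding good_def by blast
    then show "wp \<delta> A T arrive_guess (16 * L + 60) (updated g (insert_entry (thr g) i (ls g)) s') s'"
      using wp_arrive_guess[OF g(2,1,3,4) ls(4)[OF g(1)]] p_in_M[OF i(1)] g(5,6) new by simp
  next
    fix g assume "g < G"
    then show "good (thr g) (ta i) (insert_entry (thr g) i (ls g)) \<and> length (insert_entry (thr g) i (ls g)) \<le> L + 1"
      using good_insert_entry[OF ls(3) i thr_nonneg ls(4)] by blast
  qed
  then show ?thesis by (simp add: sketch_prog_def s0_def add.commute)
qed

lemma wp_departure:
  assumes s: "sketch_inv t s" and i: "enat i < len" "next_event W len ta t (ta i + W)"
  shows "wp \<delta> A T (on_departure (sketch_prog D)) (G * 13 + 4) (sketch_inv (ta i + W)) (load_time (ta i + W) s)"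
proof -
  define s0 where "s0 = load_time (ta i + W) s"
  have "sketch_inv t s0"
    by (rule sketch_inv_agree[OF s, of "{''now''}"])
      (use s fits_env B_pos in \<open>auto simp: s0_def load_time_def sketch_inv_def\<close>)
  then obtain ls where ls: "env s0" "\<And>g. g < G \<Longrightarrow> seg s0 g (ls g)" "\<And>g. g < G \<Longrightarrow> good (thr g) t (ls g)"
    "\<And>g. g < G \<Longrightarrow> length (ls g) \<le> L + 1"
    unfolding sketch_inv_def by blast
  have now: "RV s0 ''now'' 0 = ta i + W" by (simp add: s0_def load_time_def)
  have "wp \<delta> A T (for_guesses depart_guess ;; set_best) (G * (10 + 3) + 4) (sketch_inv (ta i + W)) s0"
  proof (rule wp_for_guesses[OF ls(1,2)])
    fix g s' assume g: "g < G" "env s'" "NV s' ''g'' 0 = g" "seg s' g (ls g)"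
      "PV s' ''new'' 0 = PV s0 ''new'' 0" "RV s' ''now'' 0 = RV s0 ''now'' 0"
    then show "wp \<delta> A T depart_guess 10 (updated g (expire (ta i + W) (ls g)) s') s'"
      using wp_depart_guess[OF g(2,1,3,4)] now by simp
  next
    fix g assume "g < G"
    moreover have "length (expire (ta i + W) (ls g)) \<le> length (ls g)" by (simp add: expire_def)
    ultimately show "good (thr g) (ta i + W) (expire (ta i + W) (ls g)) \<and> length (expire (ta i + W) (ls g)) \<le> L + 1"
      using good_expire[OF ls(3) i] ls(4) order_trans by blast
  qed
  then show ?thesis by (simp add: sketch_prog_def s0_def)
qed

text \<open>Stated with \<open>exec\<close> rather than \<open>wp\<close> because the time
  \<open>T n + 1\<close> depends on the length \<open>n\<close> of the chosen list. The report
  writes only its two output arrays, so the invariant survives it.\<close>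

lemma exec_report:
  assumes s: "sketch_inv t s"
  shows "\<exists>s' n. exec \<delta> A T report_prog (load_time t s) (T n + 1) s' \<and> n \<le> L \<and> sketch_inv t s' \<and>
    valid_solution M \<delta> k z (Q t) (reported_centers k s') (reported_radius s') \<and>
    reported_radius s' \<le> (1 + \<epsilon>) * c * opt M \<delta> k z (Q t)"
proof -
  define s0 where "s0 = load_time t s"
  have inv0: "sketch_inv t s0"
    by (rule sketch_inv_agree[OF s, of "{''now''}"])
      (use s fits_env B_pos in \<open>auto simp: s0_def load_time_def sketch_inv_def\<close>)
  define h where "h = NV s0 ''B'' 0"
  obtain ls where ls: "env s0" "\<And>g. g < G \<Longrightarrow> seg s0 g (ls g) \<and> good (thr g) t (ls g)"
    "h < G" "length (ls h) \<le> L" "\<And>h'. h' < h \<Longrightarrow> L < length (ls h')"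
    using inv0 unfolding sketch_inv_def h_def by blast
  define n where "n = length (ls h)"
  have seg: "NV s0 ''N'' h = n" "block s0 (h * S + NV s0 ''H'' h) (ls h)"
    using ls(2)[OF ls(3)] by (auto simp: seg_def n_def)
  have v: "NV s0 ''S'' 0 = S" "RV s0 ''D'' h = thr h" using ls(1,3) by (auto simp: env_def)
  have read: "read_points ''p'' (h * S + NV s0 ''H'' h) n s0 = map (\<lambda>x. p (fst x)) (ls h)"
    using block_nth(1)[OF seg(2)] by (intro nth_equalityI) (auto simp: read_points_def PV_def n_def)
  obtain cs r where cs: "A (map (\<lambda>x. p (fst x)) (ls h)) = (cs, r)" by fastforce
  have correct: "valid_solution M \<delta> k z (Q t) cs (r + thr h + thr h)"
    "r + thr h + thr h \<le> (1 + \<epsilon>) * c * opt M \<delta> k z (Q t)" "length cs = k"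
  proof -
    have "\<exists>l'. good (thr h') t l' \<and> L < length l'" if "h' < h" for h'
      using ls(2)[of h'] ls(3) ls(5)[OF that] that by (meson less_trans)
    then show "valid_solution M \<delta> k z (Q t) cs (r + thr h + thr h)"
      "r + thr h + thr h \<le> (1 + \<epsilon>) * c * opt M \<delta> k z (Q t)" "length cs = k"
      using report_correct[OF _ ls(4) _ cs] ls(2,3) by blast+
  qed
  define s1 where "s1 = write_real (''radius'', 0) r (write_points ''centers'' cs s0)"
  define s2 where "s2 = write_real (''radius'', 0) (r + thr h + thr h) s1"
  have e1: "exec \<delta> A T (Solve ''p'' (NAdd (NMul (nvar ''B'') (nvar ''S'')) (NCell ''H'' (nvar ''B'')))
      (NCell ''N'' (nvar ''B'')) ''centers'' ''radius'') s0 (T n) s1"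
    using exec.Solve[of A "''p''" "NAdd (NMul (nvar ''B'') (nvar ''S'')) (NCell ''H'' (nvar ''B''))" s0
        "NCell ''N'' (nvar ''B'')" cs r \<delta> T "''centers''" "''radius''"] read cs v seg
    by (simp add: s1_def h_def)
  have "exec \<delta> A T (RAssign ''radius'' (NConst 0)
       (RAdd (RAdd (rvar ''radius'') (RCell ''D'' (nvar ''B''))) (RCell ''D'' (nvar ''B'')))) s1 1 s2"
    using exec.RAssign[of \<delta> A T "''radius''" "NConst 0"
        "RAdd (RAdd (rvar ''radius'') (RCell ''D'' (nvar ''B''))) (RCell ''D'' (nvar ''B''))" s1] v
    by (simp add: s2_def s1_def h_def)
  then have e: "exec \<delta> A T report_prog s0 (T n + 1) s2"
    unfolding report_prog_def by (rule exec.Seq[OF e1])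
  have "sketch_inv t s2"
    by (rule sketch_inv_agree[OF inv0, of "{''centers'', ''radius''}"])
      (use ls(1) fits_env B_pos B_ge(1) correct(3) in \<open>auto simp: s2_def s1_def\<close>)
  moreover have "reported_centers k s2 = cs"
    using correct(3) by (intro nth_equalityI) (auto simp: reported_centers_def read_points_def s2_def s1_def
        write_real_def write_points_def)
  moreover have "reported_radius s2 = r + thr h + thr h"
    by (simp add: reported_radius_def s2_def write_real_def)
  ultimately show ?thesis using e correct(1,2) ls(4) unfolding s0_def n_def by metis
qed

text \<open>\<open>sketch_at\<close> speaks about arbitrary runs, while \<open>wp\<close> provides
  one; determinism identifies them.\<close>

lemma wp_exec:
  assumes "wp \<delta> A T prog b R s" "exec \<delta> A T prog s m s'"
  shows "R s'"
  using assms exec_deterministic unfolding wp_def by metis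

lemma wp_init:
  assumes "\<forall>e\<in>event_times W len ta. t < e"
  shows "wp \<delta> A T (init_prog D) (J * 3 + I * 4 + 20) (sketch_inv t) (input_mem k z \<epsilon> \<Delta>min \<Delta>max W)"
proof (rule wp_mono[OF env_init order_refl], elim conjE)
  fix s assume s: "env s" "\<forall>x. NV s ''N'' x = 0 \<and> NV s ''H'' x = 0" "NV s ''B'' 0 = 0"
  have "t < ta i" if "enat i < len" for i using assms that by (auto simp: event_times_def)
  then have "alive t = {}" by (fastforce simp: alive_def)
  then show "sketch_inv t s" using s G_ge unfolding sketch_inv_def
    by (auto simp: seg_def good_Nil intro!: exI[of _ "\<lambda>_. []"])
qed

section \<open>Reachable memories\<close>

abbreviation "sketch T \<equiv> sketch_at \<delta> A T (sketch_prog D) (input_mem k z \<epsilon> \<Delta>min \<Delta>max W) W len p ta"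

lemma sketch_sketch_inv:
  assumes "sketch T t s"
  shows "sketch_inv t s"
  using assms
proof (induction rule: sketch_at.induct)
  case (start m s t)
  then show ?case using wp_exec[OF wp_init] by (auto simp: sketch_prog_def)
next
  case (wait t s u)
  then show ?case using sketch_inv_alive alive_wait by blast
next
  case (arrival t s i m s')
  then show ?case using wp_exec[OF wp_arrival] by blast
next
  case (departure t s i m s')
  then show ?case using wp_exec[OF wp_departure] by blast
next
  case (report t s m s')
  obtain s'' n where "exec \<delta> A T report_prog (load_time t s) (T n + 1) s''" "sketch_inv t s''"
    using exec_report[OF report.IH, of T] by blast
  then show ?case using report.hyps(2) exec_deterministic by (fastforce simp: sketch_prog_def)
qed

text \<open>This shows that operations never get stuck, so that claims about all reachable memories
  are not vacuous. The induction is on the number of events up to \<open>t\<close>.\<close>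

lemma sketch_exists: "\<exists>s. sketch T t s"
proof -
  define E where "E t = {e \<in> event_times W len ta. e \<le> t}" for t
  have fin: "finite (E t)" for t
  proof -
    have "finite {i. enat i < len \<and> ta i \<le> t}" using stream unfolding window_stream_def by blast
    \<comment> \<open>A point that has expired by time \<open>t\<close> has also arrived by then, so
      finitely many arrivals bound both kinds of events.\<close>
    moreover have "E t \<subseteq> ta ` {i. enat i < len \<and> ta i \<le> t} \<union> (\<lambda>i. ta i + W) ` {i. enat i < len \<and> ta i \<le> t}"
      using W_pos by (auto simp: E_def event_times_def)
    ultimately show ?thesis by (meson finite_UnI finite_imageI finite_subset)
  qed
  show ?thesis
  proof (induction "card (E t)" arbitrary: t rule: less_induct)
    case less
    show ?case
    proof (cases "E t = {}")
      case True
      then have "\<forall>e\<in>event_times W len ta. t < e" by (auto simp: E_def not_le)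
      moreover from wp_init[OF this, of T] obtain m s
        where "exec \<delta> A T (on_init (sketch_prog D)) (input_mem k z \<epsilon> \<Delta>min \<Delta>max W) m s"
        unfolding wp_def sketch_prog_def by auto
      ultimately show ?thesis using sketch_at.start by blast
    next
      case False
      define e where "e = Max (E t)"
      \<comment> \<open>\<open>t'\<close> must lie before the last event \<open>e\<close> but not
        before any other event up to \<open>t\<close>; \<open>e - 1\<close> supplies a value when
        there is no other event.\<close>
      define t' where "t' = Max (insert (e - 1) (E t - {e}))"
      have e: "e \<in> E t" "\<And>x. x \<in> E t \<Longrightarrow> x \<le> e" using False fin by (auto simp: e_def)
      have t': "t' < e" "\<And>x. x \<in> E t \<Longrightarrow> x \<noteq> e \<Longrightarrow> x \<le> t'"
      proof -
        show "t' < e" using e fin by (auto simp: t'_def order_le_less)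
        show "x \<le> t'" if "x \<in> E t" "x \<noteq> e" for x
          unfolding t'_def using fin that by (intro Max_ge) auto
      qed
      have "E t' \<subseteq> E t - {e}" using t'(1) e(1) by (auto simp: E_def)
      then have "card (E t') < card (E t)"
        using e(1) fin by (metis card_Diff1_less card_mono finite_Diff order_le_less_trans)
      then obtain s where s: "sketch T t' s" using less by blast
      have next': "next_event W len ta t' e"
        using e(1) t' by (force simp: next_event_def E_def)
      have wait': "\<forall>x\<in>event_times W len ta. \<not> (e < x \<and> x \<le> t)" "e \<le> t"
        using e by (force simp: E_def)+
      have "\<exists>s'. sketch T e s'"
      proof -
        from e(1) consider i where "enat i < len" "e = ta i" | i where "enat i < len" "e = ta i + W"
          by (auto simp: E_def event_times_def)
        then show ?thesis
        proof cases
          case 1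
          then show ?thesis using wp_arrival[OF sketch_sketch_inv[OF s] 1(1)] next' sketch_at.arrival[OF s 1(1)]
            unfolding wp_def by blast
        next
          case 2
          then show ?thesis using wp_departure[OF sketch_sketch_inv[OF s] 2(1)] next' sketch_at.departure[OF s 2(1)]
            unfolding wp_def by blast
        qed
      qed
      then show ?thesis using sketch_at.wait wait' by blast
    qed
  qed
qed

section \<open>Numerical bounds\<close>

definition bound :: real where "bound = 1000 * (64 powr d + 2)"

text \<open>With \<open>a = 64 powr d\<close>, the largest coefficient comes from storage: 87 = 3 *
  29 for the cell types and array names, times \<open>10 * a + 16\<close>, stays below
  \<open>1000 * a + 2000\<close>.\<close>

lemma costs:
  fixes l :: real
  defines "l \<equiv> log_spread (\<Delta>max / \<Delta>min)"
  shows "real (3 * (card names * B)) \<le> bound * (N * l)"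
    "real (G * 13 + 4) \<le> bound * l"
    "real (G * (16 * L + 63) + 4) \<le> bound * (N ^ 3 * l)"
    "real L \<le> bound * N"
proof -
  define a where "a = 64 powr d"
  have a: "1 \<le> a" using d_nonneg unfolding a_def by (intro ge_one_powr_ge_zero) auto
  have l: "1 \<le> l" by (simp add: l_def log_spread_def)
  have G: "real G \<le> 5 * l" using G_le by (simp add: l_def)
  have L: "real L \<le> (2 * a + 1) * N" using L_le by (simp add: a_def)
  have bd: "bound = 1000 * a + 2000" by (simp add: bound_def a_def)
  have N: "1 \<le> N" by (rule N_ge_1)
  have Nl: "1 \<le> N * l" "N \<le> N * l" "l \<le> N * l"
    using N l mult_mono[of 1 N 1 l] mult_left_mono[of 1 l N] mult_right_mono[of 1 N l] by auto
  have "real G * real S \<le> 5 * l * ((2 * a + 3) * N)"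
    using G L N a l by (intro mult_mono) (auto simp: S_def algebra_simps)
  also have "\<dots> = (10 * a + 15) * (N * l)" by (simp add: algebra_simps)
  finally have "real B \<le> (10 * a + 16) * (N * l)"
    using k_le_N Nl by (simp add: B_def algebra_simps)
  then have "87 * real B \<le> (870 * a + 1392) * (N * l)" by (simp add: algebra_simps)
  also have "\<dots> \<le> bound * (N * l)" using a Nl unfolding bd by (intro mult_right_mono) auto
  finally show "real (3 * (card names * B)) \<le> bound * (N * l)" by (simp add: card_names)
  have "real (G * 13 + 4) \<le> 69 * l" using G l by simp
  also have "\<dots> \<le> bound * l" using a l unfolding bd by (intro mult_right_mono) auto
  finally show "real (G * 13 + 4) \<le> bound * l" .
  have "real L \<le> bound * N" using L a N mult_right_mono[of "2 * a + 1" bound N] unfolding bd by linarith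
  then show "real L \<le> bound * N" .
  have "real (16 * L + 63) \<le> (32 * a + 79) * N" using L N by (simp add: algebra_simps)
  then have "real G * real (16 * L + 63) \<le> 5 * l * ((32 * a + 79) * N)"
    using G l N a by (intro mult_mono) auto
  then have "real (G * (16 * L + 63) + 4) \<le> 5 * l * ((32 * a + 79) * N) + 4 * (N * l)"
    using Nl(1) by simp
  also have "\<dots> = (160 * a + 399) * (N * l)" by (simp add: algebra_simps)
  also have "\<dots> \<le> bound * (N ^ 3 * l)"
  proof (rule mult_mono)
    \<comment> \<open>An arrival takes time linear in \<open>N\<close>; the cubic bound follows from
      \<open>1 \<le> N\<close>.\<close>
    have "N ^ 1 \<le> N ^ 3" using N by (intro power_increasing) auto
    then show "N * l \<le> N ^ 3 * l" using l by (intro mult_right_mono) auto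
  qed (use a Nl in \<open>auto simp: bd\<close>)
  finally show "real (G * (16 * L + 63) + 4) \<le> bound * (N ^ 3 * l)" .
qed

end

theorem theorem5:
  fixes d :: real
  shows "\<exists>(alg :: sketch_alg) (C :: real). 0 < C \<and>
    (\<forall>(M :: 'a set) \<delta> k z \<epsilon> \<Delta>min \<Delta>max \<sigma> W len p ta c A T.
       Metric_space M \<delta> \<and> doubling_dimension M \<delta> d \<and>
       1 \<le> k \<and> 0 < \<epsilon> \<and> \<epsilon> < 1 \<and>
       window_stream M W len p ta \<and>
       0 < \<Delta>min \<and> \<Delta>min \<le> \<Delta>max \<and> \<sigma> = \<Delta>max / \<Delta>min \<and>
       (\<forall>i j. enat i < len \<and> enat j < len \<and> p i \<noteq> p j \<longrightarrow>
          \<Delta>min \<le> \<delta> (p i) (p j) \<and> \<delta> (p i) (p j) \<le> \<Delta>max) \<and>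
       static_approx M \<delta> k z c A \<longrightarrow>
       (let N = real (kz k z) / \<epsilon> powr d;
            sketch = sketch_at \<delta> A T alg (input_mem k z \<epsilon> \<Delta>min \<Delta>max W) W len p ta
        in
          (\<forall>t. \<exists>s. sketch t s) \<and>
          (\<forall>t s. sketch t s \<longrightarrow> real (storage s) \<le> C * (N * log_spread \<sigma>)) \<and>
          (\<forall>t s i. sketch t s \<and> enat i < len \<and> next_event W len ta t (ta i + W) \<longrightarrow>
             (\<exists>m s'. exec \<delta> A T (on_departure alg) (load_time (ta i + W) s) m s' \<and>
                real m \<le> C * log_spread \<sigma>)) \<and>
          (\<forall>t s i. sketch t s \<and> enat i < len \<and> next_event W len ta t (ta i) \<longrightarrow>
             (\<exists>m s'. exec \<delta> A T (on_arrival alg) (load_arrival (ta i) (p i) s) m s' \<and>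
                real m \<le> C * (N ^ 3 * log_spread \<sigma>))) \<and>
          (\<forall>t s. sketch t s \<longrightarrow>
             (\<exists>m s' n. exec \<delta> A T (on_report alg) (load_time t s) m s' \<and>
                valid_solution M \<delta> k z (window W len p ta t)
                  (reported_centers k s') (reported_radius s') \<and>
                reported_radius s' \<le> (1 + \<epsilon>) * c * opt M \<delta> k z (window W len p ta t) \<and>
                real n \<le> C * N \<and> real m \<le> real (T n) + C))))"
proof (intro exI[of _ "sketch_prog (nat \<lfloor>2 powr d\<rfloor>)"] exI[of _ "1000 * (64 powr d + 2)"] conjI allI impI)
  show "0 < 1000 * (64 powr d + 2)" by (simp add: add_pos_pos)
next
  fix M :: "'a set" and \<delta> k z and \<epsilon> \<Delta>min \<Delta>max \<sigma> W :: real and len p ta and c :: real and A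
    and T :: "nat \<Rightarrow> nat"
  assume asm: "Metric_space M \<delta> \<and> doubling_dimension M \<delta> d \<and>
       1 \<le> k \<and> 0 < \<epsilon> \<and> \<epsilon> < 1 \<and>
       window_stream M W len p ta \<and>
       0 < \<Delta>min \<and> \<Delta>min \<le> \<Delta>max \<and> \<sigma> = \<Delta>max / \<Delta>min \<and>
       (\<forall>i j. enat i < len \<and> enat j < len \<and> p i \<noteq> p j \<longrightarrow>
          \<Delta>min \<le> \<delta> (p i) (p j) \<and> \<delta> (p i) (p j) \<le> \<Delta>max) \<and>
       static_approx M \<delta> k z c A"
  have "M \<noteq> {}"
  proof
    assume "M = {}"
    \<comment> \<open>In an empty space every exponent is a doubling bound, which contradicts the
      minimality of \<open>d\<close>.\<close>
    then have "doubling_bound M \<delta> (d - 1)" by (simp add: doubling_bound_def)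
    then show False using asm unfolding doubling_dimension_def by force
  qed
  then interpret sliding_window M \<delta> d k z \<epsilon> \<Delta>min \<Delta>max W len p ta c A
    using asm by (intro sliding_window.intro sliding_window_axioms.intro)
      (auto simp: doubling_dimension_def)
  note defs = D_def[symmetric] N_def[symmetric] bound_def[symmetric]
  have \<sigma>: "\<sigma> = \<Delta>max / \<Delta>min" using asm by blast
  note inv = sketch_sketch_inv
  show "let N = real (kz k z) / \<epsilon> powr d;
            sketch = sketch_at \<delta> A T (sketch_prog (nat \<lfloor>2 powr d\<rfloor>)) (input_mem k z \<epsilon> \<Delta>min \<Delta>max W) W len p ta
        in
          (\<forall>t. \<exists>s. sketch t s) \<and>
          (\<forall>t s. sketch t s \<longrightarrow> real (storage s) \<le> 1000 * (64 powr d + 2) * (N * log_spread \<sigma>)) \<and>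
          (\<forall>t s i. sketch t s \<and> enat i < len \<and> next_event W len ta t (ta i + W) \<longrightarrow>
             (\<exists>m s'. exec \<delta> A T (on_departure (sketch_prog (nat \<lfloor>2 powr d\<rfloor>))) (load_time (ta i + W) s) m s' \<and>
                real m \<le> 1000 * (64 powr d + 2) * log_spread \<sigma>)) \<and>
          (\<forall>t s i. sketch t s \<and> enat i < len \<and> next_event W len ta t (ta i) \<longrightarrow>
             (\<exists>m s'. exec \<delta> A T (on_arrival (sketch_prog (nat \<lfloor>2 powr d\<rfloor>))) (load_arrival (ta i) (p i) s) m s' \<and>
                real m \<le> 1000 * (64 powr d + 2) * (N ^ 3 * log_spread \<sigma>))) \<and>
          (\<forall>t s. sketch t s \<longrightarrow>
             (\<exists>m s' n. exec \<delta> A T (on_report (sketch_prog (nat \<lfloor>2 powr d\<rfloor>))) (load_time t s) m s' \<and>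
                valid_solution M \<delta> k z (window W len p ta t)
                  (reported_centers k s') (reported_radius s') \<and>
                reported_radius s' \<le> (1 + \<epsilon>) * c * opt M \<delta> k z (window W len p ta t) \<and>
                real n \<le> 1000 * (64 powr d + 2) * N \<and> real m \<le> real (T n) + 1000 * (64 powr d + 2)))"
    unfolding Let_def defs \<sigma>
  proof (intro conjI allI impI)
    fix t show "\<exists>s. sketch T t s" by (rule sketch_exists)
  next
    fix t s assume "sketch T t s"
    then have "fits names B s" using inv fits_env unfolding sketch_inv_def by blast
    then have "storage s \<le> 3 * (card names * B)" using storage_le finite_names by blast
    then show "real (storage s) \<le> bound * (N * log_spread (\<Delta>max / \<Delta>min))"
      using costs(1) by (meson of_nat_le_iff order_trans)
  next
    fix t s i assume a: "sketch T t s \<and> enat i < len \<and> next_event W len ta t (ta i + W)"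
    obtain m s' where "exec \<delta> A T (on_departure (sketch_prog D)) (load_time (ta i + W) s) m s'" "m \<le> G * 13 + 4"
      using wp_departure[OF inv, of T t s i T] a unfolding wp_def by blast
    then show "\<exists>m s'. exec \<delta> A T (on_departure (sketch_prog D)) (load_time (ta i + W) s) m s' \<and>
        real m \<le> bound * log_spread (\<Delta>max / \<Delta>min)"
      using costs(2) by (meson of_nat_le_iff order_trans)
  next
    fix t s i assume a: "sketch T t s \<and> enat i < len \<and> next_event W len ta t (ta i)"
    obtain m s' where "exec \<delta> A T (on_arrival (sketch_prog D)) (load_arrival (ta i) (p i) s) m s'"
      "m \<le> G * (16 * L + 63) + 4"
      using wp_arrival[OF inv, of T t s i T] a unfolding wp_def by blast
    then show "\<exists>m s'. exec \<delta> A T (on_arrival (sketch_prog D)) (load_arrival (ta i) (p i) s) m s' \<and>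
        real m \<le> bound * (N ^ 3 * log_spread (\<Delta>max / \<Delta>min))"
      using costs(3) by (meson of_nat_le_iff order_trans)
  next
    fix t s assume "sketch T t s"
    from exec_report[OF inv[OF this], of T] obtain s' n where r:
      "exec \<delta> A T report_prog (load_time t s) (T n + 1) s'" "n \<le> L"
      "valid_solution M \<delta> k z (Q t) (reported_centers k s') (reported_radius s')"
      "reported_radius s' \<le> (1 + \<epsilon>) * c * opt M \<delta> k z (Q t)"
      by blast
    have "real n \<le> bound * N" using r(2) costs(4) by (meson of_nat_le_iff order_trans)
    moreover have "1 \<le> bound" by (simp add: bound_def add_increasing)
    ultimately show "\<exists>m s' n. exec \<delta> A T (on_report (sketch_prog D)) (load_time t s) m s' \<and>
        valid_solution M \<delta> k z (Q t) (reported_centers k s') (reported_radius s') \<and>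
        reported_radius s' \<le> (1 + \<epsilon>) * c * opt M \<delta> k z (Q t) \<and>
        real n \<le> bound * N \<and> real m \<le> real (T n) + bound"
      using r by (intro exI[of _ "T n + 1"] exI[of _ s'] exI[of _ n]) (simp add: sketch_prog_def)
  qed
qed

end
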